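(* Let $N\ge2$, $1\le p<1+\frac2N$, $u_0\in L^2(\mathbb T^N)$, and let $v\in L^\infty(\mathbb R_+;L^{\frac{2}{p-1}}(\mathbb T^N))$ be a divergence-free vector field (with $L^{\frac2{p-1}}=L^\infty$ if $p=1$). Then there exists $0<T\le1$, depending on $\sup_{t>0}\|v(t)\|_{L^{2/(p-1)}}$ and $\|u_0\|_{L^2}$ (and on $N,p$), such that the equation $$u_t+v\cdot\nabla u-\Delta u=|u|^p-\int_{\mathbb T^N}|u|^p\,dx\quad\text{on }\mathbb T^N\ (\text{periodic}),\qquad u(0)=u_0,$$ admits a mild solution $u$ on $[0,T]$, which is unique in $X_T$.
   Context: $\mathbb T^N=[0,1]^N$ is the $N$-torus. $e^{t\Delta}$ is the heat semigroup generated by the periodic Laplacian, i.e. the Fourier multiplier $e^{-4\pi^2t|\mathbf k|^2}$, $\mathbf k\in\mathbb Z^N$. Mild solution: a function $u\in C([0,T];L^2(\mathbb T^N))$ with $\nabla u(t)\in L^2(\mathbb T^N)$ for each $0<t\le T$ is a mild solution on $[0,T]$ with initial data $u_0$ if for $t\in[0,T]$ $$u(t)=e^{t\Delta}u_0+\int_0^te^{(t-\tau)\Delta}(|u|^p)\,d\tau-\int_0^te^{(t-\tau)\Delta}(v\cdot\nabla u)\,d\tau-\int_0^t\int_{\mathbb T^N}|u|^p\,dx\,d\tau,$$ the integrals being Bochner integrals. $X_T$ is the Banach space of $u\in C([0,T];L^2(\mathbb T^N))$ with $\sup_{0<t\le T}t^{1/2}\|\nabla u(t)\|_{L^2}<\infty$,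 with norm $\|u\|_{X_T}=\max\big(\sup_{0\le t\le T}\|u(t)\|_{L^2},\ \sup_{0<t\le T}t^{1/2}\|\nabla u(t)\|_{L^2}\big)$. *)

theory Defs
  imports "HOL-Probability.Probability"
begin

text \<open>
  The torus is the unit box with Lebesgue measure. Since functions on it only matter up to null
  sets, identification of opposite faces plays a role only for test functions, which are taken to
  be smooth periodic functions on the whole space.
\<close>

abbreviation torus :: "(real^'n) measure" where
  "torus \<equiv> lebesgue_on (cbox 0 1)"

lemma box_One: "cbox (0::real^'n) 1 = cbox 0 One"
proof -
  have "(1::real^'n) \<bullet> b = One \<bullet> b" if "b \<in> Basis" for b
  proof -
    have "(1::real^'n) \<bullet> b = 1" using that by (auto simp: Basis_vec_def inner_axis)
    then show ?thesis using that by simp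
  qed
  then have "(1::real^'n) = One" by (rule euclidean_eqI)
  then show ?thesis by simp
qed

lemma emeasure_torus: "emeasure (torus :: (real^'n) measure) (space torus) = 1"
  by (simp add: emeasure_restrict_space space_restrict_space emeasure_lborel_cbox_eq inner_Basis_inf_left box_One)

interpretation torus: prob_space "torus :: (real^'n) measure"
  by (rule prob_spaceI) (rule emeasure_torus)

lemma measure_torus [simp]: "measure torus (cbox 0 (1::real^'n)) = 1"
  using torus.prob_space by simp

definition square_integrable :: "(real^'n \<Rightarrow> 'b::euclidean_space) \<Rightarrow> bool" where
  "square_integrable f \<longleftrightarrow>
     f \<in> borel_measurable torus \<and> integrable torus (\<lambda>x. (norm (f x))\<^sup>2)"

lemma square_integrable_measurable_fun: "square_integrable f \<Longrightarrow> f \<in> borel_measurable torus"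
  by (simp add: square_integrable_def)

lemma square_integrable_bound:
  fixes f :: "real^'n \<Rightarrow> 'b::euclidean_space" and w :: "real^'n \<Rightarrow> 'c::euclidean_space"
  assumes "square_integrable w" "f \<in> borel_measurable torus" "AE x in torus. norm (f x) \<le> norm (w x)"
  shows "square_integrable f"
  unfolding square_integrable_def
proof
  have [measurable]: "f \<in> borel_measurable torus" by fact
  show "integrable torus (\<lambda>x. (norm (f x))\<^sup>2)"
  proof (rule Bochner_Integration.integrable_bound)
    show "integrable torus (\<lambda>x. (norm (w x))\<^sup>2)" using assms by (simp add: square_integrable_def)
    show "AE x in torus. norm ((norm (f x))\<^sup>2) \<le> norm ((norm (w x))\<^sup>2)"
      using assms(3) by eventually_elim (auto intro: power_mono)
  qed measurable
qed fact

lemma square_integrable_scaleR [intro]: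
  "square_integrable f \<Longrightarrow> square_integrable (\<lambda>x. c *\<^sub>R f x)"
  by (auto simp: square_integrable_def power_mult_distrib)

lemma square_integrable_const [intro]: "square_integrable (\<lambda>_. c)"
  by (simp add: square_integrable_def)

lemma square_integrable_add [intro]:
  assumes "square_integrable f" "square_integrable g"
  shows "square_integrable (\<lambda>x. f x + g x)"
  unfolding square_integrable_def
proof
  have [measurable]: "f \<in> borel_measurable torus" "g \<in> borel_measurable torus"
    using assms by (auto simp: square_integrable_def)
  show "(\<lambda>x. f x + g x) \<in> borel_measurable torus" by measurable
  show "integrable torus (\<lambda>x. (norm (f x + g x))\<^sup>2)"
  proof (rule Bochner_Integration.integrable_bound)
    show "integrable torus (\<lambda>x. 2 * (norm (f x))\<^sup>2 + 2 * (norm (g x))\<^sup>2)"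
      using assms by (auto simp: square_integrable_def)
    have "(norm (f x + g x))\<^sup>2 \<le> 2 * (norm (f x))\<^sup>2 + 2 * (norm (g x))\<^sup>2" for x
    proof -
      have "(norm (f x + g x))\<^sup>2 \<le> (norm (f x) + norm (g x))\<^sup>2"
        by (intro power_mono norm_triangle_ineq norm_ge_zero)
      also have "\<dots> \<le> 2 * (norm (f x))\<^sup>2 + 2 * (norm (g x))\<^sup>2"
        using zero_le_power2[of "norm (f x) - norm (g x)"] by (simp add: power2_eq_square algebra_simps)
      finally show ?thesis .
    qed
    then show "AE x in torus. norm ((norm (f x + g x))\<^sup>2) \<le> norm (2 * (norm (f x))\<^sup>2 + 2 * (norm (g x))\<^sup>2)"
      by auto
  qed measurable
qed

lemma square_integrable_minus [intro]: "square_integrable f \<Longrightarrow> square_integrable (\<lambda>x. - f x)"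
  using square_integrable_scaleR[of f "-1"] by simp

lemma square_integrable_diff [intro]:
  "square_integrable f \<Longrightarrow> square_integrable g \<Longrightarrow> square_integrable (\<lambda>x. f x - g x)"
  using square_integrable_add[OF _ square_integrable_minus, of f g] by simp

lemma square_integrable_inner [intro]:
  assumes "square_integrable f" "square_integrable g"
  shows "integrable torus (\<lambda>x. f x \<bullet> g x)"
proof -
  have "integrable torus (\<lambda>x. ((norm (f x + g x))\<^sup>2 - (norm (f x))\<^sup>2 - (norm (g x))\<^sup>2) / 2)"
    using assms square_integrable_add[OF assms]
    by (intro integrable_divide Bochner_Integration.integrable_diff) (auto simp: square_integrable_def)
  then show ?thesis by (simp add: dot_norm algebra_simps)
qed

definition eq_L2 :: "(real^'n \<Rightarrow> 'b::euclidean_space) \<Rightarrow> (real^'n \<Rightarrow> 'b) \<Rightarrow> bool" where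
  "eq_L2 f g \<longleftrightarrow> square_integrable f \<and> square_integrable g \<and> (AE x in torus. f x = g x)"

lemma part_equivp_eq_L2: "part_equivp eq_L2"
proof (rule part_equivpI)
  show "\<exists>f. eq_L2 f f"
    by (rule exI[of _ "\<lambda>_. 0"]) (auto simp: eq_L2_def)
  show "symp eq_L2" by (auto simp: symp_def eq_L2_def)
  show "transp eq_L2" unfolding transp_def eq_L2_def by (auto elim: eventually_elim2)
qed

text \<open>
  The Hilbert space of square integrable functions on the torus modulo equality almost everywhere;
  \<open>abs_L2\<close> forms the class of a function and \<open>rep_L2\<close> picks a representative. The instances
  \<open>banach\<close> and \<open>second_countable_topology\<close> below make the library's Bochner integral
  available for functions with values in this space.
\<close>

quotient_type (overloaded) ('n, 'b) L2 = "real^'n \<Rightarrow> 'b::euclidean_space" / partial: eq_L2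
  by (rule part_equivp_eq_L2)

lemma square_integrable_rep [intro]: "square_integrable (rep_L2 f)"
  using Quotient3_rep_reflp[OF Quotient3_L2, of f] by (simp add: eq_L2_def)

lemma abs_rep_L2 [simp]: "abs_L2 (rep_L2 f) = f"
  by (rule Quotient3_abs_rep[OF Quotient3_L2])

lemma rep_L2_measurable [measurable]: "rep_L2 f \<in> borel_measurable torus"
  by (rule square_integrable_measurable_fun) auto

lemma rep_abs_L2:
  assumes "square_integrable f"
  shows "AE x in torus. rep_L2 (abs_L2 f) x = f x"
proof -
  have "eq_L2 f f" using assms by (simp add: eq_L2_def)
  then have "eq_L2 (rep_L2 (abs_L2 f)) f"
    by (rule rep_abs_rsp_left[OF Quotient3_L2])
  then show ?thesis by (simp add: eq_L2_def)
qed

lemma abs_L2_eqI: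
  assumes "square_integrable f" "square_integrable g" "AE x in torus. f x = g x"
  shows "abs_L2 f = abs_L2 g"
  using Quotient3_rel_abs[OF Quotient3_L2, of f g] assms by (simp add: eq_L2_def)

lemma L2_eqI: "AE x in torus. rep_L2 f x = rep_L2 g x \<Longrightarrow> f = g"
  using abs_L2_eqI[of "rep_L2 f" "rep_L2 g"] by auto

instantiation L2 :: (finite, euclidean_space) real_inner
begin

definition zero_L2 :: "('a, 'b) L2" where "zero_L2 = abs_L2 (\<lambda>_. 0)"
definition plus_L2 :: "('a, 'b) L2 \<Rightarrow> ('a, 'b) L2 \<Rightarrow> ('a, 'b) L2" where
  "plus_L2 f g = abs_L2 (\<lambda>x. rep_L2 f x + rep_L2 g x)"
definition uminus_L2 :: "('a, 'b) L2 \<Rightarrow> ('a, 'b) L2" where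
  "uminus_L2 f = abs_L2 (\<lambda>x. - rep_L2 f x)"
definition minus_L2 :: "('a, 'b) L2 \<Rightarrow> ('a, 'b) L2 \<Rightarrow> ('a, 'b) L2" where
  "minus_L2 f g = abs_L2 (\<lambda>x. rep_L2 f x - rep_L2 g x)"
definition scaleR_L2 :: "real \<Rightarrow> ('a, 'b) L2 \<Rightarrow> ('a, 'b) L2" where
  "scaleR_L2 c f = abs_L2 (\<lambda>x. c *\<^sub>R rep_L2 f x)"
definition inner_L2 :: "('a, 'b) L2 \<Rightarrow> ('a, 'b) L2 \<Rightarrow> real" where
  "inner_L2 f g = (LINT x|torus. rep_L2 f x \<bullet> rep_L2 g x)"
definition norm_L2 :: "('a, 'b) L2 \<Rightarrow> real" where
  "norm_L2 f = sqrt (LINT x|torus. (norm (rep_L2 f x))\<^sup>2)"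
definition sgn_L2 :: "('a, 'b) L2 \<Rightarrow> ('a, 'b) L2" where
  "sgn_L2 f = inverse (norm f) *\<^sub>R f"
definition dist_L2 :: "('a, 'b) L2 \<Rightarrow> ('a, 'b) L2 \<Rightarrow> real" where
  "dist_L2 f g = norm (f - g)"
definition uniformity_L2 :: "(('a, 'b) L2 \<times> ('a, 'b) L2) filter" where
  "uniformity_L2 = (INF e\<in>{0<..}. principal {(x, y). dist x y < e})"
definition open_L2 :: "('a, 'b) L2 set \<Rightarrow> bool" where
  "open_L2 U = (\<forall>x\<in>U. eventually (\<lambda>(x', y). x' = x \<longrightarrow> y \<in> U) uniformity)"

lemma rep_zero_L2: "AE x in torus. rep_L2 (0 :: ('a, 'b) L2) x = 0"
  unfolding zero_L2_def by (rule rep_abs_L2) auto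
lemma rep_plus_L2: "AE x in torus. rep_L2 (f + g :: ('a, 'b) L2) x = rep_L2 f x + rep_L2 g x"
  unfolding plus_L2_def by (rule rep_abs_L2) auto
lemma rep_uminus_L2: "AE x in torus. rep_L2 (- f :: ('a, 'b) L2) x = - rep_L2 f x"
  unfolding uminus_L2_def by (rule rep_abs_L2) auto
lemma rep_minus_L2: "AE x in torus. rep_L2 (f - g :: ('a, 'b) L2) x = rep_L2 f x - rep_L2 g x"
  unfolding minus_L2_def by (rule rep_abs_L2) auto
lemma rep_scaleR_L2: "AE x in torus. rep_L2 (c *\<^sub>R f :: ('a, 'b) L2) x = c *\<^sub>R rep_L2 f x"
  unfolding scaleR_L2_def by (rule rep_abs_L2) auto

instance
proof
  fix f g h :: "('a, 'b) L2" and a b :: real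
  show "f + g + h = f + (g + h)"
    by (rule L2_eqI) (use rep_plus_L2[of f g] rep_plus_L2[of "f+g" h] rep_plus_L2[of g h]
        rep_plus_L2[of f "g+h"] in eventually_elim, simp add: algebra_simps)
  show "f + g = g + f"
    by (simp add: plus_L2_def add.commute)
  show "0 + f = f"
    by (rule L2_eqI) (use rep_plus_L2[of 0 f] rep_zero_L2 in eventually_elim, simp)
  show "- f + f = 0"
    by (rule L2_eqI) (use rep_plus_L2[of "- f" f] rep_uminus_L2[of f] rep_zero_L2 in eventually_elim, simp)
  show "f - g = f + - g"
    by (rule L2_eqI) (use rep_plus_L2[of f "- g"] rep_uminus_L2[of g] rep_minus_L2[of f g] in eventually_elim, simp)
  show "a *\<^sub>R (f + g) = a *\<^sub>R f + a *\<^sub>R g"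
    by (rule L2_eqI) (use rep_scaleR_L2[of a "f+g"] rep_plus_L2[of f g] rep_scaleR_L2[of a f]
       rep_scaleR_L2[of a g] rep_plus_L2[of "a *\<^sub>R f" "a *\<^sub>R g"] in eventually_elim, simp add: algebra_simps)
  show "(a + b) *\<^sub>R f = a *\<^sub>R f + b *\<^sub>R f"
    by (rule L2_eqI) (use rep_scaleR_L2[of "a+b" f] rep_scaleR_L2[of a f] rep_scaleR_L2[of b f]
        rep_plus_L2[of "a *\<^sub>R f" "b *\<^sub>R f"] in eventually_elim, simp add: algebra_simps)
  show "a *\<^sub>R b *\<^sub>R f = (a * b) *\<^sub>R f"
    by (rule L2_eqI) (use rep_scaleR_L2[of "a*b" f] rep_scaleR_L2[of b f] rep_scaleR_L2[of a "b *\<^sub>R f"]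
        in eventually_elim, simp)
  show "1 *\<^sub>R f = f"
    by (simp add: scaleR_L2_def)
  show "sgn f = inverse (norm f) *\<^sub>R f" by (rule sgn_L2_def)
  show "dist f g = norm (f - g)" by (rule dist_L2_def)
  show "(uniformity :: (('a, 'b) L2 \<times> ('a, 'b) L2) filter)
      = (INF e\<in>{0<..}. principal {(x, y). dist x y < e})" by (rule uniformity_L2_def)
  show "open U = (\<forall>x\<in>U. eventually (\<lambda>(x', y). x' = x \<longrightarrow> y \<in> U) uniformity)"
    for U :: "('a, 'b) L2 set" by (rule open_L2_def)
  show "f \<bullet> g = g \<bullet> f" by (simp add: inner_L2_def inner_commute)
  have "(f + g) \<bullet> h = (LINT x|torus. rep_L2 f x \<bullet> rep_L2 h x + rep_L2 g x \<bullet> rep_L2 h x)"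
    unfolding inner_L2_def
    by (rule integral_cong_AE) (measurable, use rep_plus_L2[of f g] in eventually_elim, simp add: inner_add_left)
  also have "\<dots> = f \<bullet> h + g \<bullet> h"
    unfolding inner_L2_def by (rule Bochner_Integration.integral_add) auto
  finally show "(f + g) \<bullet> h = f \<bullet> h + g \<bullet> h" .
  have "(a *\<^sub>R f) \<bullet> g = (LINT x|torus. a * (rep_L2 f x \<bullet> rep_L2 g x))"
    unfolding inner_L2_def
    by (rule integral_cong_AE) (measurable, use rep_scaleR_L2[of a f] in eventually_elim, simp)
  then show "(a *\<^sub>R f) \<bullet> g = a * (f \<bullet> g)" by (simp add: inner_L2_def)
  show "0 \<le> f \<bullet> f" by (simp add: inner_L2_def)
  show "norm f = sqrt (f \<bullet> f)" by (simp add: inner_L2_def norm_L2_def dot_square_norm)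
  show "f \<bullet> f = 0 \<longleftrightarrow> f = 0"
  proof
    assume "f \<bullet> f = 0"
    then have *: "AE x in torus. rep_L2 f x \<bullet> rep_L2 f x = 0"
      unfolding inner_L2_def by (subst (asm) integral_nonneg_eq_0_iff_AE) auto
    then show "f = 0"
      by (intro L2_eqI) (use * rep_zero_L2 in eventually_elim, simp)
  next
    assume "f = 0"
    have "(LINT x|torus. rep_L2 (0 :: ('a, 'b) L2) x \<bullet> rep_L2 (0 :: ('a, 'b) L2) x) = (LINT x|(torus :: (real^'a) measure). 0)"
      by (rule integral_cong_AE) (measurable, use rep_zero_L2 in eventually_elim, simp)
    then show "f \<bullet> f = 0" by (simp add: inner_L2_def \<open>f = 0\<close>)
  qed
qed

end

lemma norm_L2_sq: "(norm f)\<^sup>2 = (LINT x|torus. (norm (rep_L2 f x))\<^sup>2)"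
  by (simp add: norm_L2_def)

lemma norm_abs_L2:
  assumes "square_integrable f"
  shows "norm (abs_L2 f) = sqrt (LINT x|torus. (norm (f x))\<^sup>2)"
proof -
  have [measurable]: "f \<in> borel_measurable torus"
    using assms by (auto simp: square_integrable_def)
  have "(LINT x|torus. (norm (rep_L2 (abs_L2 f) x))\<^sup>2) = (LINT x|torus. (norm (f x))\<^sup>2)"
    by (rule integral_cong_AE) (measurable, use rep_abs_L2[OF assms] in eventually_elim, simp)
  then show ?thesis by (simp add: norm_L2_def)
qed

lemma minus_abs_L2:
  assumes "square_integrable f" "square_integrable g"
  shows "abs_L2 f - abs_L2 g = abs_L2 (\<lambda>x. f x - g x)"
  unfolding minus_L2_def
  by (rule abs_L2_eqI) (use assms rep_abs_L2[OF assms(1)] rep_abs_L2[OF assms(2)] in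
      \<open>auto elim: eventually_elim2\<close>)

lemma tendsto_abs_L2:
  fixes F :: "nat \<Rightarrow> real^'n \<Rightarrow> 'b::euclidean_space" and w :: "real^'n \<Rightarrow> 'c::euclidean_space"
  assumes w: "square_integrable w"
    and [measurable]: "\<And>k. F k \<in> borel_measurable torus" "f \<in> borel_measurable torus"
    and bd: "\<And>k. AE x in torus. norm (F k x) \<le> norm (w x)"
    and lim: "AE x in torus. (\<lambda>k. F k x) \<longlonglongrightarrow> f x"
  shows "square_integrable f" "(\<lambda>k. abs_L2 (F k)) \<longlonglongrightarrow> abs_L2 f"
proof -
  have bd': "AE x in torus. \<forall>k. norm (F k x) \<le> norm (w x)"
    using bd by (simp add: AE_all_countable)
  then have bf: "AE x in torus. norm (f x) \<le> norm (w x)"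
    using lim
  proof eventually_elim
    case (elim x)
    then show ?case by (intro tendsto_upperbound[OF tendsto_norm[OF elim(2)]]) auto
  qed
  show f: "square_integrable f" by (rule square_integrable_bound[OF w _ bf]) simp
  have F: "square_integrable (F k)" for k by (rule square_integrable_bound[OF w _ bd]) simp
  have "(\<lambda>k. LINT x|torus. (norm (F k x - f x))\<^sup>2) \<longlonglongrightarrow> (LINT x|(torus :: (real^'n) measure). 0)"
  proof (rule integral_dominated_convergence[where w = "\<lambda>x. 4 * (norm (w x))\<^sup>2"])
    show "integrable torus (\<lambda>x. 4 * (norm (w x))\<^sup>2)" using w by (auto simp: square_integrable_def)
    show "AE x in torus. (\<lambda>k. (norm (F k x - f x))\<^sup>2) \<longlonglongrightarrow> 0"
      using lim
    proof eventually_elim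
      case (elim x)
      then have "(\<lambda>k. (norm (F k x - f x))\<^sup>2) \<longlonglongrightarrow> (norm (f x - f x))\<^sup>2"
        by (intro tendsto_intros)
      then show ?case by simp
    qed
    show "AE x in torus. norm ((norm (F k x - f x))\<^sup>2) \<le> 4 * (norm (w x))\<^sup>2" for k
      using bd[of k] bf
    proof eventually_elim
      case (elim x)
      then have "norm (F k x - f x) \<le> 2 * norm (w x)"
        using norm_triangle_ineq4[of "F k x" "f x"] by linarith
      then have "(norm (F k x - f x))\<^sup>2 \<le> (2 * norm (w x))\<^sup>2" by (intro power_mono) auto
      then show ?case by (simp add: power_mult_distrib)
    qed
  qed measurable
  then have "(\<lambda>k. sqrt (LINT x|torus. (norm (F k x - f x))\<^sup>2)) \<longlonglongrightarrow> sqrt 0"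
    by (intro tendsto_intros) simp
  then have "(\<lambda>k. norm (abs_L2 (F k) - abs_L2 f)) \<longlonglongrightarrow> 0"
    by (simp add: minus_abs_L2 norm_abs_L2 F f square_integrable_diff)
  then show "(\<lambda>k. abs_L2 (F k)) \<longlonglongrightarrow> abs_L2 f"
    using LIM_zero_cancel tendsto_norm_zero_iff by blast
qed


instance L2 :: (finite, euclidean_space) banach
proof
  fix X :: "nat \<Rightarrow> ('a, 'b) L2"
  assume X: "Cauchy X"
  have "\<exists>N. \<forall>m\<ge>N. \<forall>n\<ge>N. norm (X m - X n) < (1/4)^k" for k
    using CauchyD[OF X, of "(1/4)^k"] by auto
  then obtain N where N: "\<And>k m n. m \<ge> N k \<Longrightarrow> n \<ge> N k \<Longrightarrow> norm (X m - X n) < (1/4)^k"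
    by metis
  define r where "r k = k + (\<Sum>i\<le>k. N i)" for k
  have r_ge: "r k \<ge> N k" for k
    unfolding r_def using member_le_sum[of k "{..k}" N] by simp
  have r_strict: "strict_mono r"
    by (rule strict_mono_Suc_iff[THEN iffD2]) (simp add: r_def)
  define F where "F k = rep_L2 (X (r k))" for k
  have F_si [intro]: "square_integrable (F k)" for k by (auto simp: F_def)
  have F_meas [measurable]: "F k \<in> borel_measurable torus" for k by (simp add: F_def)
  have F_norm: "norm (X m - X (r k)) = sqrt (LINT x|torus. (norm (rep_L2 (X m) x - F k x))\<^sup>2)" for m k
    unfolding F_def minus_L2_def by (rule norm_abs_L2) auto
  have F_diff: "(LINT x|torus. (norm (F (Suc k) x - F k x))\<^sup>2) \<le> (1/16)^k" for k
  proof -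
    have "norm (X (r (Suc k)) - X (r k)) < (1/4)^k"
      using r_ge[of k] strict_monoD[OF r_strict, of k "Suc k"] by (intro N) auto
    then have "(norm (X (r (Suc k)) - X (r k)))\<^sup>2 \<le> ((1/4)^k)\<^sup>2"
      by (intro power_mono) auto
    also have "((1/4)^k)\<^sup>2 = ((1/16)^k :: real)"
      by (simp add: power2_eq_square flip: power_mult_distrib)
    finally show ?thesis by (simp add: F_norm F_def[symmetric])
  qed
  have F_int: "integrable torus (\<lambda>x. (norm (F (Suc k) x - F k x))\<^sup>2)" for k
    using square_integrable_diff[OF F_si F_si] by (auto simp: square_integrable_def)
  have L1: "(\<integral>\<^sup>+x. ennreal (norm (F (Suc k) x - F k x)) \<partial>torus) \<le> ennreal (2 * (1/2)^k)" for k
  proof -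
    have young: "y \<le> 2^k * y\<^sup>2 + (1/2)^k" if "y \<ge> 0" for y :: real
    proof (cases "y \<le> (1/2)^k")
      case True
      moreover have "0 \<le> 2^k * y\<^sup>2" by simp
      ultimately show ?thesis by linarith
    next
      case False
      then have "(2^k * y) * (1/2)^k \<le> (2^k * y) * y" using that by (intro mult_left_mono) auto
      moreover have "(2^k * y) * (1/2)^k = y" by (simp add: power_one_over)
      moreover have "0 \<le> (1/2::real)^k" by simp
      moreover have "2^k * y\<^sup>2 = (2^k * y) * y" by (simp add: power2_eq_square)
      ultimately show ?thesis by linarith
    qed
    have "(\<integral>\<^sup>+x. ennreal (norm (F (Suc k) x - F k x)) \<partial>torus)
        \<le> (\<integral>\<^sup>+x. ennreal (2^k * (norm (F (Suc k) x - F k x))\<^sup>2 + (1/2)^k) \<partial>torus)"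
      by (intro nn_integral_mono ennreal_leI young) simp
    also have "\<dots> = ennreal (LINT x|torus. 2^k * (norm (F (Suc k) x - F k x))\<^sup>2 + (1/2)^k)"
      by (rule nn_integral_eq_integral) (use F_int in auto)
    also have "(LINT x|torus. 2^k * (norm (F (Suc k) x - F k x))\<^sup>2 + (1/2)^k)
       = 2^k * (LINT x|torus. (norm (F (Suc k) x - F k x))\<^sup>2) + (1/2)^k"
      using F_int by simp
    also have "ennreal \<dots> \<le> ennreal (2 * (1/2)^k)"
    proof (rule ennreal_leI)
      have "2^k * (LINT x|torus. (norm (F (Suc k) x - F k x))\<^sup>2) \<le> 2^k * (1/16)^k"
        by (intro mult_left_mono F_diff) auto
      also have "\<dots> = (1/8::real)^k" by (simp flip: power_mult_distrib)
      also have "\<dots> \<le> (1/2)^k" by (rule power_mono) auto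
      finally show "2^k * (LINT x|torus. (norm (F (Suc k) x - F k x))\<^sup>2) + (1/2)^k \<le> 2 * (1/2)^k" by simp
    qed
    finally show ?thesis .
  qed
  have "(\<integral>\<^sup>+x. (\<Sum>k. ennreal (norm (F (Suc k) x - F k x))) \<partial>torus)
      = (\<Sum>k. \<integral>\<^sup>+x. ennreal (norm (F (Suc k) x - F k x)) \<partial>torus)"
    by (rule nn_integral_suminf) measurable
  also have "\<dots> \<le> (\<Sum>k. ennreal (2 * (1/2)^k))"
    by (intro suminf_le L1) auto
  also have "\<dots> < \<infinity>"
    by (subst suminf_ennreal2) (auto intro!: summable_mult)
  finally have "AE x in torus. (\<Sum>k. ennreal (norm (F (Suc k) x - F k x))) \<noteq> \<infinity>"
    by (intro nn_integral_noteq_infinite) auto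
  then have conv: "AE x in torus. convergent (\<lambda>k. F k x)"
  proof eventually_elim
    case (elim x)
    then have "summable (\<lambda>k. norm (F (Suc k) x - F k x))"
      by (intro summable_suminf_not_top) auto
    then have "summable (\<lambda>k. F (Suc k) x - F k x)" by (rule summable_norm_cancel)
    then have "convergent (\<lambda>n. \<Sum>k<n. F (Suc k) x - F k x)" by (simp add: summable_iff_convergent)
    then have "convergent (\<lambda>n. F n x - F 0 x)" by (simp add: sum_lessThan_telescope[of "\<lambda>n. F n x"])
    then have "convergent (\<lambda>n. (F n x - F 0 x) + F 0 x)" by (intro convergent_add convergent_const)
    then show ?case by simp
  qed
  define G where "G x = lim (\<lambda>k. F k x)" for x
  have G_meas [measurable]: "G \<in> borel_measurable torus" unfolding G_def by measurable
  have lim: "AE x in torus. (\<lambda>k. F k x) \<longlonglongrightarrow> G x"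
    using conv by eventually_elim (simp add: G_def convergent_LIMSEQ_iff)
  have close: "(\<integral>\<^sup>+x. ennreal ((norm (G x - F k x))\<^sup>2) \<partial>torus) \<le> ennreal (((1/4)^k)\<^sup>2)" for k
  proof -
    have "(\<integral>\<^sup>+x. ennreal ((norm (G x - F k x))\<^sup>2) \<partial>torus)
        = (\<integral>\<^sup>+x. liminf (\<lambda>m. ennreal ((norm (F m x - F k x))\<^sup>2)) \<partial>torus)"
    proof (rule nn_integral_cong_AE)
      show "AE x in torus. ennreal ((norm (G x - F k x))\<^sup>2) = liminf (\<lambda>m. ennreal ((norm (F m x - F k x))\<^sup>2))"
        using lim
      proof eventually_elim
        case (elim x)
        then have "(\<lambda>m. ennreal ((norm (F m x - F k x))\<^sup>2)) \<longlonglongrightarrow> ennreal ((norm (G x - F k x))\<^sup>2)"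
          by (intro tendsto_ennrealI tendsto_intros)
        then show ?case by (intro lim_imp_Liminf[symmetric]) simp_all
      qed
    qed
    also have "\<dots> \<le> liminf (\<lambda>m. \<integral>\<^sup>+x. ennreal ((norm (F m x - F k x))\<^sup>2) \<partial>torus)"
      by (rule nn_integral_liminf) measurable
    also have "\<dots> \<le> ennreal (((1/4)^k)\<^sup>2)"
    proof (rule Liminf_le)
      show "\<forall>\<^sub>F m in sequentially. (\<integral>\<^sup>+x. ennreal ((norm (F m x - F k x))\<^sup>2) \<partial>torus) \<le> ennreal (((1/4)^k)\<^sup>2)"
        using eventually_ge_at_top[of k]
      proof eventually_elim
        case (elim m)
        have int: "integrable torus (\<lambda>x. (norm (F m x - F k x))\<^sup>2)"
          using square_integrable_diff[OF F_si F_si] by (auto simp: square_integrable_def)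
        have "norm (X (r m) - X (r k)) < (1/4)^k"
          using r_ge[of k] elim strict_mono_less_eq[OF r_strict, of k m] by (intro N) auto
        then have "(norm (X (r m) - X (r k)))\<^sup>2 \<le> ((1/4)^k)\<^sup>2" by (intro power_mono) auto
        then show ?case
          by (subst nn_integral_eq_integral[OF int]) (auto simp: F_norm F_def[symmetric])
      qed
    qed simp
    finally show ?thesis .
  qed
  have GF: "square_integrable (\<lambda>x. G x - F k x)" for k
    unfolding square_integrable_def integrable_iff_bounded
    using le_less_trans[OF close[of k] ennreal_less_top] by auto
  have G: "square_integrable G"
    using square_integrable_add[OF GF[of 0] F_si[of 0]] by simp
  have "norm (abs_L2 G - X (r k)) \<le> (1/4)^k" for k
  proof -
    have "abs_L2 G - X (r k) = abs_L2 (\<lambda>x. G x - F k x)"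
      using minus_abs_L2[OF G F_si[of k]] by (simp add: F_def)
    then have "(norm (abs_L2 G - X (r k)))\<^sup>2 = (LINT x|torus. (norm (G x - F k x))\<^sup>2)"
      by (simp add: norm_abs_L2[OF GF])
    also have "ennreal \<dots> \<le> ennreal (((1/4)^k)\<^sup>2)"
      using close[of k] by (subst (asm) nn_integral_eq_integral) (use GF in \<open>auto simp: square_integrable_def\<close>)
    finally have "(norm (abs_L2 G - X (r k)))\<^sup>2 \<le> ((1/4)^k)\<^sup>2" by simp
    then show ?thesis by (rule power2_le_imp_le) simp
  qed
  then have "(\<lambda>k. norm (abs_L2 G - X (r k))) \<longlonglongrightarrow> 0"
    by (intro tendsto_sandwich[OF _ _ tendsto_const LIMSEQ_power_zero[of "1/4::real"]]) auto
  then have lim_r: "(\<lambda>k. X (r k)) \<longlonglongrightarrow> abs_L2 G"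
    by (simp add: tendsto_dist_iff[of _ "abs_L2 G"] dist_norm norm_minus_commute)
  have "X \<longlonglongrightarrow> abs_L2 G"
  proof (rule metric_LIMSEQ_I)
    fix e :: real assume "e > 0"
    then obtain M where M: "\<And>m n. m \<ge> M \<Longrightarrow> n \<ge> M \<Longrightarrow> dist (X m) (X n) < e / 2"
      using metric_CauchyD[OF X, of "e/2"] by auto
    obtain K where K: "\<And>k. k \<ge> K \<Longrightarrow> dist (X (r k)) (abs_L2 G) < e / 2"
      using metric_LIMSEQ_D[OF lim_r, of "e/2"] \<open>e > 0\<close> by auto
    have "dist (X n) (abs_L2 G) < e" if "n \<ge> M" for n
    proof -
      have "r (max K M) \<ge> M" using seq_suble[OF r_strict, of "max K M"] by linarith
      then have "dist (X n) (X (r (max K M))) < e / 2" using that M by blast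
      moreover have "dist (X (r (max K M))) (abs_L2 G) < e / 2" by (rule K) simp
      ultimately show ?thesis
        using dist_triangle[of "X n" "abs_L2 G" "X (r (max K M))"] by linarith
    qed
    then show "\<exists>M. \<forall>n\<ge>M. dist (X n) (abs_L2 G) < e" by blast
  qed
  then show "convergent X" by (auto simp: convergent_def)
qed


definition dyadic_index :: "nat \<Rightarrow> real^'n \<Rightarrow> int^'n" where
  "dyadic_index n x = (\<chi> i. \<lfloor>2 ^ n * x $ i\<rfloor>)"

definition dyadic_step :: "'b::euclidean_space set \<Rightarrow> nat \<Rightarrow> ((int^'n) \<times> nat) list \<Rightarrow> real^'n \<Rightarrow> 'b" where
  "dyadic_step Q n xs x =
     (case map_of xs (dyadic_index n x) of None \<Rightarrow> 0 | Some m \<Rightarrow> from_nat_into Q m)"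

lemma vec_nth_torus_measurable [measurable]: "(\<lambda>x. x $ i) \<in> borel_measurable (torus :: (real^'n) measure)"
  by (intro measurable_restrict_space1 measurable_completion) simp

lemma dyadic_index_measurable [measurable]:
  "dyadic_index n \<in> measurable torus (count_space UNIV)"
proof (subst measurable_count_space_eq2_countable; (intro conjI ballI)?)
  fix a :: "int^'n"
  have "dyadic_index n -` {a} \<inter> space torus = {x \<in> space torus. \<forall>i. \<lfloor>2 ^ n * x $ i\<rfloor> = a $ i}"
    by (auto simp: dyadic_index_def vec_eq_iff)
  also have "\<dots> \<in> sets torus" by measurable
  finally show "dyadic_index n -` {a} \<inter> space torus \<in> sets torus" .
qed auto

lemma dyadic_step_measurable [measurable]: "dyadic_step Q n xs \<in> borel_measurable torus"
  unfolding dyadic_step_def by (rule measurable_compose[OF dyadic_index_measurable]) simp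

lemma dyadic_index_tendsto: "(\<lambda>n. \<chi> i. real_of_int (dyadic_index n x $ i) / 2 ^ n) \<longlonglongrightarrow> x"
proof (rule vec_tendstoI)
  fix i
  have "(\<lambda>n. \<lfloor>2 ^ n * x $ i\<rfloor> / 2 ^ n) \<longlonglongrightarrow> x $ i"
  proof (rule tendsto_sandwich)
    have "(2 ^ n * x $ i - 1) / 2 ^ n \<le> \<lfloor>2 ^ n * x $ i\<rfloor> / 2 ^ n" for n
      by (intro divide_right_mono) (linarith, simp)
    then show "\<forall>\<^sub>F n in sequentially. x $ i - (1/2) ^ n \<le> \<lfloor>2 ^ n * x $ i\<rfloor> / 2 ^ n"
      by (auto simp: diff_divide_distrib power_one_over)
    have "\<lfloor>2 ^ n * x $ i\<rfloor> / 2 ^ n \<le> (2 ^ n * x $ i) / 2 ^ n" for n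
      by (intro divide_right_mono) (linarith, simp)
    then show "\<forall>\<^sub>F n in sequentially. \<lfloor>2 ^ n * x $ i\<rfloor> / 2 ^ n \<le> x $ i" by auto
    have "(\<lambda>n. x $ i - (1/2) ^ n) \<longlonglongrightarrow> x $ i - 0" by (intro tendsto_intros) auto
    then show "(\<lambda>n. x $ i - (1/2) ^ n) \<longlonglongrightarrow> x $ i" by simp
  qed simp
  then show "(\<lambda>n. (\<chi> i. real_of_int (dyadic_index n x $ i) / 2 ^ n) $ i) \<longlonglongrightarrow> x $ i"
    by (simp add: dyadic_index_def)
qed

lemma closure_dyadic_step_continuous:
  fixes g :: "real^'n \<Rightarrow> 'b::euclidean_space"
  assumes g: "continuous_on UNIV g" "\<And>x. norm (g x) \<le> B"
    and Q: "countable Q" "\<And>X. open X \<Longrightarrow> X \<noteq> {} \<Longrightarrow> \<exists>q\<in>Q. q \<in> X"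
  shows "abs_L2 g \<in> closure (range (\<lambda>(n, xs). abs_L2 (dyadic_step Q n xs)))"
proof -
  define y where "y n k = g (\<chi> i. real_of_int (k $ i) / 2 ^ n)" for n and k :: "int^'n"
  have "\<exists>m. dist (from_nat_into Q m) (y n k) < inverse (real (Suc n))" for n k
  proof -
    obtain q where "q \<in> Q" "q \<in> ball (y n k) (inverse (real (Suc n)))"
      using Q(2)[of "ball (y n k) (inverse (real (Suc n)))"] by auto
    then show ?thesis
      using from_nat_into_surj[OF Q(1), of q] by (auto simp: dist_commute)
  qed
  then obtain m where m: "\<And>n k. dist (from_nat_into Q (m n k)) (y n k) < inverse (real (Suc n))" by metis
  define K where "K n = {k :: int^'n. \<forall>i. k $ i \<in> {0..2^n}}" for n :: nat
  have "finite (K n)" for n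
  proof (rule finite_subset)
    show "K n \<subseteq> vec_lambda ` (PiE UNIV (\<lambda>_. {0..2^n}))"
    proof
      fix k assume "k \<in> K n"
      then have "vec_nth k \<in> PiE UNIV (\<lambda>_. {0..2^n :: int})" by (auto simp: K_def)
      then show "k \<in> vec_lambda ` (PiE UNIV (\<lambda>_. {0..2^n}))"
        by (intro image_eqI[of _ _ "vec_nth k"]) (auto simp: vec_nth_inverse)
    qed
  qed (intro finite_imageI finite_PiE, auto)
  then have "\<exists>ks. set ks = K n" for n by (simp add: finite_list)
  then obtain ks where ks: "\<And>n. set (ks n) = K n" by metis
  define F where "F n = dyadic_step Q n (map (\<lambda>k. (k, m n k)) (ks n))" for n
  have F: "F n x = (if dyadic_index n x \<in> K n then from_nat_into Q (m n (dyadic_index n x)) else 0)" for n x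
    by (simp add: F_def dyadic_step_def map_of_map_restrict ks restrict_map_def)
  have inK: "dyadic_index n x \<in> K n" if "x \<in> cbox 0 1" for n x
  proof -
    have "0 \<le> \<lfloor>2 ^ n * x $ i\<rfloor> \<and> \<lfloor>2 ^ n * x $ i\<rfloor> \<le> 2 ^ n" for i
    proof -
      have x: "0 \<le> x $ i" "x $ i \<le> 1" using that by (auto simp: mem_box_cart)
      then have "2 ^ n * x $ i \<le> 2 ^ n * 1" by (intro mult_left_mono) auto
      then have "\<lfloor>2 ^ n * x $ i\<rfloor> \<le> \<lfloor>2 ^ n :: real\<rfloor>" by (intro floor_mono) simp
      also have "\<lfloor>2 ^ n :: real\<rfloor> = 2 ^ n" by (metis floor_of_int of_int_numeral of_int_power)
      finally show ?thesis using x by simp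
    qed
    then show ?thesis by (simp add: K_def dyadic_index_def)
  qed
  have "B \<ge> 0" using norm_ge_zero[of "g 0"] g(2)[of 0] by linarith
  have "(\<lambda>n. abs_L2 (F n)) \<longlonglongrightarrow> abs_L2 g"
  proof (rule tendsto_abs_L2[where w = "\<lambda>_. B + 1"])
    show "g \<in> borel_measurable torus"
      by (intro measurable_restrict_space1 measurable_completion)
        (use borel_measurable_continuous_onI[OF g(1)] in simp)
    show "AE x in torus. norm (F n x) \<le> norm (B + 1)" for n
    proof (rule AE_I2)
      fix x
      have "norm (from_nat_into Q (m n k)) \<le> B + 1" for k
      proof -
        have "inverse (real (Suc n)) \<le> 1" by (simp add: field_simps)
        then have "norm (from_nat_into Q (m n k) - y n k) \<le> 1"
          using m[of n k] by (simp add: dist_norm)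
        moreover have "norm (y n k) \<le> B" using g(2) by (simp add: y_def)
        ultimately show ?thesis
          using norm_triangle_ineq[of "from_nat_into Q (m n k) - y n k" "y n k"] by simp
      qed
      then show "norm (F n x) \<le> norm (B + 1)" using \<open>B \<ge> 0\<close> by (simp add: F)
    qed
    show "AE x in torus. (\<lambda>n. F n x) \<longlonglongrightarrow> g x"
    proof (rule AE_I2)
      fix x :: "real^'n" assume "x \<in> space torus"
      then have x: "x \<in> cbox 0 1" by simp
      have "isCont g x" using g(1) by (simp add: continuous_on_eq_continuous_at)
      then have lim: "(\<lambda>n. y n (dyadic_index n x)) \<longlonglongrightarrow> g x"
        unfolding y_def by (rule isCont_tendsto_compose[OF _ dyadic_index_tendsto])
      have "(\<lambda>n. F n x - y n (dyadic_index n x)) \<longlonglongrightarrow> 0"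
      proof (rule Lim_null_comparison[OF _ LIMSEQ_inverse_real_of_nat])
        show "\<forall>\<^sub>F n in sequentially. norm (F n x - y n (dyadic_index n x)) \<le> inverse (real (Suc n))"
          using m inK[OF x] by (intro always_eventually) (auto simp: F dist_norm less_imp_le)
      qed
      from tendsto_add[OF this lim] show "(\<lambda>n. F n x) \<longlonglongrightarrow> g x" by simp
    qed
  qed (auto simp: F_def)
  then show ?thesis
    unfolding closure_sequential by (intro exI[of _ "\<lambda>n. abs_L2 (F n)"]) (auto simp: F_def)
qed

lemma closure_dyadic_step:
  fixes f :: "('n::finite, 'b::euclidean_space) L2"
  assumes Q: "countable Q" "\<And>X. open X \<Longrightarrow> X \<noteq> {} \<Longrightarrow> \<exists>q\<in>Q. q \<in> X"
  shows "f \<in> closure (range (\<lambda>(n, xs). abs_L2 (dyadic_step Q n xs)))" (is "_ \<in> closure ?D")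
proof -
  have closed: "a \<in> closure ?D" if "X \<longlonglongrightarrow> a" "\<And>n. X n \<in> closure ?D" for X :: "nat \<Rightarrow> ('n, 'b) L2" and a
    using closed_sequentially[OF closed_closure, of X "?D" a] that by blast
  have bounded: "abs_L2 h \<in> closure ?D"
    if [measurable]: "h \<in> borel_measurable torus" and h: "\<And>x. norm (h x) \<le> real m" for h :: "real^'n \<Rightarrow> 'b" and m
  proof -
    have "h measurable_on (cbox 0 1)"
      using that(1) by (subst measurable_on_iff_borel_measurable) auto
    then obtain N g where N: "negligible N" and g: "\<And>n. continuous_on UNIV (g n)"
      and lim: "\<And>x. x \<notin> N \<Longrightarrow> (\<lambda>n. g n x) \<longlonglongrightarrow> (if x \<in> cbox 0 1 then h x else 0)"
      unfolding measurable_on_def by blast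
    define P where "P = closest_point (cball (0::'b) (real m))"
    have P: "norm (P y) \<le> real m" for y
      using closest_point_in_set[of "cball (0::'b) (real m)" y] by (simp add: P_def)
    have P_id: "P y = y" if "norm y \<le> real m" for y
      using that by (simp add: P_def closest_point_self)
    have P_cont: "continuous_on UNIV P"
      unfolding P_def by (rule continuous_on_closest_point) auto
    have Pg_cont: "continuous_on UNIV (\<lambda>x. P (g n x))" for n
      by (rule continuous_on_compose2[OF P_cont g]) auto
    have "(\<lambda>n. abs_L2 (\<lambda>x. P (g n x))) \<longlonglongrightarrow> abs_L2 h"
    proof (rule tendsto_abs_L2[where w = "\<lambda>_. real m"])
      show "(\<lambda>x. P (g n x)) \<in> borel_measurable torus" for n
        by (intro measurable_restrict_space1 measurable_completion)
          (use borel_measurable_continuous_onI[OF Pg_cont] in simp)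
      have "AE x in lebesgue. x \<notin> N"
        using N by (simp add: negligible_iff_null_sets AE_not_in)
      then have "AE x in torus. x \<notin> N"
        by (subst AE_restrict_space_iff) auto
      moreover have "AE x in torus. x \<in> cbox 0 (1::real^'n)" by (rule AE_I2) simp
      ultimately show "AE x in torus. (\<lambda>n. P (g n x)) \<longlonglongrightarrow> h x"
      proof eventually_elim
        case (elim x)
        have "isCont P (h x)" using P_cont by (simp add: continuous_on_eq_continuous_at)
        moreover have "(\<lambda>n. g n x) \<longlonglongrightarrow> h x" using lim[OF elim(1)] elim(2) by simp
        ultimately have "(\<lambda>n. P (g n x)) \<longlonglongrightarrow> P (h x)" by (rule isCont_tendsto_compose)
        then show ?case using h by (simp add: P_id)
      qed
    qed (use P in auto)
    then show ?thesis
      by (rule closed) (rule closure_dyadic_step_continuous[OF Pg_cont P Q])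
  qed
  define h where "h m x = (if norm (rep_L2 f x) \<le> real m then rep_L2 f x else 0)" for m x
  have h_meas [measurable]: "h m \<in> borel_measurable torus" for m unfolding h_def by measurable
  have "(\<lambda>m. abs_L2 (h m)) \<longlonglongrightarrow> abs_L2 (rep_L2 f)"
  proof (rule tendsto_abs_L2[where w = "rep_L2 f"])
    show "AE x in torus. (\<lambda>m. h m x) \<longlonglongrightarrow> rep_L2 f x"
    proof (rule AE_I2)
      fix x
      obtain M where M: "norm (rep_L2 f x) \<le> real M" using real_arch_simple by blast
      have "\<forall>\<^sub>F m in sequentially. h m x = rep_L2 f x"
        using eventually_ge_at_top[of M]
      proof eventually_elim
        case (elim m)
        then have "norm (rep_L2 f x) \<le> real m" using M of_nat_mono[OF elim, where 'a=real] by linarith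
        then show ?case by (simp add: h_def)
      qed
      then show "(\<lambda>m. h m x) \<longlonglongrightarrow> rep_L2 f x" by (rule tendsto_eventually)
    qed
  qed (auto simp: h_def)
  then have "abs_L2 (rep_L2 f) \<in> closure ?D"
    by (rule closed) (rule bounded, auto simp: h_def)
  then show ?thesis by simp
qed

instance L2 :: (finite, euclidean_space) second_countable_topology
proof
  obtain Q :: "'b set" where Q: "countable Q" "\<And>X. open X \<Longrightarrow> X \<noteq> {} \<Longrightarrow> \<exists>q\<in>Q. q \<in> X"
    by (rule countable_dense_setE) blast
  define D :: "('a, 'b) L2 set" where "D = range (\<lambda>(n, xs). abs_L2 (dyadic_step Q n xs))"
  have "countable D" unfolding D_def by auto
  define B where "B = (\<lambda>(d, n). ball d (inverse (real (Suc n)))) ` (D \<times> UNIV)"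
  have "topological_basis B"
  proof (rule topological_basisI)
    fix U and f :: "('a, 'b) L2" assume "open U" "f \<in> U"
    then obtain e where e: "e > 0" "ball f e \<subseteq> U" by (meson openE)
    then obtain n where n: "inverse (real (Suc n)) < e / 2" using reals_Archimedean[of "e/2"] by auto
    have "f \<in> closure D" unfolding D_def by (rule closure_dyadic_step[OF Q])
    then obtain d where d: "d \<in> D" "dist d f < inverse (real (Suc n))"
      unfolding closure_approachable by (meson inverse_positive_iff_positive of_nat_0_less_iff zero_less_Suc)
    have "ball d (inverse (real (Suc n))) \<subseteq> ball f e"
    proof
      fix z assume "z \<in> ball d (inverse (real (Suc n)))"
      then show "z \<in> ball f e"
        using dist_triangle[of f z d] d(2) n by (simp add: dist_commute)
    qed
    then show "\<exists>B'\<in>B. f \<in> B' \<and> B' \<subseteq> U"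
      using d e(2) by (intro bexI[of _ "ball d (inverse (real (Suc n)))"]) (auto simp: B_def)
  qed (auto simp: B_def)
  moreover have "countable B" unfolding B_def using \<open>countable D\<close> by auto
  ultimately show "\<exists>B :: ('a, 'b) L2 set set. countable B \<and> open = generate_topology B"
    using topological_basis_imp_subbasis by blast
qed


text \<open>
  The norm of $L^q$ on the torus, \<open>1 \<le> q \<le> \<infinity>\<close>, for functions (not classes).
\<close>

definition torus_norm :: "ennreal \<Rightarrow> (real^'n \<Rightarrow> 'b::euclidean_space) \<Rightarrow> ennreal" where
  "torus_norm q f =
     (if q = \<infinity> then esssup torus (\<lambda>x. ennreal (norm (f x)))
      else let I = \<integral>\<^sup>+x. ennreal (norm (f x) powr enn2real q) \<partial>torus
           in if I = \<infinity> then \<infinity> else ennreal (enn2real I powr (1 / enn2real q)))"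

definition in_Lq :: "ennreal \<Rightarrow> (real^'n \<Rightarrow> 'b::euclidean_space) \<Rightarrow> bool" where
  "in_Lq q f \<longleftrightarrow> f \<in> borel_measurable torus \<and> torus_norm q f < \<infinity>"

text \<open>
  Bochner (strong) measurability of \<open>t \<mapsto> v t\<close> on the positive half-line with values in $L^q$:
  almost everywhere limit, in the norm of $L^q$, of functions with finitely many values.
\<close>

definition strongly_measurable_Lq :: "ennreal \<Rightarrow> (real \<Rightarrow> real^'n \<Rightarrow> 'b::euclidean_space) \<Rightarrow> bool" where
  "strongly_measurable_Lq q v \<longleftrightarrow>
     (\<exists>s. (\<forall>k. simple_function (lebesgue_on {0<..}) (s k)) \<and> (\<forall>k. \<forall>t>0. in_Lq q (s k t)) \<and>
          (AE t in lebesgue_on {0<..}. (\<lambda>k. torus_norm q (\<lambda>x. s k t x - v t x)) \<longlonglongrightarrow> 0))"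

definition Linf_Lq_norm :: "ennreal \<Rightarrow> (real \<Rightarrow> real^'n \<Rightarrow> 'b::euclidean_space) \<Rightarrow> ennreal" where
  "Linf_Lq_norm q v = esssup (lebesgue_on {0<..}) (\<lambda>t. torus_norm q (v t))"

definition in_Linf_Lq :: "ennreal \<Rightarrow> (real \<Rightarrow> real^'n \<Rightarrow> 'b::euclidean_space) \<Rightarrow> bool" where
  "in_Linf_Lq q v \<longleftrightarrow>
     (AE t in lebesgue_on {0<..}. in_Lq q (v t)) \<and> strongly_measurable_Lq q v \<and> Linf_Lq_norm q v < \<infinity>"

definition velocity_exponent :: "real \<Rightarrow> ennreal" where
  "velocity_exponent p = (if p = 1 then \<infinity> else ennreal (2 / (p - 1)))"

text \<open>
  Infinitely differentiable functions: being the greatest such class, it consists of the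
  differentiable functions all of whose partial derivatives belong to it again.
\<close>

coinductive smooth :: "(real^'n \<Rightarrow> real) \<Rightarrow> bool" where
  "(\<forall>x. GDERIV f x :> g x) \<Longrightarrow> (\<forall>i. smooth (\<lambda>x. g x $ i)) \<Longrightarrow> smooth f"

definition test_function :: "(real^'n \<Rightarrow> real) \<Rightarrow> (real^'n \<Rightarrow> real^'n) \<Rightarrow> bool" where
  "test_function \<phi> D \<longleftrightarrow>
     smooth \<phi> \<and> (\<forall>x i. \<phi> (x + axis i 1) = \<phi> x) \<and> (\<forall>x. GDERIV \<phi> x :> D x)"

definition divergence_free :: "(real^'n \<Rightarrow> real^'n) \<Rightarrow> bool" where
  "divergence_free w \<longleftrightarrow> (\<forall>\<phi> D. test_function \<phi> D \<longrightarrow> (LINT x|torus. w x \<bullet> D x) = 0)"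

definition has_weak_gradient :: "('n::finite, real) L2 \<Rightarrow> ('n, real^'n) L2 \<Rightarrow> bool" where
  "has_weak_gradient u g \<longleftrightarrow>
     (\<forall>\<phi> D. test_function \<phi> D \<longrightarrow>
        (LINT x|torus. rep_L2 u x *\<^sub>R D x) = - (LINT x|torus. \<phi> x *\<^sub>R rep_L2 g x))"

definition grad :: "('n::finite, real) L2 \<Rightarrow> ('n, real^'n) L2" where
  "grad u = (THE g. has_weak_gradient u g)"

definition fourier_coeff :: "(real^'n \<Rightarrow> real) \<Rightarrow> int^'n \<Rightarrow> complex" where
  "fourier_coeff f k =
     (LINT x|torus. complex_of_real (f x) * cis (- 2 * pi * (\<Sum>i\<in>UNIV. of_int (k $ i) * x $ i)))"

text \<open>
  The heat semigroup as a Fourier multiplier. It has to act on integrable functions that need not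
  be square integrable, such as \<open>\<bar>u\<bar> powr p\<close>; for \<open>t > 0\<close> the result is square integrable.
\<close>

definition heat :: "real \<Rightarrow> (real^'n \<Rightarrow> real) \<Rightarrow> ('n::finite, real) L2" where
  "heat t f = (THE g. \<forall>k. fourier_coeff (rep_L2 g) k =
     of_real (exp (- 4 * pi\<^sup>2 * t * (\<Sum>i\<in>UNIV. (of_int (k $ i))\<^sup>2))) * fourier_coeff f k)"

definition mild_solution ::
  "real \<Rightarrow> (real \<Rightarrow> real^'n \<Rightarrow> real^'n) \<Rightarrow> ('n::finite, real) L2 \<Rightarrow> real \<Rightarrow> (real \<Rightarrow> ('n, real) L2) \<Rightarrow> bool" where
  "mild_solution p v u0 T u \<longleftrightarrow>
     continuous_on {0..T} u \<and>
     (\<forall>t\<in>{0<..T}. \<exists>g. has_weak_gradient (u t) g) \<and>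
     (\<forall>t\<in>{0..T}.
        let source = (\<lambda>\<tau>. heat (t - \<tau>) (\<lambda>x. \<bar>rep_L2 (u \<tau>) x\<bar> powr p));
            transport = (\<lambda>\<tau>. heat (t - \<tau>) (\<lambda>x. v \<tau> x \<bullet> rep_L2 (grad (u \<tau>)) x));
            mean = (\<lambda>\<tau>. LINT x|torus. \<bar>rep_L2 (u \<tau>) x\<bar> powr p)
        in set_integrable lebesgue {0<..<t} source \<and>
           set_integrable lebesgue {0<..<t} transport \<and>
           set_integrable lebesgue {0<..<t} mean \<and>
           u t = heat t (rep_L2 u0)
               + (LINT \<tau>:{0<..<t}|lebesgue. source \<tau>)
               - (LINT \<tau>:{0<..<t}|lebesgue. transport \<tau>)
               - (LINT \<tau>:{0<..<t}|lebesgue. mean \<tau>) *\<^sub>R abs_L2 (\<lambda>_. 1))"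

definition X_space :: "real \<Rightarrow> (real \<Rightarrow> ('n::finite, real) L2) set" where
  "X_space T = {u. continuous_on {0..T} u \<and>
     (\<forall>t\<in>{0<..T}. \<exists>g. has_weak_gradient (u t) g) \<and>
     bdd_above ((\<lambda>t. sqrt t * norm (grad (u t))) ` {0<..T})}"

end

theory Submission
  imports Defs
begin

text \<open>
  The functions \<open>cos + sin\<close> of \<open>2\<pi> k \<cdot> x\<close>, \<open>k \<in> \<int>\<^sup>N\<close>, form a real orthonormal basis of \<open>L\<^sup>2\<close> of the torus
  which diagonalises the heat semigroup and in which \<open>\<partial>\<^sub>i\<close> maps the coefficient at \<open>k\<close> to the one at
  \<open>-k\<close>, up to the factor \<open>2\<pi> k\<^sub>i\<close>; this gives the estimates \<open>\<parallel>\<nabla> e\<^sup>t\<^sup>\<Delta> u\<parallel> \<le> t\<^sup>-\<^sup>1\<^sup>/\<^sup>2 \<parallel>u\<parallel>\<close> and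
  \<open>\<parallel>e\<^sup>t\<^sup>\<Delta> f\<parallel> \<le> C t\<^sup>-\<^sup>N\<^sup>/\<^sup>4 \<parallel>f\<parallel>\<^sub>1\<close>. Both \<open>v \<cdot> \<nabla>u\<close> and \<open>\<bar>u\<bar>\<^sup>p - \<bar>w\<bar>\<^sup>p\<close> are dominated by products of an
  \<open>L\<^sup>q\<close> function, \<open>q = 2/(p-1)\<close>, and an \<open>L\<^sup>2\<close> function, and the heat flow of such a product is bounded in
  \<open>L\<^sup>2\<close> by \<open>t\<^sup>-\<^sup>\<alpha>\<close> with \<open>\<alpha> = N(p-1)/4 < 1/2\<close>. The Duhamel map therefore contracts a ball of \<open>X\<^sub>T\<close> when \<open>T\<close> is
  small. Uniqueness in all of \<open>X\<^sub>T\<close> follows by applying the contraction estimate successively on short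
  intervals whose length depends only on the norms of the two solutions.
\<close>

section \<open>Orthonormal bases\<close>

text \<open>The threshold \<open>p < 1 + 2/N\<close> is the condition \<open>\<alpha> < 1/2\<close>:
  bounding the gradient of the Duhamel integral costs a further factor
  \<open>(t - \<tau>) powr (-1/2)\<close>, and \<open>(t - \<tau>) powr - (\<alpha> + 1/2)\<close>
  has to be integrable. The other singularity, \<open>\<tau> powr (-1/2)\<close>, is the weight of
  \<open>X_T\<close> through which \<open>\<nabla>u\<close> enters the transport term. Since
  \<open>grad\<close> and \<open>heat\<close> are definite descriptions, nothing is known of them
  before existence and uniqueness are proved. Gradient estimates are therefore carried as bounds
  \<open>grad_le\<close> on finite sums of coefficients; such a bound yields the weak gradient and
  survives sums, limits and Bochner integrals. The nonlinearity reaches the fixed point argument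
  only through the locale \<open>duhamel\<close>, which is also instantiated for source, transport
  and mean separately, because a mild solution demands that each integral exist by itself. The
  existence time may depend on two norms only, so it is selected before the datum and the velocity;
  a competing solution has an uncontrolled \<open>X_T\<close> norm, for which this time need not be
  small.\<close>

locale orthonormal_basis =
  fixes e :: "'i::countable \<Rightarrow> 'h::{real_inner,banach,second_countable_topology}"
  assumes orthonormal: "e i \<bullet> e j = (if i = j then 1 else 0)"
    and total: "(\<And>i. x \<bullet> e i = 0) \<Longrightarrow> x = 0"
begin

lemma inner_sum_basis:
  "finite K \<Longrightarrow> (\<Sum>i\<in>K. c i *\<^sub>R e i) \<bullet> e j = (if j \<in> K then c j else 0)"
  by (simp add: inner_sum_left orthonormal if_distrib cong: if_cong)

lemma norm_sum_basis:
  assumes "finite K"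
  shows "(norm (\<Sum>i\<in>K. c i *\<^sub>R e i))\<^sup>2 = (\<Sum>i\<in>K. (c i)\<^sup>2)"
  unfolding power2_norm_eq_inner
  using assms by (simp add: inner_sum_right inner_sum_basis power2_eq_square)

lemma eqI: "(\<And>i. x \<bullet> e i = y \<bullet> e i) \<Longrightarrow> x = y"
  using total[of "x - y"] by (simp add: inner_diff_left)

lemma bessel:
  assumes "finite K"
  shows "(\<Sum>i\<in>K. (x \<bullet> e i)\<^sup>2) \<le> (norm x)\<^sup>2"
proof -
  define y where "y = (\<Sum>i\<in>K. (x \<bullet> e i) *\<^sub>R e i)"
  have "x \<bullet> y = (\<Sum>i\<in>K. (x \<bullet> e i)\<^sup>2)"
    by (simp add: y_def inner_sum_right power2_eq_square)
  moreover have "y \<bullet> y = (\<Sum>i\<in>K. (x \<bullet> e i)\<^sup>2)"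
    using norm_sum_basis[OF assms, of "\<lambda>i. x \<bullet> e i"] by (simp add: y_def power2_norm_eq_inner)
  moreover have "0 \<le> (x - y) \<bullet> (x - y)" by simp
  ultimately show ?thesis
    by (simp add: power2_norm_eq_inner inner_diff_left inner_diff_right inner_commute)
qed

text \<open>The partial sums form a Cauchy net: a sum over indices outside a finite set
  \<open>F0\<close> has squared norm equal to the sum of the squared coefficients there, which is
  small once \<open>F0\<close> carries almost the whole total. The sum is unordered, so no
  enumeration of the index type enters.\<close>

lemma riesz_fischer:
  assumes bound: "\<And>K. finite K \<Longrightarrow> (\<Sum>i\<in>K. (c i)\<^sup>2) \<le> B"
  obtains x where "((\<lambda>i. c i *\<^sub>R e i) has_sum x) UNIV" "\<And>i. x \<bullet> e i = c i"
proof -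
  let ?s = "sum (\<lambda>i. c i *\<^sub>R e i)"
  have summ: "(\<lambda>i. (c i)\<^sup>2) summable_on UNIV"
    by (rule nonneg_bdd_above_summable_on) (auto intro!: bdd_aboveI bound)
  have "\<exists>P. eventually P (finite_subsets_at_top UNIV) \<and> (\<forall>F G. P F \<and> P G \<longrightarrow> dist (?s F) (?s G) < r)"
    if "r > 0" for r :: real
  proof -
    \<comment> \<open>The square of \<open>r / 4\<close>: two partial sums beyond \<open>F0\<close>
      then differ by at most \<open>r / 2\<close>.\<close>
    have "0 < r\<^sup>2 / 16" using that by simp
    from infsum_finite_approximation[OF summ this]
    obtain F0 where F0: "finite F0" "dist (\<Sum>i\<in>F0. (c i)\<^sup>2) (infsum (\<lambda>i. (c i)\<^sup>2) UNIV) \<le> r\<^sup>2 / 16"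
      by blast
    have le: "norm (?s (F - F0)) \<le> r / 4" if "finite F" for F
    proof -
      have "(\<Sum>i\<in>F-F0. (c i)\<^sup>2) + (\<Sum>i\<in>F0. (c i)\<^sup>2) = (\<Sum>i\<in>F\<union>F0. (c i)\<^sup>2)"
        using that F0(1) by (subst sum.union_disjoint[symmetric]) (auto intro!: sum.cong)
      also have "\<dots> \<le> infsum (\<lambda>i. (c i)\<^sup>2) UNIV"
        using that F0(1) by (intro finite_sum_le_infsum summ) auto
      finally have "(\<Sum>i\<in>F-F0. (c i)\<^sup>2) \<le> r\<^sup>2 / 16"
        using F0(2) unfolding dist_real_def by linarith
      then have "(norm (?s (F - F0)))\<^sup>2 \<le> (r / 4)\<^sup>2"
        using norm_sum_basis[of "F - F0" c] that by (simp add: power_divide)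
      then show ?thesis by (rule power2_le_imp_le) (use \<open>r > 0\<close> in simp)
    qed
    have "dist (?s F) (?s G) < r" if "finite F \<and> F0 \<subseteq> F" "finite G \<and> F0 \<subseteq> G" for F G
    proof -
      have "?s F = ?s (F - F0) + ?s F0" "?s G = ?s (G - F0) + ?s F0"
        by (rule sum.subset_diff; use that in simp)+
      moreover have "norm (?s (F - F0)) \<le> r / 4" "norm (?s (G - F0)) \<le> r / 4"
        using le[of F] le[of G] that by auto
      ultimately show ?thesis
        using \<open>r > 0\<close> norm_triangle_ineq4[of "?s (F - F0)" "?s (G - F0)"] by (simp add: dist_norm)
    qed
    moreover have "eventually (\<lambda>F. finite F \<and> F0 \<subseteq> F) (finite_subsets_at_top UNIV)"
      unfolding eventually_finite_subsets_at_top using F0(1) by blast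
    ultimately show ?thesis by blast
  qed
  then have "cauchy_filter (filtermap ?s (finite_subsets_at_top UNIV))"
    by (simp add: cauchy_filter_metric_filtermap)
  then obtain x where "(?s \<longlongrightarrow> x) (finite_subsets_at_top UNIV)"
    using complete_uniform[where S="UNIV :: 'h set"] complete_UNIV[where 'a='h] by (force simp: filterlim_def)
  then have hs: "((\<lambda>i. c i *\<^sub>R e i) has_sum x) UNIV" by (simp add: has_sum_def)
  moreover have "x \<bullet> e i = c i" for i
  proof -
    have "((\<lambda>j. (c j *\<^sub>R e j) \<bullet> e i) has_sum x \<bullet> e i) UNIV"
      using has_sum_bounded_linear[OF bounded_linear_inner_left hs] by (simp add: o_def)
    moreover have "((\<lambda>j. (c j *\<^sub>R e j) \<bullet> e i) has_sum c i) UNIV"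
      by (rule has_sum_finite_neutralI[of "{i}"]) (auto simp: orthonormal)
    ultimately show ?thesis by (rule has_sum_unique)
  qed
  ultimately show ?thesis by (rule that)
qed

text \<open>Riesz-Fischer, applied to the coefficients of \<open>x\<close>, produces some sum with
  these coefficients; totality identifies it with \<open>x\<close>.\<close>

lemma expansion: "((\<lambda>i. (x \<bullet> e i) *\<^sub>R e i) has_sum x) UNIV"
proof -
  obtain y where "((\<lambda>i. (x \<bullet> e i) *\<^sub>R e i) has_sum y) UNIV" "\<And>i. y \<bullet> e i = x \<bullet> e i"
    using riesz_fischer[OF bessel] by blast
  then show ?thesis using eqI by metis
qed

lemma parseval: "((\<lambda>i. (x \<bullet> e i) * (y \<bullet> e i)) has_sum x \<bullet> y) UNIV"
  using has_sum_bounded_linear[OF bounded_linear_inner_left[of y] expansion[of x]]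
  by (simp only: inner_scaleR_left inner_commute[of "e _" y])

lemma norm_le:
  assumes "\<And>K. finite K \<Longrightarrow> (\<Sum>i\<in>K. (x \<bullet> e i)\<^sup>2) \<le> B\<^sup>2" "0 \<le> B"
  shows "norm x \<le> B"
proof (rule power2_le_imp_le)
  have "((\<lambda>i. (x \<bullet> e i)\<^sup>2) has_sum (norm x)\<^sup>2) UNIV"
    using parseval[of x x] by (simp add: power2_eq_square[symmetric] power2_norm_eq_inner)
  from has_sum_le_finite_sums[OF this] show "(norm x)\<^sup>2 \<le> B\<^sup>2" using assms(1) by blast
qed fact

text \<open>The function is the pointwise limit of its partial sums along finite sets exhausting the
  countable index type. This is how the Duhamel integrands are shown measurable, since their
  coefficients are explicit.\<close>

lemma borel_measurable_coordinates:
  assumes [measurable]: "\<And>i. (\<lambda>\<omega>. f \<omega> \<bullet> e i) \<in> borel_measurable M"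
  shows "f \<in> borel_measurable M"
proof (rule borel_measurable_LIMSEQ_metric)
  define K :: "nat \<Rightarrow> 'i set" where "K n = from_nat ` {..n}" for n
  have K: "filterlim K (finite_subsets_at_top UNIV) sequentially"
    unfolding filterlim_finite_subsets_at_top
  proof safe
    fix X :: "'i set" assume "finite X"
    have "X \<subseteq> K n" if n: "n \<ge> Max (to_nat ` X)" for n
    proof
      fix x assume "x \<in> X"
      then have "to_nat x \<le> Max (to_nat ` X)" using \<open>finite X\<close> by simp
      then have "to_nat x \<le> n" using n by linarith
      then show "x \<in> K n" unfolding K_def by (intro image_eqI[of x from_nat "to_nat x"]) auto
    qed
    then show "\<forall>\<^sub>F n in sequentially. finite (K n) \<and> X \<subseteq> K n \<and> K n \<subseteq> UNIV"
      unfolding eventually_sequentially by (auto simp: K_def)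
  qed
  show "(\<lambda>\<omega>. \<Sum>i\<in>K n. (f \<omega> \<bullet> e i) *\<^sub>R e i) \<in> borel_measurable M" for n
    by measurable
  show "(\<lambda>n. \<Sum>i\<in>K n. (f \<omega> \<bullet> e i) *\<^sub>R e i) \<longlonglongrightarrow> f \<omega>" for \<omega>
    using expansion[of "f \<omega>"] unfolding has_sum_def by (rule filterlim_compose[OF _ K])
qed

end

section \<open>Trigonometric polynomials on the torus\<close>

lemma borel_measurable_torus_continuous:
  fixes f :: "real^'n \<Rightarrow> 'b::euclidean_space"
  assumes "continuous_on UNIV f"
  shows "f \<in> borel_measurable torus"
  by (intro measurable_restrict_space1 measurable_completion)
    (use borel_measurable_continuous_onI[OF assms] in simp)

lemma integrable_torus_continuous:
  fixes f :: "real^'n \<Rightarrow> 'b::euclidean_space"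
  assumes "continuous_on UNIV f"
  shows "integrable torus f"
  by (rule continuous_imp_integrable) (rule continuous_on_subset[OF assms], simp)

lemma square_integrable_continuous:
  fixes f :: "real^'n \<Rightarrow> 'b::euclidean_space"
  assumes "continuous_on UNIV f"
  shows "square_integrable f"
  unfolding square_integrable_def
  by (intro conjI borel_measurable_torus_continuous integrable_torus_continuous continuous_intros assms)

text \<open>The box lengthened by \<open>h\<close> in direction \<open>i\<close> is cut once at
  height 1 and once at height \<open>h\<close>. Each cut leaves a unit box and a slab of thickness
  \<open>h\<close>, and the two slabs are translates of each other by a full period.\<close>

lemma integral_torus_shift:
  fixes f :: "real^'n \<Rightarrow> real"
  assumes cont: "continuous_on UNIV f" and per: "\<And>x. f (x + axis i 1) = f x" and h: "0 \<le> h" "h \<le> 1"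
  shows "(LINT x|torus. f (x + h *\<^sub>R axis i 1)) = (LINT x|torus. f x)"
proof -
  let ?a = "axis i (1::real)"
  define Q where "Q = cbox 0 (1 + h *\<^sub>R ?a)"
  have a: "?a \<in> Basis" by (simp add: axis_in_Basis_iff)
  have nth: "x \<bullet> ?a = x $ i" for x :: "real^'n" by (simp add: inner_axis)
  have int: "f integrable_on cbox u w" for u w
    by (rule integrable_continuous) (rule continuous_on_subset[OF cont], simp)
  have split: "integral Q f = integral (Q \<inter> {x. x \<bullet> ?a \<le> c}) f + integral (Q \<inter> {x. x \<bullet> ?a \<ge> c}) f" for c
    unfolding Q_def by (rule integral_split[OF int a])
  have box: "cbox u w = cbox u' w'" if "u = u'" "w = w'" for u w u' w' :: "real^'n" using that by simp
  have le: "cbox u w \<inter> {x. x \<bullet> ?a \<le> c} = cbox u (\<chi> j. if j = i then min (w $ i) c else w $ j)" for u w c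
    using interval_split_cart(1)[where a=u and b=w and k=i and c=c] by (simp add: nth interval_cbox_cart)
  have ge: "cbox u w \<inter> {x. x \<bullet> ?a \<ge> c} = cbox (\<chi> j. if j = i then max (u $ i) c else u $ j) w" for u w c
    using interval_split_cart(2)[where a=u and b=w and k=i and c=c] by (simp add: nth interval_cbox_cart)
  have 1: "Q \<inter> {x. x \<bullet> ?a \<le> 1} = cbox 0 1" "Q \<inter> {x. x \<bullet> ?a \<le> h} = cbox 0 (1 + (h - 1) *\<^sub>R ?a)"
    unfolding Q_def le by (rule box; use h in \<open>simp add: vec_eq_iff axis_def\<close>)+
  have 2: "Q \<inter> {x. x \<bullet> ?a \<ge> 1} = cbox (0 + ?a) ((1 + (h - 1) *\<^sub>R ?a) + ?a)"
    "Q \<inter> {x. x \<bullet> ?a \<ge> h} = cbox (0 + h *\<^sub>R ?a) (1 + h *\<^sub>R ?a)"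
    unfolding Q_def ge by (rule box; use h in \<open>simp add: vec_eq_iff axis_def\<close>)+
  have "integral (cbox (0 + ?a) ((1 + (h - 1) *\<^sub>R ?a) + ?a)) f = integral (cbox 0 (1 + (h - 1) *\<^sub>R ?a)) f"
    unfolding integral_shift_cbox_plus[symmetric] using per by (simp add: o_def add.commute)
  then have "integral (cbox 0 1) f = integral (cbox (0 + h *\<^sub>R ?a) (1 + h *\<^sub>R ?a)) f"
    using split[of 1] split[of h] unfolding 1 2 by simp
  also have "\<dots> = integral (cbox 0 1) (\<lambda>x. f (x + h *\<^sub>R ?a))"
    unfolding integral_shift_cbox_plus[symmetric] by (simp add: o_def add.commute)
  finally have *: "integral (cbox 0 1) (\<lambda>x. f (x + h *\<^sub>R ?a)) = integral (cbox 0 1) f" ..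
  have cont': "continuous_on UNIV (\<lambda>x. f (x + h *\<^sub>R ?a))"
    by (intro continuous_on_compose2[OF cont] continuous_intros) auto
  show ?thesis
    using * by (simp add: lebesgue_integral_eq_integral integrable_torus_continuous[OF cont] integrable_torus_continuous[OF cont'])
qed

definition phase :: "int^'n \<Rightarrow> real^'n \<Rightarrow> real" where
  "phase k x = 2 * pi * (\<Sum>i\<in>UNIV. of_int (k $ i) * x $ i)"

lemma phase_simps [simp]:
  "phase 0 x = 0" "phase (k + l) x = phase k x + phase l x"
  "phase (k - l) x = phase k x - phase l x" "phase (- k) x = - phase k x"
  by (auto simp: phase_def algebra_simps sum.distrib sum_subtractf sum_negf)

lemma phase_shift: "phase k (x + h *\<^sub>R axis i 1) = phase k x + 2 * pi * (of_int (k $ i) * h)"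
proof -
  have "(\<Sum>j\<in>UNIV. of_int (k $ j) * (x + h *\<^sub>R axis i 1) $ j)
      = (\<Sum>j\<in>UNIV. of_int (k $ j) * x $ j + (if j = i then of_int (k $ i) * h else 0))"
    by (intro sum.cong) (auto simp: axis_def algebra_simps)
  then show ?thesis by (simp add: phase_def sum.distrib distrib_left)
qed

lemma continuous_on_phase [continuous_intros]: "continuous_on S (phase k)"
  unfolding phase_def by (intro continuous_intros)

text \<open>A shift by half a wavelength in a direction with \<open>k $ i \<noteq> 0\<close> changes
  the sign of the cosine but not its integral. The angle \<open>a\<close> is kept general because
  \<open>a = - pi/2\<close> gives the sine.\<close>

lemma integral_cos_phase:
  "(LINT x|(torus :: (real^'n) measure). cos (phase k x + a)) = (if k = 0 then cos a else 0)"
proof (cases "k = 0")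
  case False
  then obtain i where i: "k $ i \<noteq> 0" by (auto simp: vec_eq_iff)
  define j where "j = \<bar>k $ i\<bar>"
  define h where "h = 1 / (2 * real_of_int j)"
  have j: "j \<ge> 1" using i by (simp add: j_def)
  then have h: "0 \<le> h" "h \<le> 1" by (auto simp: h_def divide_simps)
  have "of_int (k $ i) * h = 1/2 \<or> of_int (k $ i) * h = -1/2"
    using i by (auto simp: h_def j_def abs_if)
  then have "2 * pi * (of_int (k $ i) * h) = pi \<or> 2 * pi * (of_int (k $ i) * h) = - pi"
    by (elim disjE; simp only:) simp_all
  then have "cos (2 * pi * (of_int (k $ i) * h)) = -1 \<and> sin (2 * pi * (of_int (k $ i) * h)) = 0"
    by (elim disjE; simp only:) simp_all
  then have ph: "cos (phase k (x + h *\<^sub>R axis i 1) + a) = - cos (phase k x + a)" for x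
    unfolding phase_shift by (simp add: cos_add sin_add)
  have per: "cos (phase k (x + axis i 1) + a) = cos (phase k x + a)" for x
  proof -
    have "phase k (x + axis i 1) = phase k x + 2 * pi * of_int (k $ i)"
      using phase_shift[of k x 1 i] by simp
    then show ?thesis by (simp add: cos_add sin_add)
  qed
  have "(LINT x|torus. cos (phase k (x + h *\<^sub>R axis i 1) + a)) = (LINT x|torus. cos (phase k x + a))"
    by (rule integral_torus_shift[where f = "\<lambda>x. cos (phase k x + a)", OF _ per h]) (intro continuous_intros)
  then show ?thesis using False by (simp add: ph)
qed simp

text \<open>The kernel of the Hartley transform: one real function for each frequency, orthonormal
  without normalising constants and without selecting one of each pair \<open>k\<close>,
  \<open>- k\<close>.\<close>

definition cas :: "int^'n \<Rightarrow> real^'n \<Rightarrow> real" where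
  "cas k x = cos (phase k x) + sin (phase k x)"

lemma continuous_on_cas [continuous_intros]: "continuous_on S (cas k)"
  unfolding cas_def by (intro continuous_intros)

lemma cas_measurable [measurable]: "cas k \<in> borel_measurable torus"
  by (intro borel_measurable_torus_continuous continuous_intros)

lemma square_integrable_cas [intro]: "square_integrable (cas k)"
  by (intro square_integrable_continuous continuous_intros)

lemma abs_cas_le: "\<bar>cas k x\<bar> \<le> 2"
  using abs_cos_le_one[of "phase k x"] abs_sin_le_one[of "phase k x"] unfolding cas_def by linarith

lemma cas_periodic: "cas k (x + axis i 1) = cas k x"
proof -
  have "phase k (x + axis i 1) = phase k x + 2 * pi * of_int (k $ i)"
    using phase_shift[of k x 1 i] by simp
  then show ?thesis by (simp add: cas_def cos_add sin_add)
qed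

lemma cas_zero [simp]: "cas 0 = (\<lambda>x. 1)"
  by (simp add: cas_def fun_eq_iff)

lemma cas_mult: "cas k x * cas l x = cos (phase (k - l) x) + sin (phase (k + l) x)"
  by (simp add: cas_def cos_diff sin_add algebra_simps)

text \<open>In the product formula the sine has mean zero at every frequency and the cosine at every
  frequency except \<open>k - l = 0\<close>.\<close>

lemma integral_cas_mult: "(LINT x|torus. cas k x * cas l x) = (if k = l then 1 else 0)"
proof -
  have int: "integrable torus (\<lambda>x. cos (phase m x))" "integrable torus (\<lambda>x. sin (phase m x))" for m :: "int^'n"
    by (intro integrable_torus_continuous continuous_intros)+
  have s: "(LINT x|torus. sin (phase m x)) = 0" for m :: "int^'n"
    using integral_cos_phase[of m "- pi/2"] by (simp add: cos_diff)
  have c: "(LINT x|torus. cos (phase m x)) = (if m = 0 then 1 else 0)" for m :: "int^'n"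
    using integral_cos_phase[of m 0] by simp
  show ?thesis
    unfolding cas_mult Bochner_Integration.integral_add[OF int] c s by simp
qed

lemma inner_abs_L2:
  assumes "square_integrable g"
  shows "f \<bullet> abs_L2 g = (LINT x|torus. rep_L2 f x \<bullet> g x)"
proof -
  have [measurable]: "g \<in> borel_measurable torus" using assms by (simp add: square_integrable_def)
  show ?thesis unfolding inner_L2_def
    by (rule integral_cong_AE) (measurable, use rep_abs_L2[OF assms] in eventually_elim, simp)
qed

lemma inner_abs_L2':
  assumes "square_integrable f" "square_integrable g"
  shows "abs_L2 f \<bullet> abs_L2 g = (LINT x|torus. f x \<bullet> g x)"
proof -
  have [measurable]: "g \<in> borel_measurable torus" "f \<in> borel_measurable torus"
    using assms by (auto simp: square_integrable_def)
  show ?thesis unfolding inner_abs_L2[OF assms(2)]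
    by (rule integral_cong_AE) (measurable, use rep_abs_L2[OF assms(1)] in eventually_elim, simp)
qed

text \<open>The linear span of the functions \<open>cas k\<close>. It contains sines and cosines
  because \<open>k\<close> and \<open>- k\<close> both occur, and it is closed under
  products.\<close>

inductive trig_poly :: "(real^'n \<Rightarrow> real) \<Rightarrow> bool" where
  cas: "trig_poly (cas k)"
| cmult: "trig_poly f \<Longrightarrow> trig_poly (\<lambda>x. c * f x)"
| add: "trig_poly f \<Longrightarrow> trig_poly g \<Longrightarrow> trig_poly (\<lambda>x. f x + g x)"

lemma trig_poly_continuous: "trig_poly f \<Longrightarrow> continuous_on UNIV f"
  by (induction rule: trig_poly.induct) (intro continuous_intros; assumption)+

lemma trig_poly_const: "trig_poly (\<lambda>x. c)"
  using trig_poly.cmult[OF trig_poly.cas[of 0], of c] by simp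

lemma trig_poly_cos: "trig_poly (\<lambda>x. cos (phase k x))"
proof -
  have "(\<lambda>x. cos (phase k x)) = (\<lambda>x. 1/2 * (cas k x + cas (- k) x))" by (simp add: cas_def)
  then show ?thesis by (simp only: trig_poly.intros)
qed

lemma trig_poly_sin: "trig_poly (\<lambda>x. sin (phase k x))"
proof -
  have "(\<lambda>x. sin (phase k x)) = (\<lambda>x. 1/2 * (cas k x + (-1) * cas (- k) x))" by (simp add: cas_def)
  then show ?thesis by (simp only: trig_poly.intros)
qed

lemma trig_poly_mult:
  assumes "trig_poly f" "trig_poly g"
  shows "trig_poly (\<lambda>x. f x * g x)"
  using assms
proof (induction arbitrary: g rule: trig_poly.induct)
  case (cas k)
  then show ?case
  proof (induction rule: trig_poly.induct)
    case (cas l)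
    show ?case unfolding cas_mult by (intro trig_poly.add trig_poly_cos trig_poly_sin)
  next
    case (cmult f c)
    then show ?case using trig_poly.cmult[of "\<lambda>x. cas k x * f x" c] by (simp add: algebra_simps)
  next
    case (add f g)
    then show ?case using trig_poly.add[of "\<lambda>x. cas k x * f x" "\<lambda>x. cas k x * g x"] by (simp add: algebra_simps)
  qed
next
  case (cmult f c)
  then show ?case using trig_poly.cmult[of "\<lambda>x. f x * g x" c] by (simp add: mult.assoc)
next
  case (add f1 f2)
  then show ?case using trig_poly.add[of "\<lambda>x. f1 x * g x" "\<lambda>x. f2 x * g x"] by (simp add: distrib_right)
qed

lemma trig_poly_sum: "finite I \<Longrightarrow> (\<And>i. i \<in> I \<Longrightarrow> trig_poly (f i)) \<Longrightarrow> trig_poly (\<lambda>x. \<Sum>i\<in>I. f i x)"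
  by (induction rule: finite_induct) (auto intro: trig_poly.add trig_poly_const)

lemma trig_poly_cos_coordinate: "trig_poly (\<lambda>x :: real^'n. cos (2 * pi * (x $ i - c)))"
proof -
  have "phase (axis i 1) x = 2 * pi * x $ i" for x :: "real^'n"
  proof -
    have "(\<Sum>j\<in>UNIV. of_int (axis i 1 $ j) * x $ j) = (\<Sum>j\<in>UNIV. if j = i then x $ i else 0)"
      by (intro sum.cong) (auto simp: axis_def)
    then show ?thesis by (simp add: phase_def)
  qed
  then have "(\<lambda>x. cos (2 * pi * (x $ i - c))) =
      (\<lambda>x. cos (2*pi*c) * cos (phase (axis i 1) x) + sin (2*pi*c) * sin (phase (axis i 1) x))"
    by (auto simp: right_diff_distrib cos_diff)
  then show ?thesis by (simp only: trig_poly.intros trig_poly_cos trig_poly_sin)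
qed

text \<open>Shifted cosines of the coordinates generate an algebra inside the trigonometric
  polynomials. Weierstrass approximation on a cube thus transfers to continuous functions of these
  cosines.\<close>

lemma trig_poly_real_polynomial:
  assumes "real_polynomial_function p"
  shows "trig_poly (\<lambda>x. p (\<chi> i. cos (2 * pi * (x $ i - c i))))"
  using assms
proof (induction rule: real_polynomial_function.induct)
  case (linear f)
  interpret bounded_linear f by fact
  have "f y = (\<Sum>i\<in>UNIV. f (axis i 1) * y $ i)" for y
  proof -
    have "y = (\<Sum>i\<in>UNIV. y $ i *\<^sub>R axis i 1)"
      using basis_expansion[of y] by (simp add: scalar_mult_eq_scaleR)
    then have "f y = f (\<Sum>i\<in>UNIV. y $ i *\<^sub>R axis i 1)" by (rule arg_cong)
    also have "\<dots> = (\<Sum>i\<in>UNIV. f (axis i 1) * y $ i)" by (simp add: sum scaleR mult.commute)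
    finally show ?thesis .
  qed
  from this[of "\<chi> i. cos (2 * pi * (_ $ i - c i))"]
  have "(\<lambda>x. f (\<chi> i. cos (2 * pi * (x $ i - c i)))) =
      (\<lambda>x. \<Sum>i\<in>UNIV. f (axis i 1) * cos (2 * pi * (x $ i - c i)))"
    by (intro ext) simp
  then show ?case
    by (simp only:) (intro trig_poly_sum trig_poly.cmult trig_poly_cos_coordinate, simp)
qed (auto intro: trig_poly_const trig_poly.add trig_poly_mult)

section \<open>The Hartley basis\<close>

text \<open>On half a period the cosine decreases strictly; a larger \<open>\<bar>y\<bar>\<close> is
  reflected to \<open>1 - \<bar>y\<bar>\<close>. The bound \<open>1 - r\<close> keeps the reflected
  point at distance at least \<open>r\<close> from 0, so the neighbouring period does not
  interfere.\<close>

lemma cos_greater_iff: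
  assumes r: "0 < r" "r \<le> 1/2" and y: "\<bar>y\<bar> \<le> 1 - r"
  shows "cos (2 * pi * r) < cos (2 * pi * y) \<longleftrightarrow> \<bar>y\<bar> < r"
proof -
  have mono: "cos (2 * pi * r) < cos (2 * pi * z) \<longleftrightarrow> z < r" if "0 \<le> z" "z \<le> 1/2" for z
    using that r by (subst cos_mono_less_eq) auto
  have abs: "cos (2 * pi * y) = cos (2 * pi * \<bar>y\<bar>)" by (simp add: abs_if)
  show ?thesis
  proof (cases "\<bar>y\<bar> \<le> 1/2")
    case True
    then show ?thesis unfolding abs by (intro mono) auto
  next
    case False
    have "cos (2 * pi * \<bar>y\<bar>) = cos (2 * pi * (1 - \<bar>y\<bar>))" by (simp add: right_diff_distrib cos_diff)
    then show ?thesis using mono[of "1 - \<bar>y\<bar>"] False r y unfolding abs by auto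
  qed
qed

text \<open>The faces of the dyadic grid lie in countably many hyperplanes. Away from them the
  half-open cubes of \<open>dyadic_index\<close> agree with open cubes, which strict inequalities
  can describe.\<close>

lemma AE_torus_not_dyadic:
  "AE x in (torus :: (real^'n) measure). \<forall>i. \<forall>j::int. 2 ^ n * x $ i \<noteq> of_int j"
proof -
  have "AE x in (lebesgue :: (real^'n) measure). 2 ^ n * x $ i \<noteq> of_int j" for i and j :: int
  proof -
    have "negligible {x :: real^'n. x \<bullet> axis i 1 = of_int j / 2 ^ n}"
      by (intro negligible_standard_hyperplane) (simp add: axis_in_Basis_iff)
    then have "AE x in (lebesgue :: (real^'n) measure). x \<notin> {x. x \<bullet> axis i 1 = of_int j / 2 ^ n}"
      unfolding negligible_iff_null_sets by (rule AE_not_in)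
    then show ?thesis by eventually_elim (auto simp: inner_axis field_simps)
  qed
  then have "AE x in (lebesgue :: (real^'n) measure). \<forall>i. \<forall>j::int. 2 ^ n * x $ i \<noteq> of_int j"
    by (simp add: AE_all_countable)
  then show ?thesis by (subst AE_restrict_space_iff) auto
qed

text \<open>Ramps of growing slope make the open condition \<open>0 < s\<close> a limit of
  continuous functions with values in the unit interval.\<close>

lemma tendsto_min_max_scaled:
  "(\<lambda>m. min 1 (real m * max 0 s)) \<longlonglongrightarrow> (if 0 < s then 1 else 0)"
proof (cases "0 < s")
  case True
  then obtain M where M: "1 < real M * s" using reals_Archimedean3 by blast
  have "\<forall>\<^sub>F m in sequentially. min 1 (real m * max 0 s) = 1"
    using eventually_ge_at_top[of M]
  proof eventually_elim
    case (elim m)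
    then have "real M * s \<le> real m * s" using True by (intro mult_right_mono) auto
    then have "1 \<le> real m * s" using M by linarith
    then show ?case using True by (simp add: max_def)
  qed
  then show ?thesis using True by (simp add: tendsto_eventually)
qed (auto simp: max_def)

text \<open>
  A dyadic cube is cut out by inequalities \<open>cos (2 * pi * (x $ i - c i)) > cos (2 * pi * r)\<close>, so its
  indicator function is a bounded limit of polynomials in these cosines.
\<close>

lemma trig_poly_tendsto_dyadic_cube:
  fixes k :: "int^'n"
  assumes k: "\<And>i. 0 \<le> k $ i \<and> k $ i < 2 ^ n"
  obtains F :: "nat \<Rightarrow> real^'n \<Rightarrow> real" where "\<And>m. trig_poly (F m)" "\<And>m x. \<bar>F m x\<bar> \<le> 2"
    "AE x in torus. (\<lambda>m. F m x) \<longlonglongrightarrow> indicator {x. dyadic_index n x = k} x"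
proof -
  \<comment> \<open>\<open>r\<close> is half the side length and \<open>c\<close> the centre of the
    cube with index \<open>k\<close>; the bounds on \<open>k\<close> keep this cube inside the unit
    box.\<close>
  define r :: real where "r = 1 / 2 ^ (n + 1)"
  define c :: "'n \<Rightarrow> real" where "c i = (of_int (k $ i) + 1/2) / 2 ^ n" for i
  define C where "C x = (\<chi> i. cos (2 * pi * (x $ i - c i)))" for x :: "real^'n"
  \<comment> \<open>A product of ramps, one for each coordinate, as a function of the cosines alone;
    its limit is 1 exactly when every cosine exceeds \<open>cos (2 * pi * r)\<close>.\<close>
  define h where "h m s = (\<Prod>i\<in>UNIV. min 1 (real m * max 0 (s $ i - cos (2 * pi * r))))" for m and s :: "real^'n"
  have r: "0 < r" "r \<le> 1/2" by (auto simp: r_def divide_simps)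
  have C: "C x \<in> cbox (-1) 1" for x by (auto simp: C_def mem_box_cart)
  have h_bound: "\<bar>h m s\<bar> \<le> 1" for m s
    unfolding h_def abs_prod by (intro prod_le_1) auto
  have "continuous_on S (h m)" for S m
    unfolding h_def by (intro continuous_intros)
  then have "\<exists>p. real_polynomial_function p \<and> (\<forall>s\<in>cbox (-1) 1. \<bar>h m s - p s\<bar> < inverse (real (Suc m)))" for m
    by (rule Stone_Weierstrass_real_polynomial_function[OF compact_cbox, of _ _ "h m" "inverse (real (Suc m))"]) auto
  then obtain p where p: "\<And>m. real_polynomial_function (p m)"
    and hp: "\<And>m s. s \<in> cbox (-1) 1 \<Longrightarrow> \<bar>h m s - p m s\<bar> < inverse (real (Suc m))"
    by metis
  show ?thesis
  proof
    show "trig_poly (\<lambda>x. p m (C x))" for m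
      unfolding C_def by (rule trig_poly_real_polynomial[OF p])
    show "\<bar>p m (C x)\<bar> \<le> 2" for m x
    proof -
      have "inverse (real (Suc m)) \<le> 1" by (simp add: field_simps)
      then show ?thesis using hp[OF C, of m x] h_bound[of m "C x"] by linarith
    qed
    have cube: "AE x in torus. x \<in> cbox 0 (1::real^'n)" by (rule AE_I2) simp
    show "AE x in torus. (\<lambda>m. p m (C x)) \<longlonglongrightarrow> indicator {x. dyadic_index n x = k} x"
      using AE_torus_not_dyadic[of n] cube
    proof eventually_elim
      case (elim x)
      have iff: "0 < C x $ i - cos (2 * pi * r) \<longleftrightarrow> \<lfloor>2 ^ n * x $ i\<rfloor> = k $ i" for i
      proof -
        have x: "0 \<le> x $ i" "x $ i \<le> 1" using elim(2) by (auto simp: mem_box_cart)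
        have "of_int (k $ i) + 1 \<le> (2 ^ n :: real)" using k[of i]
        proof -
          have "k $ i + 1 \<le> 2 ^ n" using k[of i] by linarith
          then have "real_of_int (k $ i + 1) \<le> real_of_int (2 ^ n)" by (simp only: of_int_le_iff)
          then show ?thesis by simp
        qed
        then have "(of_int (k $ i) + 1) / 2 ^ n \<le> (1 :: real)" by simp
        moreover have "c i = of_int (k $ i) / 2 ^ n + r" "c i = (of_int (k $ i) + 1) / 2 ^ n - r"
          by (auto simp: r_def c_def add_divide_distrib)
        moreover have "0 \<le> real_of_int (k $ i) / 2 ^ n" using k[of i] by simp
        ultimately have "r \<le> c i" "c i \<le> 1 - r" by linarith+
        then have "\<bar>x $ i - c i\<bar> \<le> 1 - r" using x by auto
        from cos_greater_iff[OF r this]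
        have "0 < C x $ i - cos (2 * pi * r) \<longleftrightarrow> \<bar>x $ i - c i\<bar> < r" by (simp add: C_def)
        also have "\<dots> \<longleftrightarrow> \<bar>2 ^ n * x $ i - (of_int (k $ i) + 1/2)\<bar> < 1/2"
        proof -
          have "2 ^ n * c i = of_int (k $ i) + 1/2" by (simp add: c_def)
          then have "2 ^ n * x $ i - (of_int (k $ i) + 1/2) = 2 ^ n * (x $ i - c i)"
            by (simp add: right_diff_distrib)
          moreover have "1/2 = 2 ^ n * r" by (simp add: r_def)
          ultimately show ?thesis by (simp only: abs_mult) simp
        qed
        also have "\<dots> \<longleftrightarrow> \<lfloor>2 ^ n * x $ i\<rfloor> = k $ i"
        proof -
          have "\<bar>y - (of_int j + 1/2)\<bar> < 1/2 \<longleftrightarrow> \<lfloor>y\<rfloor> = j" if "y \<noteq> of_int j" for y :: real and j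
            unfolding floor_eq_iff abs_less_iff using that by (safe; linarith)
          then show ?thesis using elim(1) by blast
        qed
        finally show ?thesis .
      qed
      have lim: "(\<lambda>m. h m (C x)) \<longlonglongrightarrow> (\<Prod>i\<in>UNIV. if 0 < C x $ i - cos (2 * pi * r) then 1 else 0)"
        unfolding h_def by (intro tendsto_prod tendsto_min_max_scaled)
      have prod: "(\<Prod>i\<in>UNIV. if 0 < C x $ i - cos (2 * pi * r) then 1 else 0) = (indicator {x. dyadic_index n x = k} x :: real)"
        unfolding iff by (auto simp: indicator_def dyadic_index_def vec_eq_iff)
      have "(\<lambda>m. p m (C x) - h m (C x)) \<longlonglongrightarrow> 0"
      proof (rule Lim_null_comparison[OF _ LIMSEQ_inverse_real_of_nat])
        show "\<forall>\<^sub>F m in sequentially. norm (p m (C x) - h m (C x)) \<le> inverse (real (Suc m))"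
          using hp[OF C, of _ x] by (intro always_eventually) (auto simp: abs_minus_commute less_imp_le)
      qed
      from tendsto_add[OF this lim] show ?case by (simp only: prod) simp
    qed
  qed
qed

definition hartley :: "int^'n \<Rightarrow> ('n::finite, real) L2" where
  "hartley k = abs_L2 (cas k)"

lemma inner_hartley: "f \<bullet> hartley k = (LINT x|torus. rep_L2 f x * cas k x)"
  by (simp add: hartley_def inner_abs_L2 square_integrable_cas)

lemma indicator_dyadic_cube_measurable [measurable]:
  "(\<lambda>x. indicator {x. dyadic_index n x = l} x :: real) \<in> borel_measurable (torus :: (real^'n) measure)"
  using measurable_compose[OF dyadic_index_measurable[of n], of "indicator {l} :: _ \<Rightarrow> real" borel]
  by (simp add: indicator_def)

text \<open>For a cube inside the unit box the indicator is an \<open>L\<^sup>2\<close> limit of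
  trigonometric polynomials, to which \<open>f\<close> is orthogonal. Every other cube meets the
  torus in a null set: index \<open>2 ^ n\<close> in some coordinate is attained only on the face
  \<open>x $ i = 1\<close>, which is dyadic.\<close>

lemma inner_dyadic_cube_eq_0:
  fixes f :: "('n::finite, real) L2"
  assumes f: "\<And>k. f \<bullet> hartley k = 0"
  shows "(LINT x|torus. rep_L2 f x * indicator {x. dyadic_index n x = k} x) = 0"
proof (cases "\<forall>i. 0 \<le> k $ i \<and> k $ i < 2 ^ n")
  case True
  then obtain F :: "nat \<Rightarrow> real^'n \<Rightarrow> real" where F: "\<And>m. trig_poly (F m)" "\<And>m x. \<bar>F m x\<bar> \<le> 2"
    "AE x in torus. (\<lambda>m. F m x) \<longlonglongrightarrow> indicator {x. dyadic_index n x = k} x"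
    using trig_poly_tendsto_dyadic_cube[of k n] by blast
  have orth: "f \<bullet> abs_L2 g = 0" if "trig_poly g" for g
    using that
  proof (induction rule: trig_poly.induct)
    case (cas k)
    then show ?case using f[of k] by (simp add: hartley_def)
  next
    case (cmult g c)
    then have g: "square_integrable g" by (intro square_integrable_continuous trig_poly_continuous)
    then have "square_integrable (\<lambda>x. c * g x)" using square_integrable_scaleR[OF g, of c] by simp
    then show ?case using cmult by (simp add: inner_abs_L2 g mult.left_commute)
  next
    case (add g h)
    then have gh: "square_integrable g" "square_integrable h"
      by (auto intro: square_integrable_continuous trig_poly_continuous)
    then have "integrable torus (\<lambda>x. rep_L2 f x * g x)" "integrable torus (\<lambda>x. rep_L2 f x * h x)"
      using square_integrable_inner[of "rep_L2 f" g] square_integrable_inner[of "rep_L2 f" h] by auto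
    then show ?case using add gh by (simp add: inner_abs_L2 square_integrable_add distrib_left)
  qed
  have si: "square_integrable (indicator {x. dyadic_index n x = k} :: real^'n \<Rightarrow> real)"
    and lim: "(\<lambda>m. abs_L2 (F m)) \<longlonglongrightarrow> abs_L2 (indicator {x. dyadic_index n x = k})"
    by (rule tendsto_abs_L2[where w = "\<lambda>_. 2::real"];
        use F(2,3) indicator_dyadic_cube_measurable borel_measurable_torus_continuous[OF trig_poly_continuous[OF F(1)]] in auto)+
  have "(\<lambda>m. f \<bullet> abs_L2 (F m)) \<longlonglongrightarrow> f \<bullet> abs_L2 (indicator {x. dyadic_index n x = k})"
    by (intro tendsto_intros lim)
  then have "(\<lambda>m. 0) \<longlonglongrightarrow> f \<bullet> abs_L2 (indicator {x. dyadic_index n x = k})"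
    by (simp only: orth[OF F(1)])
  then have "f \<bullet> abs_L2 (indicator {x. dyadic_index n x = k}) = 0"
    by (simp add: LIMSEQ_const_iff)
  then show ?thesis using si by (simp add: inner_abs_L2)
next
  case False
  then obtain i where "\<not> (0 \<le> k $ i \<and> k $ i < 2 ^ n)" by blast
  then have i: "k $ i < 0 \<or> k $ i \<ge> 2 ^ n" by linarith
  have cube: "AE x in torus. x \<in> cbox 0 (1::real^'n)" by (rule AE_I2) simp
  have "AE x in torus. rep_L2 f x * indicator {x. dyadic_index n x = k} x = 0"
    using AE_torus_not_dyadic[of n] cube
  proof eventually_elim
    case (elim x)
    have "\<lfloor>2 ^ n * x $ i\<rfloor> \<noteq> k $ i"
    proof
      assume eq: "\<lfloor>2 ^ n * x $ i\<rfloor> = k $ i"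
      have x: "0 \<le> x $ i" "x $ i \<le> 1" using elim(2) by (auto simp: mem_box_cart)
      have "k $ i \<ge> 0" using x by (simp flip: eq)
      then have "(2 ^ n :: int) \<le> \<lfloor>2 ^ n * x $ i\<rfloor>" using i eq by simp
      then have "2 ^ n \<le> 2 ^ n * x $ i" by (simp add: le_floor_iff)
      moreover have "2 ^ n * x $ i \<le> 2 ^ n * 1" using x by (intro mult_left_mono) auto
      ultimately have "2 ^ n * x $ i = of_int (2 ^ n)" by simp
      then show False using elim(1) by blast
    qed
    then show ?case by (auto simp: dyadic_index_def vec_eq_iff indicator_def)
  qed
  then show ?thesis by (rule integral_eq_zero_AE)
qed

text \<open>Step functions on dyadic cubes are dense by \<open>closure_dyadic_step\<close>, and the
  orthogonal complement of \<open>f\<close> is closed.\<close>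

lemma hartley_total:
  fixes f :: "('n::finite, real) L2"
  assumes f: "\<And>k. f \<bullet> hartley k = 0"
  shows "f = 0"
proof -
  obtain Q :: "real set" where Q: "countable Q" "\<And>X. open X \<Longrightarrow> X \<noteq> {} \<Longrightarrow> \<exists>q\<in>Q. q \<in> X"
    by (rule countable_dense_setE) blast
  have 0: "f \<bullet> abs_L2 (dyadic_step Q n xs) = 0" for n xs
  proof -
    define c where "c l = (case map_of xs l of None \<Rightarrow> 0 | Some m \<Rightarrow> from_nat_into Q m)" for l :: "int^'n"
    have fin: "finite (dom (map_of xs))" by (rule finite_dom_map_of)
    have eq: "dyadic_step Q n xs x = (\<Sum>l\<in>dom (map_of xs). c l * indicator {x. dyadic_index n x = l} x)" for x
    proof -
      have "(\<Sum>l\<in>dom (map_of xs). c l * indicator {x. dyadic_index n x = l} x) =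
          (\<Sum>l\<in>dom (map_of xs). if dyadic_index n x = l then c (dyadic_index n x) else 0)"
        by (intro sum.cong) (auto simp: indicator_def)
      also have "\<dots> = dyadic_step Q n xs x"
        using fin by (auto simp: dyadic_step_def c_def split: option.splits)
      finally show ?thesis ..
    qed
    have "integrable torus (rep_L2 f)"
      using square_integrable_inner[of "rep_L2 f" "\<lambda>_. 1"] by auto
    then have int: "integrable torus (\<lambda>x. rep_L2 f x * indicator {x. dyadic_index n x = l} x)" for l
      by (rule Bochner_Integration.integrable_bound) (auto simp: indicator_def)
    have "square_integrable (dyadic_step Q n xs)"
    proof (rule square_integrable_bound[where w = "\<lambda>_. \<Sum>l\<in>dom (map_of xs). \<bar>c l\<bar>"])
      show "AE x in torus. norm (dyadic_step Q n xs x) \<le> norm (\<Sum>l\<in>dom (map_of xs). \<bar>c l\<bar>)"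
        unfolding eq by (auto intro!: order_trans[OF sum_abs] sum_mono simp: indicator_def sum_nonneg)
    qed auto
    then have "f \<bullet> abs_L2 (dyadic_step Q n xs) = (LINT x|torus. (\<Sum>l\<in>dom (map_of xs). c l * (rep_L2 f x * indicator {x. dyadic_index n x = l} x)))"
      by (simp add: inner_abs_L2 eq sum_distrib_left mult.left_commute)
    also have "\<dots> = 0"
      using int by (simp add: Bochner_Integration.integral_sum inner_dyadic_cube_eq_0[OF f])
    finally show ?thesis .
  qed
  have "f \<in> closure (range (\<lambda>(n, xs). abs_L2 (dyadic_step Q n xs)))"
    by (rule closure_dyadic_step[OF Q])
  moreover have "closure (range (\<lambda>(n, xs). abs_L2 (dyadic_step Q n xs))) \<subseteq> {g. f \<bullet> g = 0}"
    by (rule closure_minimal) (use 0 in \<open>auto intro!: closed_Collect_eq continuous_intros\<close>)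
  ultimately show ?thesis by auto
qed

interpretation hartley: orthonormal_basis "hartley :: int^'n \<Rightarrow> ('n::finite, real) L2"
proof
  show "hartley i \<bullet> hartley j = (if i = j then 1 else 0)" for i j :: "int^'n"
    using integral_cas_mult[of i j] by (simp add: hartley_def inner_abs_L2' square_integrable_cas)
qed (rule hartley_total)

section \<open>Weak gradients\<close>

lemma square_integrable_vec_nth [intro]:
  fixes g :: "real^'n \<Rightarrow> real^'m"
  assumes "square_integrable g"
  shows "square_integrable (\<lambda>x. g x $ i)"
proof (rule square_integrable_bound[OF assms])
  have [measurable]: "g \<in> borel_measurable torus" using assms by (simp add: square_integrable_def)
  show "(\<lambda>x. g x $ i) \<in> borel_measurable torus"
    by (rule measurable_compose[of g _ borel]) auto
qed (auto intro: component_le_norm_cart)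

lemma borel_measurable_vec_lambda:
  fixes f :: "'a \<Rightarrow> 'm::finite \<Rightarrow> real"
  assumes "\<And>i. (\<lambda>x. f x i) \<in> borel_measurable M"
  shows "(\<lambda>x. \<chi> i. f x i) \<in> borel_measurable M"
  by (rule borel_measurable_euclidean_space[THEN iffD2]) (auto simp: Basis_vec_def inner_axis assms)

lemma square_integrable_vec_lambda:
  fixes g :: "'m::finite \<Rightarrow> real^'n \<Rightarrow> real"
  assumes "\<And>i. square_integrable (g i)"
  shows "square_integrable (\<lambda>x. \<chi> i. g i x)"
  unfolding square_integrable_def
proof
  show "(\<lambda>x. \<chi> i. g i x) \<in> borel_measurable torus"
    using assms by (intro borel_measurable_vec_lambda) (simp add: square_integrable_def)
  have "(norm (\<chi> i. g i x))\<^sup>2 = (\<Sum>i\<in>UNIV. (norm (g i x))\<^sup>2)" for x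
    by (simp add: norm_vec_def L2_set_def sum_nonneg)
  then show "integrable torus (\<lambda>x. (norm (\<chi> i. g i x))\<^sup>2)"
    using assms by (simp add: square_integrable_def)
qed

lemma integrable_scaleR_square_integrable:
  fixes g :: "real^'n \<Rightarrow> 'b::euclidean_space"
  assumes "square_integrable f" "square_integrable g"
  shows "integrable torus (\<lambda>x. f x *\<^sub>R g x)"
proof (rule Bochner_Integration.integrable_bound)
  have [measurable]: "f \<in> borel_measurable torus" "g \<in> borel_measurable torus"
    using assms by (auto simp: square_integrable_def)
  show "integrable torus (\<lambda>x. norm (f x) \<bullet> norm (g x))"
    by (intro square_integrable_inner square_integrable_bound[OF assms(1)] square_integrable_bound[OF assms(2)]) auto
  show "(\<lambda>x. f x *\<^sub>R g x) \<in> borel_measurable torus" by measurable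
qed auto

section \<open>Integration by parts against test functions\<close>

text \<open>Difference quotients have mean zero by translation invariance. The mean value theorem
  bounds them uniformly, so dominated convergence passes to the derivative.\<close>

lemma integral_torus_directional_derivative:
  fixes f f' :: "real^'n \<Rightarrow> real"
  assumes cont: "continuous_on UNIV f" "continuous_on UNIV f'"
    and per: "\<And>x. f (x + axis i 1) = f x"
    and deriv: "\<And>x. ((\<lambda>s. f (x + s *\<^sub>R axis i 1)) has_real_derivative f' x) (at 0)"
  shows "(LINT x|torus. f' x) = 0"
proof -
  define a where "a = (axis i 1 :: real^'n)"
  define h where "h m = 1 / real (Suc m)" for m
  define q where "q m x = (f (x + h m *\<^sub>R a) - f x) / h m" for m x
  have h: "0 < h m" "h m \<le> 1" for m by (auto simp: h_def)
  have deriv': "((\<lambda>s. f (x + s *\<^sub>R a)) has_real_derivative f' (x + s *\<^sub>R a)) (at s)" for x s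
  proof -
    have "((\<lambda>r. f ((x + s *\<^sub>R a) + r *\<^sub>R a)) has_real_derivative f' (x + s *\<^sub>R a)) (at 0)"
      using deriv[of "x + s *\<^sub>R a"] by (simp add: a_def)
    moreover have "(\<lambda>r. f ((x + s *\<^sub>R a) + r *\<^sub>R a)) = (\<lambda>r. f (x + (r + s) *\<^sub>R a))"
      by (simp add: algebra_simps)
    ultimately show ?thesis
      using DERIV_shift[of "\<lambda>s. f (x + s *\<^sub>R a)" "f' (x + s *\<^sub>R a)" 0 s] by simp
  qed
  \<comment> \<open>The intermediate point of the mean value theorem may leave the unit box by at
    most 1 in direction \<open>i\<close>; hence a box of side 2.\<close>
  have "compact (f' ` cbox 0 2)"
    by (intro compact_continuous_image continuous_on_subset[OF cont(2)]) auto
  then obtain B where B: "\<And>x. x \<in> cbox 0 2 \<Longrightarrow> \<bar>f' x\<bar> \<le> B"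
    using compact_imp_bounded by (fastforce simp: bounded_iff)
  have q_bound: "\<bar>q m x\<bar> \<le> B" if x: "x \<in> cbox 0 1" for m x
  proof -
    have "\<exists>z>0. z < h m \<and> f (x + h m *\<^sub>R a) - f (x + 0 *\<^sub>R a) = (h m - 0) * f' (x + z *\<^sub>R a)"
      by (rule MVT2[of 0 "h m" "\<lambda>s. f (x + s *\<^sub>R a)" "\<lambda>s. f' (x + s *\<^sub>R a)"]) (use h deriv' in auto)
    then obtain z where z: "0 < z" "z < h m" "f (x + h m *\<^sub>R a) - f x = h m * f' (x + z *\<^sub>R a)" by auto
    have "x + z *\<^sub>R a \<in> cbox 0 2"
    proof -
      have "0 \<le> z * a $ j" "z * a $ j \<le> 1" for j
        using z(1,2) h(2)[of m] by (auto simp: a_def axis_def)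
      moreover have "0 \<le> x $ j" "x $ j \<le> 1" for j using x by (auto simp: mem_box_cart)
      ultimately show ?thesis
        by (auto simp: mem_box_cart intro!: add_nonneg_nonneg) (metis add_mono one_add_one)
    qed
    then show ?thesis using B z(3) h(1)[of m] by (simp add: q_def)
  qed
  have cq: "continuous_on UNIV (q m)" for m
    unfolding q_def by (intro continuous_intros continuous_on_compose2[OF cont(1)]) (use h(1)[of m] in auto)
  have "(\<lambda>m. LINT x|torus. q m x) \<longlonglongrightarrow> (LINT x|torus. f' x)"
  proof (rule integral_dominated_convergence[where w = "\<lambda>_. B"])
    show "AE x in torus. norm (q m x) \<le> B" for m by (rule AE_I2) (simp add: q_bound)
    show "AE x in torus. (\<lambda>m. q m x) \<longlonglongrightarrow> f' x"
    proof (rule AE_I2)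
      fix x
      have "((\<lambda>s. (f (x + s *\<^sub>R a) - f x) / s) \<longlongrightarrow> f' x) (at 0)"
        using deriv[of x] unfolding a_def has_field_derivative_iff by simp
      moreover have "filterlim h (at 0) sequentially"
        unfolding filterlim_at h_def using LIMSEQ_inverse_real_of_nat
        by (auto simp: inverse_eq_divide)
      ultimately show "(\<lambda>m. q m x) \<longlonglongrightarrow> f' x"
        unfolding q_def by (rule filterlim_compose)
    qed
  qed (auto intro: borel_measurable_torus_continuous cont cq)
  moreover have "(LINT x|torus. q m x) = 0" for m
  proof -
    have c: "continuous_on UNIV (\<lambda>x. f (x + h m *\<^sub>R a))"
      by (intro continuous_intros continuous_on_compose2[OF cont(1)]) auto
    show ?thesis
      unfolding q_def using integral_torus_shift[OF cont(1) per, of "h m"] h[of m]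
        integrable_torus_continuous[OF c] integrable_torus_continuous[OF cont(1)]
      by (simp add: a_def)
  qed
  ultimately show ?thesis by (simp add: LIMSEQ_const_iff)
qed

lemma GDERIV_imp_DERIV_axis:
  assumes "GDERIV f x :> D"
  shows "((\<lambda>s. f (x + s *\<^sub>R axis i 1)) has_real_derivative D $ i) (at 0)"
proof -
  have "((\<lambda>s. x + s *\<^sub>R axis i 1) has_derivative (\<lambda>s. s *\<^sub>R axis i 1)) (at (0::real))"
    by (auto intro!: derivative_eq_intros)
  moreover have "(f has_derivative (\<lambda>h. h \<bullet> D)) (at (x + (0::real) *\<^sub>R axis i 1))"
    using assms by (simp add: gderiv_def)
  ultimately have "((\<lambda>s. f (x + s *\<^sub>R axis i 1)) has_derivative (\<lambda>s. (s *\<^sub>R axis i 1) \<bullet> D)) (at 0)"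
    by (rule has_derivative_compose)
  moreover have "(\<lambda>s. (s *\<^sub>R axis i 1) \<bullet> D) = (\<lambda>s. s * D $ i)"
    by (simp add: inner_commute[of _ D] inner_axis fun_eq_iff)
  ultimately show ?thesis by (simp add: has_field_derivative_def mult_commute_abs)
qed

lemma GDERIV_unique:
  fixes f :: "real^'n \<Rightarrow> real"
  assumes "GDERIV f x :> D" "GDERIV f x :> D'"
  shows "D = D'"
proof -
  have "D $ i = D' $ i" for i
    using assms[THEN GDERIV_imp_DERIV_axis[where i = i]] by (rule DERIV_unique)
  then show ?thesis by (simp add: vec_eq_iff)
qed

lemma smooth_continuous: "smooth f \<Longrightarrow> continuous_on UNIV f"
  by (erule smooth.cases)
    (auto simp: gderiv_def continuous_on_eq_continuous_at intro: has_derivative_continuous)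

text \<open>The gradient hidden in \<open>smooth\<close> has continuous components; uniqueness of
  gradients identifies it with \<open>D\<close>.\<close>

lemma test_function_continuous:
  assumes "test_function \<phi> D"
  shows "continuous_on UNIV \<phi>" "continuous_on UNIV (\<lambda>x. D x $ i)"
proof -
  have s: "smooth \<phi>" and D: "\<And>x. GDERIV \<phi> x :> D x" using assms by (auto simp: test_function_def)
  show "continuous_on UNIV \<phi>" by (rule smooth_continuous[OF s])
  from s obtain g where g: "\<And>x. GDERIV \<phi> x :> g x" "\<And>i. smooth (\<lambda>x. g x $ i)"
    by (cases rule: smooth.cases) auto
  then have "g = D" using GDERIV_unique D by blast
  then show "continuous_on UNIV (\<lambda>x. D x $ i)" using g(2) smooth_continuous by blast
qed

lemma GDERIV_cas: "GDERIV (cas k) x :> (\<chi> i. 2 * pi * of_int (k $ i) * cas (- k) x)"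
proof -
  define w where "w = (2 * pi) *\<^sub>R (\<chi> i. real_of_int (k $ i))"
  have phase: "phase k y = y \<bullet> w" for y
    by (simp add: phase_def w_def inner_vec_def sum_distrib_left mult_ac)
  have "GDERIV (phase k) x :> w"
    unfolding gderiv_def phase by (auto intro!: derivative_eq_intros)
  then have "GDERIV (\<lambda>x. cos (phase k x) + sin (phase k x)) x :> (- sin (phase k x)) *\<^sub>R w + cos (phase k x) *\<^sub>R w"
    by (intro GDERIV_add GDERIV_DERIV_compose[of "phase k"] DERIV_cos DERIV_sin)
  moreover have "(- sin (phase k x)) *\<^sub>R w + cos (phase k x) *\<^sub>R w = (\<chi> i. 2 * pi * of_int (k $ i) * cas (- k) x)"
    by (simp add: vec_eq_iff w_def cas_def algebra_simps)
  ultimately show ?thesis by (simp add: cas_def[abs_def])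
qed

text \<open>The multiples of all functions \<open>cas l\<close> are closed under partial
  derivatives, which is the invariant for coinduction. The factor \<open>c\<close> is part of it
  because each derivative produces one.\<close>

lemma smooth_cmult_cas: "smooth (\<lambda>x. c * cas k x)"
proof (rule smooth.coinduct[of "\<lambda>f. \<exists>c l. f = (\<lambda>x. c * cas l x)"])
  fix f :: "real^'a \<Rightarrow> real" assume "\<exists>c l. f = (\<lambda>x. c * cas l x)"
  then obtain c l where f: "f = (\<lambda>x. c * cas l x)" by blast
  define g where "g x = c *\<^sub>R (\<chi> i. 2 * pi * of_int (l $ i) * cas (- l) x)" for x
  have "((\<lambda>y. c * y) has_real_derivative c) (at y)" for y by (auto intro!: derivative_eq_intros)
  then have "GDERIV f x :> g x" for x
    unfolding f g_def by (rule GDERIV_DERIV_compose[OF GDERIV_cas])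
  moreover have "(\<lambda>x. g x $ i) = (\<lambda>x. (c * (2 * pi * of_int (l $ i))) * cas (- l) x)" for i
    by (simp add: g_def mult.assoc)
  ultimately show "\<exists>f' g. f = f' \<and> (\<forall>x. GDERIV f' x :> g x) \<and>
      (\<forall>i. (\<exists>c l. (\<lambda>x. g x $ i) = (\<lambda>x. c * cas l x)) \<or> smooth (\<lambda>x. g x $ i))"
    by blast
qed blast

lemma test_function_cas: "test_function (cas k) (\<lambda>x. \<chi> i. 2 * pi * of_int (k $ i) * cas (- k) x)"
  using smooth_cmult_cas[of 1 k] by (simp add: test_function_def cas_periodic GDERIV_cas)

text \<open>The product \<open>\<phi> * cas k\<close> is periodic, so its derivative in direction
  \<open>i\<close> has integral zero.\<close>

lemma integral_test_function_by_parts: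
  assumes "test_function \<phi> D"
  shows "(LINT x|torus. D x $ i * cas k x) = - 2 * pi * of_int (k $ i) * (LINT x|torus. \<phi> x * cas (- k) x)"
proof -
  define d where "d x = 2 * pi * of_int (k $ i) * cas (- k) x" for x
  have c: "continuous_on UNIV \<phi>" "continuous_on UNIV (\<lambda>x. D x $ i)" "continuous_on UNIV d" "continuous_on UNIV (cas k)"
    unfolding d_def by (intro test_function_continuous[OF assms] continuous_intros)+
  have "(LINT x|torus. \<phi> x * d x + D x $ i * cas k x) = 0"
  proof (rule integral_torus_directional_derivative[where f = "\<lambda>x. \<phi> x * cas k x" and i = i])
    show "\<phi> (x + axis i 1) * cas k (x + axis i 1) = \<phi> x * cas k x" for x
      using assms by (simp add: cas_periodic test_function_def)
    show "((\<lambda>s. \<phi> (x + s *\<^sub>R axis i 1) * cas k (x + s *\<^sub>R axis i 1)) has_real_derivative \<phi> x * d x + D x $ i * cas k x) (at 0)" for x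
    proof -
      have 1: "((\<lambda>s. \<phi> (x + s *\<^sub>R axis i 1)) has_real_derivative D x $ i) (at 0)"
        using assms by (intro GDERIV_imp_DERIV_axis) (simp add: test_function_def)
      have 2: "((\<lambda>s. cas k (x + s *\<^sub>R axis i 1)) has_real_derivative d x) (at 0)"
        using GDERIV_imp_DERIV_axis[OF GDERIV_cas, of k x i] by (simp add: d_def)
      show ?thesis using DERIV_mult[OF 1 2] by (simp add: algebra_simps)
    qed
  qed (intro continuous_intros c)+
  moreover have "integrable torus (\<lambda>x. \<phi> x * d x)" "integrable torus (\<lambda>x. D x $ i * cas k x)"
    by (intro integrable_torus_continuous continuous_intros c)+
  ultimately have "(LINT x|torus. D x $ i * cas k x) = - (LINT x|torus. \<phi> x * d x)" by simp
  also have "(LINT x|torus. \<phi> x * d x) = (LINT x|torus. (2 * pi * of_int (k $ i)) * (\<phi> x * cas (- k) x))"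
    by (simp add: d_def mult_ac)
  finally show ?thesis by simp
qed

section \<open>Vector fields by components\<close>

text \<open>The Hartley basis spans real-valued classes only, so vector-valued ones are reduced to
  it coordinate by coordinate.\<close>

definition component :: "'m \<Rightarrow> ('n::finite, real^'m) L2 \<Rightarrow> ('n, real) L2" where
  "component i g = abs_L2 (\<lambda>x. rep_L2 g x $ i)"

lemma rep_component: "AE x in torus. rep_L2 (component i g) x = rep_L2 g x $ i"
  unfolding component_def by (rule rep_abs_L2) auto

lemma component_eqI:
  assumes "\<And>i. component i g = component i h"
  shows "g = h"
proof (rule L2_eqI)
  have "AE x in torus. \<forall>i. rep_L2 (component i g) x = rep_L2 g x $ i"
    "AE x in torus. \<forall>i. rep_L2 (component i h) x = rep_L2 h x $ i"
    by (simp_all add: AE_all_countable rep_component)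
  then show "AE x in torus. rep_L2 g x = rep_L2 h x"
    by eventually_elim (simp add: vec_eq_iff assms)
qed

lemma component_diff: "component i (g - h) = component i g - component i h"
  by (rule L2_eqI) (use rep_component[of i "g - h"] rep_minus_L2[of g h] rep_component[of i g]
    rep_component[of i h] rep_minus_L2[of "component i g" "component i h"] in eventually_elim, simp)

lemma norm_component: "(norm g)\<^sup>2 = (\<Sum>i\<in>UNIV. (norm (component i g))\<^sup>2)"
proof -
  have eq: "(norm (component i g))\<^sup>2 = (LINT x|torus. (rep_L2 g x $ i)\<^sup>2)" for i
    unfolding component_def by (subst norm_abs_L2) auto
  have int: "integrable torus (\<lambda>x. (rep_L2 g x $ i)\<^sup>2)" for i
    using square_integrable_vec_nth[OF square_integrable_rep, of g i] by (simp add: square_integrable_def)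
  have "(norm y)\<^sup>2 = (\<Sum>i\<in>UNIV. (y $ i)\<^sup>2)" for y :: "real^'b"
    by (simp add: norm_vec_def L2_set_def sum_nonneg)
  then show ?thesis unfolding eq norm_L2_sq[of g] using int by simp
qed

lemma component_abs_L2:
  assumes "square_integrable g"
  shows "component i (abs_L2 g) = abs_L2 (\<lambda>x. g x $ i)"
  unfolding component_def
  by (rule abs_L2_eqI) (use assms rep_abs_L2[OF assms] in \<open>auto elim: eventually_mono\<close>)

text \<open>Reading the vector identity coordinatewise turns it into inner products in
  \<open>L\<^sup>2\<close>, where Parseval applies.\<close>

lemma has_weak_gradient_iff:
  "has_weak_gradient u g \<longleftrightarrow> (\<forall>\<phi> D. test_function \<phi> D \<longrightarrow>
     (\<forall>i. u \<bullet> abs_L2 (\<lambda>x. D x $ i) = - (component i g \<bullet> abs_L2 \<phi>)))"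
proof -
  have "(LINT x|torus. rep_L2 u x *\<^sub>R D x) = - (LINT x|torus. \<phi> x *\<^sub>R rep_L2 g x) \<longleftrightarrow>
     (\<forall>i. u \<bullet> abs_L2 (\<lambda>x. D x $ i) = - (component i g \<bullet> abs_L2 \<phi>))" if "test_function \<phi> D" for \<phi> D
  proof -
    have D: "square_integrable (\<lambda>x. D x $ i)" and \<phi>: "square_integrable \<phi>" for i
      by (intro square_integrable_continuous test_function_continuous[OF that])+
    have D': "square_integrable D" using square_integrable_vec_lambda[of "\<lambda>i x. D x $ i", OF D] by simp
    have "(LINT x|torus. rep_L2 u x *\<^sub>R D x) $ i = u \<bullet> abs_L2 (\<lambda>x. D x $ i)" for i
      using integral_bounded_linear[OF bounded_linear_vec_nth[of i] integrable_scaleR_square_integrable[OF square_integrable_rep D', of u]]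
      by (simp add: inner_abs_L2[OF D])
    moreover have "(LINT x|torus. \<phi> x *\<^sub>R rep_L2 g x) $ i = component i g \<bullet> abs_L2 \<phi>" for i
      using integral_bounded_linear[OF bounded_linear_vec_nth[of i] integrable_scaleR_square_integrable[OF \<phi> square_integrable_rep, of g]]
      by (simp add: component_def inner_abs_L2'[OF square_integrable_vec_nth[OF square_integrable_rep] \<phi>] mult.commute)
    ultimately show ?thesis by (simp add: vec_eq_iff)
  qed
  then show ?thesis unfolding has_weak_gradient_def by blast
qed

text \<open>The definition tested with \<open>cas k\<close>. All coefficients of a weak gradient are
  thereby prescribed, which gives its uniqueness.\<close>

lemma weak_gradient_coefficient:
  assumes "has_weak_gradient u g"
  shows "component i g \<bullet> hartley k = - 2 * pi * of_int (k $ i) * (u \<bullet> hartley (- k))"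
proof -
  have "u \<bullet> abs_L2 (\<lambda>x. (2 * pi * of_int (k $ i)) * cas (- k) x) = - (component i g \<bullet> abs_L2 (cas k))"
    using assms test_function_cas[of k] unfolding has_weak_gradient_iff by fastforce
  moreover have "square_integrable (\<lambda>x. (2 * pi * of_int (k $ i)) * cas (- k) x)"
    by (intro square_integrable_continuous continuous_intros)
  moreover have "(LINT x|torus. rep_L2 u x * ((2 * pi * of_int (k $ i)) * cas (- k) x)) =
      (2 * pi * of_int (k $ i)) * (LINT x|torus. rep_L2 u x * cas (- k) x)"
    by (subst integral_mult_right_zero[symmetric]) (simp add: mult_ac)
  ultimately show ?thesis
    unfolding inner_hartley[of u] by (simp add: inner_abs_L2 hartley_def)
qed

section \<open>The Dirichlet norm in Hartley coefficients\<close>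

text \<open>The eigenvalue of \<open>- \<Delta>\<close> at frequency \<open>k\<close>.\<close>

definition lam :: "int^'n \<Rightarrow> real" where
  "lam k = 4 * pi\<^sup>2 * (\<Sum>i\<in>UNIV. (of_int (k $ i))\<^sup>2)"

lemma lam_nonneg [simp]: "0 \<le> lam k"
  by (simp add: lam_def sum_nonneg)

lemma lam_simps [simp]: "lam 0 = 0" "lam (- k) = lam k"
  by (simp_all add: lam_def)

text \<open>A bound on the Dirichlet norm that presupposes no gradient; \<open>grad_le_iff\<close>
  turns it into existence of the weak gradient with norm at most \<open>B\<close>. Since
  \<open>B\<close> enters the sums only squared, its sign is required separately.\<close>

definition grad_le :: "('n::finite, real) L2 \<Rightarrow> real \<Rightarrow> bool" where
  "grad_le u B \<longleftrightarrow> 0 \<le> B \<and> (\<forall>K. finite K \<longrightarrow> (\<Sum>k\<in>K. lam k * (u \<bullet> hartley k)\<^sup>2) \<le> B\<^sup>2)"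

lemma lam_mult_inner:
  assumes "\<And>i. component i g \<bullet> hartley (- k) = - 2 * pi * of_int ((- k) $ i) * (u \<bullet> hartley k)"
  shows "lam k * (u \<bullet> hartley k)\<^sup>2 = (\<Sum>i\<in>UNIV. (component i g \<bullet> hartley (- k))\<^sup>2)"
  unfolding assms lam_def by (simp add: power_mult_distrib sum_distrib_left sum_distrib_right mult_ac)

lemma has_sum_finite_sum:
  fixes f :: "'i \<Rightarrow> 'k \<Rightarrow> 'b::topological_comm_monoid_add"
  assumes "finite I" "\<And>i. i \<in> I \<Longrightarrow> (f i has_sum s i) A"
  shows "((\<lambda>k. \<Sum>i\<in>I. f i k) has_sum (\<Sum>i\<in>I. s i)) A"
  using assms by (induction rule: finite_induct) (auto intro!: has_sum_add)

text \<open>Parseval for each component, reindexed by \<open>k \<mapsto> - k\<close> and added over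
  the components, makes \<open>(norm g)\<^sup>2\<close> the full sum whose finite parts occur in
  \<open>grad_le\<close>.\<close>

lemma norm_weak_gradient:
  assumes "\<And>i k. component i g \<bullet> hartley k = - 2 * pi * of_int (k $ i) * (u \<bullet> hartley (- k))"
  shows "grad_le u B \<longleftrightarrow> norm g \<le> B"
proof -
  have eq: "lam k * (u \<bullet> hartley k)\<^sup>2 = (\<Sum>i\<in>UNIV. (component i g \<bullet> hartley (- k))\<^sup>2)" for k
    by (rule lam_mult_inner) (simp add: assms)
  have "((\<lambda>k. (component i g \<bullet> hartley k)\<^sup>2) has_sum (norm (component i g))\<^sup>2) UNIV" for i
    using hartley.parseval[of "component i g" "component i g"]
    by (simp add: power2_eq_square[symmetric] power2_norm_eq_inner)
  then have "((\<lambda>k. (component i g \<bullet> hartley (- k))\<^sup>2) has_sum (norm (component i g))\<^sup>2) UNIV" for i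
    by (subst has_sum_reindex_bij_betw[where f = "\<lambda>k. (component i g \<bullet> hartley k)\<^sup>2" and g = uminus and B = UNIV])
      (auto intro!: bij_betwI[where g = uminus])
  then have "((\<lambda>k. \<Sum>i\<in>UNIV. (component i g \<bullet> hartley (- k))\<^sup>2) has_sum (\<Sum>i\<in>UNIV. (norm (component i g))\<^sup>2)) UNIV"
    by (intro has_sum_finite_sum) auto
  then have sum: "((\<lambda>k. lam k * (u \<bullet> hartley k)\<^sup>2) has_sum (norm g)\<^sup>2) UNIV"
    by (simp add: eq norm_component)
  show ?thesis
  proof
    assume "grad_le u B"
    then have "0 \<le> B" and le: "\<And>K. finite K \<Longrightarrow> (\<Sum>k\<in>K. lam k * (u \<bullet> hartley k)\<^sup>2) \<le> B\<^sup>2"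
      by (auto simp: grad_le_def)
    have "(norm g)\<^sup>2 \<le> B\<^sup>2" by (rule has_sum_le_finite_sums[OF sum le])
    then show "norm g \<le> B" using \<open>0 \<le> B\<close> by (rule power2_le_imp_le)
  next
    assume le: "norm g \<le> B"
    then have "0 \<le> B" using norm_ge_zero order_trans by blast
    have "(\<Sum>k\<in>K. lam k * (u \<bullet> hartley k)\<^sup>2) \<le> B\<^sup>2" if "finite K" for K
    proof -
      have "(\<Sum>k\<in>K. lam k * (u \<bullet> hartley k)\<^sup>2) \<le> (norm g)\<^sup>2"
        by (rule has_sum_mono_neutral[OF has_sum_finite[OF that] sum]) auto
      also have "\<dots> \<le> B\<^sup>2" using le by (intro power_mono) auto
      finally show ?thesis .
    qed
    then show "grad_le u B" using \<open>0 \<le> B\<close> by (simp add: grad_le_def)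
  qed
qed

text \<open>Riesz-Fischer builds each component from the coefficients a gradient is forced to have;
  they are square summable because the square of \<open>2 * pi * k $ i\<close> is at most
  \<open>lam k\<close>. The test identity then follows by Parseval from integration by parts of the
  test function.\<close>

lemma weak_gradient_exists:
  assumes "grad_le u B"
  obtains g where "has_weak_gradient u g"
proof -
  have "\<exists>w. \<forall>k. w \<bullet> hartley k = - 2 * pi * of_int (k $ i) * (u \<bullet> hartley (- k))" for i
  proof -
    have bound: "(\<Sum>k\<in>K. (- 2 * pi * of_int (k $ i) * (u \<bullet> hartley (- k)))\<^sup>2) \<le> B\<^sup>2" if K: "finite K" for K
    proof -
      have "(- 2 * pi * of_int (k $ i) * (u \<bullet> hartley (- k)))\<^sup>2 \<le> lam (- k) * (u \<bullet> hartley (- k))\<^sup>2" for k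
      proof -
        have "(of_int (k $ i))\<^sup>2 \<le> (\<Sum>i\<in>UNIV. (real_of_int (k $ i))\<^sup>2)" by (rule member_le_sum) auto
        then have "(4 * pi\<^sup>2 * (u \<bullet> hartley (- k))\<^sup>2) * (of_int (k $ i))\<^sup>2 \<le>
            (4 * pi\<^sup>2 * (u \<bullet> hartley (- k))\<^sup>2) * (\<Sum>i\<in>UNIV. (real_of_int (k $ i))\<^sup>2)"
          by (rule mult_left_mono) auto
        then show ?thesis unfolding lam_simps lam_def by (simp add: power_mult_distrib mult_ac)
      qed
      then have "(\<Sum>k\<in>K. (- 2 * pi * of_int (k $ i) * (u \<bullet> hartley (- k)))\<^sup>2) \<le> (\<Sum>k\<in>K. lam (- k) * (u \<bullet> hartley (- k))\<^sup>2)"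
        by (rule sum_mono)
      also have "\<dots> = (\<Sum>k\<in>uminus ` K. lam k * (u \<bullet> hartley k)\<^sup>2)"
        by (subst sum.reindex) (auto simp: o_def)
      also have "\<dots> \<le> B\<^sup>2" using assms K unfolding grad_le_def by blast
      finally show ?thesis .
    qed
    define c where "c k = - 2 * pi * of_int (k $ i) * (u \<bullet> hartley (- k))" for k
    have "\<exists>w. \<forall>k. w \<bullet> hartley k = c k"
    proof (rule hartley.riesz_fischer[of c "B\<^sup>2"])
      show "(\<Sum>k\<in>K. (c k)\<^sup>2) \<le> B\<^sup>2" if "finite K" for K unfolding c_def by (rule bound[OF that])
    qed blast
    then show ?thesis by (simp only: c_def)
  qed
  then obtain w where w: "\<And>i k. w i \<bullet> hartley k = - 2 * pi * of_int (k $ i) * (u \<bullet> hartley (- k))"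
    by metis
  define g where "g = abs_L2 (\<lambda>x. \<chi> i. rep_L2 (w i) x)"
  have comp: "component i g = w i" for i
    unfolding g_def by (subst component_abs_L2) (auto intro: square_integrable_vec_lambda)
  have "u \<bullet> abs_L2 (\<lambda>x. D x $ i) = - (w i \<bullet> abs_L2 \<phi>)" if t: "test_function \<phi> D" for \<phi> D i
  proof -
    have D: "square_integrable (\<lambda>x. D x $ i)" and \<phi>: "square_integrable \<phi>"
      by (intro square_integrable_continuous test_function_continuous[OF t])+
    have "abs_L2 (\<lambda>x. D x $ i) \<bullet> hartley k = - 2 * pi * of_int (k $ i) * (abs_L2 \<phi> \<bullet> hartley (- k))" for k
      using integral_test_function_by_parts[OF t, of i k]
      by (simp add: hartley_def inner_abs_L2' D \<phi> square_integrable_cas)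
    then have *: "(u \<bullet> hartley (- k)) * (abs_L2 (\<lambda>x. D x $ i) \<bullet> hartley (- k)) = - ((w i \<bullet> hartley k) * (abs_L2 \<phi> \<bullet> hartley k))" for k
      by (simp add: w)
    have "((\<lambda>k. (u \<bullet> hartley (- k)) * (abs_L2 (\<lambda>x. D x $ i) \<bullet> hartley (- k))) has_sum u \<bullet> abs_L2 (\<lambda>x. D x $ i)) UNIV"
      by (subst has_sum_reindex_bij_betw[where f = "\<lambda>k. (u \<bullet> hartley k) * (abs_L2 (\<lambda>x. D x $ i) \<bullet> hartley k)" and g = uminus and B = UNIV])
        (auto intro!: bij_betwI[where g = uminus] hartley.parseval)
    moreover have "((\<lambda>k. - ((w i \<bullet> hartley k) * (abs_L2 \<phi> \<bullet> hartley k))) has_sum - (w i \<bullet> abs_L2 \<phi>)) UNIV"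
      by (intro has_sum_uminusI hartley.parseval)
    ultimately show ?thesis unfolding * by (rule has_sum_unique)
  qed
  then have "has_weak_gradient u g" unfolding has_weak_gradient_iff comp by blast
  then show ?thesis by (rule that)
qed

lemma grad_eqI:
  assumes "has_weak_gradient u g"
  shows "grad u = g"
  unfolding grad_def
proof (rule the_equality)
  show "h = g" if "has_weak_gradient u h" for h
    by (rule component_eqI, rule hartley.eqI) (simp add: weak_gradient_coefficient[OF assms] weak_gradient_coefficient[OF that])
qed fact

lemma grad_le_iff: "grad_le u B \<longleftrightarrow> (\<exists>g. has_weak_gradient u g) \<and> norm (grad u) \<le> B"
proof
  assume le: "grad_le u B"
  obtain g where g: "has_weak_gradient u g" by (rule weak_gradient_exists[OF le])
  then show "(\<exists>g. has_weak_gradient u g) \<and> norm (grad u) \<le> B"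
    using norm_weak_gradient[OF weak_gradient_coefficient[OF g], of B] le grad_eqI[OF g] by auto
next
  assume r: "(\<exists>g. has_weak_gradient u g) \<and> norm (grad u) \<le> B"
  then obtain g where g: "has_weak_gradient u g" by blast
  then show "grad_le u B"
    using norm_weak_gradient[OF weak_gradient_coefficient[OF g], of B] r grad_eqI[OF g] by auto
qed

lemma grad_coefficient:
  assumes "grad_le u B"
  shows "component i (grad u) \<bullet> hartley k = - 2 * pi * of_int (k $ i) * (u \<bullet> hartley (- k))"
proof -
  obtain g where g: "has_weak_gradient u g" by (rule weak_gradient_exists[OF assms])
  then show ?thesis using weak_gradient_coefficient[OF g] grad_eqI[OF g] by simp
qed

lemma grad_le_nonneg: "grad_le u B \<Longrightarrow> 0 \<le> B"
  by (simp add: grad_le_def)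

lemma grad_le_mono: "grad_le u B \<Longrightarrow> B \<le> C \<Longrightarrow> grad_le u C"
  by (simp add: grad_le_iff)

lemma grad_le_zero [simp]: "grad_le 0 B \<longleftrightarrow> 0 \<le> B"
  by (simp add: grad_le_def)

text \<open>A finite truncation of the square root of \<open>- \<Delta>\<close>. It is bounded and
  linear, and its squared norm is the sum in \<open>grad_le\<close>, so gradient bounds become
  uniform norm bounds for a family of bounded linear maps.\<close>

definition dirichlet_part :: "(int^'n) set \<Rightarrow> ('n::finite, real) L2 \<Rightarrow> ('n, real) L2" where
  "dirichlet_part K u = (\<Sum>k\<in>K. (sqrt (lam k) * (u \<bullet> hartley k)) *\<^sub>R hartley k)"

lemma grad_le_dirichlet_part: "grad_le u B \<longleftrightarrow> 0 \<le> B \<and> (\<forall>K. finite K \<longrightarrow> norm (dirichlet_part K u) \<le> B)"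
proof -
  have eq: "finite K \<Longrightarrow> (norm (dirichlet_part K u))\<^sup>2 = (\<Sum>k\<in>K. lam k * (u \<bullet> hartley k)\<^sup>2)" for K
    unfolding dirichlet_part_def by (subst hartley.norm_sum_basis) (auto simp: power_mult_distrib)
  show ?thesis unfolding grad_le_def
    by (auto simp: eq[symmetric] power_mono_iff)
qed

lemma bounded_linear_dirichlet_part: "bounded_linear (dirichlet_part K)"
  unfolding dirichlet_part_def
  by (intro bounded_linear_sum bounded_linear_scaleR_left[THEN bounded_linear_compose] bounded_linear_const_mult bounded_linear_inner_left)

lemma grad_le_add:
  assumes "grad_le u B" "grad_le w C"
  shows "grad_le (u + w) (B + C)"
proof -
  have "dirichlet_part K (u + w) = dirichlet_part K u + dirichlet_part K w" for K
    by (rule linear_add[OF bounded_linear.linear[OF bounded_linear_dirichlet_part]])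
  moreover have "norm (dirichlet_part K u + dirichlet_part K w) \<le> B + C" if "finite K" for K
    using norm_triangle_ineq[of "dirichlet_part K u" "dirichlet_part K w"] assms that
    unfolding grad_le_dirichlet_part by fastforce
  ultimately show ?thesis using assms by (simp add: grad_le_dirichlet_part)
qed

lemma grad_le_minus: "grad_le (- u) B \<longleftrightarrow> grad_le u B"
  by (simp add: grad_le_def)

lemma grad_le_diff: "grad_le u B \<Longrightarrow> grad_le w C \<Longrightarrow> grad_le (u - w) (B + C)"
  using grad_le_add[of u B "- w" C] by (simp add: grad_le_minus)

lemma grad_le_LIMSEQ:
  assumes lim: "X \<longlonglongrightarrow> u" and X: "\<forall>\<^sub>F n in sequentially. grad_le (X n) B" 
  shows "grad_le u B"
proof -
  have "norm (dirichlet_part K u) \<le> B" if "finite K" for K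
  proof (rule tendsto_upperbound)
    show "(\<lambda>n. norm (dirichlet_part K (X n))) \<longlonglongrightarrow> norm (dirichlet_part K u)"
      by (intro tendsto_norm bounded_linear.tendsto[OF bounded_linear_dirichlet_part] lim)
    show "\<forall>\<^sub>F n in sequentially. norm (dirichlet_part K (X n)) \<le> B"
      using X by eventually_elim (use that in \<open>simp add: grad_le_dirichlet_part\<close>)
  qed simp
  moreover have "0 \<le> B" using X by (auto simp: grad_le_def eventually_sequentially)
  ultimately show ?thesis by (simp add: grad_le_dirichlet_part)
qed

text \<open>Each truncation commutes with the Bochner integral; the gradient of an integral is thus
  estimated without differentiating under the integral sign.\<close>

lemma grad_le_integral:
  fixes h :: "'a \<Rightarrow> ('n::finite, real) L2"
  assumes h: "integrable M h" and b: "integrable M b" and le: "AE x in M. grad_le (h x) (b x)"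
  shows "grad_le (LINT x|M. h x) (LINT x|M. b x)"
  unfolding grad_le_dirichlet_part
proof (intro conjI allI impI)
  show "0 \<le> (LINT x|M. b x)"
    by (rule integral_nonneg_AE) (rule eventually_mono[OF le], simp add: grad_le_def)
  fix K :: "(int^'n) set" assume "finite K"
  note bl = bounded_linear_dirichlet_part[of K]
  have "norm (dirichlet_part K (LINT x|M. h x)) = norm (LINT x|M. dirichlet_part K (h x))"
    by (simp add: integral_bounded_linear[OF bl h])
  also have "\<dots> \<le> (LINT x|M. norm (dirichlet_part K (h x)))"
    by (rule integral_norm_bound)
  also have "\<dots> \<le> (LINT x|M. b x)"
    by (intro integral_mono_AE integrable_norm integrable_bounded_linear[OF bl h] b)
      (rule eventually_mono[OF le], use \<open>finite K\<close> in \<open>simp add: grad_le_dirichlet_part\<close>)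
  finally show "norm (dirichlet_part K (LINT x|M. h x)) \<le> (LINT x|M. b x)" .
qed

lemma grad_diff:
  assumes "grad_le u B" "grad_le w C"
  shows "grad (u - w) = grad u - grad w"
  using grad_coefficient[OF assms(1)] grad_coefficient[OF assms(2)] grad_coefficient[OF grad_le_diff[OF assms]]
  by (intro component_eqI hartley.eqI) (simp add: component_diff inner_diff_left algebra_simps)

section \<open>The heat semigroup\<close>

text \<open>Coefficients of functions rather than of classes, since the heat flow acts on functions
  that are merely integrable.\<close>

definition hartley_coeff :: "(real^'n \<Rightarrow> real) \<Rightarrow> int^'n \<Rightarrow> real" where
  "hartley_coeff f k = (LINT x|torus. f x * cas k x)"

lemma hartley_coeff_rep: "hartley_coeff (rep_L2 u) k = u \<bullet> hartley k"
  by (simp add: hartley_coeff_def inner_hartley)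

lemma integrable_mult_bounded:
  fixes f g :: "real^'n \<Rightarrow> real"
  assumes "integrable torus f" and [measurable]: "g \<in> borel_measurable torus" and "\<And>x. \<bar>g x\<bar> \<le> C"
  shows "integrable torus (\<lambda>x. f x * g x)"
proof (rule Bochner_Integration.integrable_bound)
  have [measurable]: "f \<in> borel_measurable torus" using assms(1) by (rule borel_measurable_integrable)
  show "integrable torus (\<lambda>x. C * f x)" using assms(1) by simp
  show "(\<lambda>x. f x * g x) \<in> borel_measurable torus" by measurable
  have "\<bar>f x * g x\<bar> \<le> \<bar>C * f x\<bar>" for x
    using mult_left_mono[OF order_trans[OF assms(3) abs_ge_self], of "\<bar>f x\<bar>" x] by (simp add: abs_mult mult.commute)
  then show "AE x in torus. norm (f x * g x) \<le> norm (C * f x)" by simp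
qed

lemma integrable_mult_cas: "integrable torus f \<Longrightarrow> integrable torus (\<lambda>x. f x * cas k x)"
  by (rule integrable_mult_bounded[OF _ cas_measurable abs_cas_le])

lemma abs_hartley_coeff_le:
  assumes "integrable torus f"
  shows "\<bar>hartley_coeff f k\<bar> \<le> 2 * (LINT x|torus. \<bar>f x\<bar>)"
proof -
  have "\<bar>hartley_coeff f k\<bar> \<le> (LINT x|torus. 2 * \<bar>f x\<bar>)"
    unfolding hartley_coeff_def
  proof (rule order_trans[OF integral_abs_bound integral_mono])
    show "integrable torus (\<lambda>x. \<bar>f x * cas k x\<bar>)" "integrable torus (\<lambda>x. 2 * \<bar>f x\<bar>)"
      using assms integrable_mult_cas[OF assms] by simp_all
    show "\<bar>f x * cas k x\<bar> \<le> 2 * \<bar>f x\<bar>" for x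
      using mult_left_mono[OF abs_cas_le[of k x], of "\<bar>f x\<bar>"] by (simp add: abs_mult mult.commute)
  qed
  then show ?thesis by simp
qed

lemma hartley_coeff_diff:
  assumes "integrable torus f" "integrable torus g"
  shows "hartley_coeff (\<lambda>x. f x - g x) k = hartley_coeff f k - hartley_coeff g k"
  unfolding hartley_coeff_def left_diff_distrib by (intro Bochner_Integration.integral_diff integrable_mult_cas assms)

text \<open>The real part of the Fourier coefficient is the even part in \<open>k\<close> of the
  Hartley coefficient; the imaginary part is the negative of its odd part.\<close>

lemma fourier_coeff_eq:
  assumes f: "integrable torus f"
  shows "fourier_coeff f k =
    Complex ((hartley_coeff f k + hartley_coeff f (- k)) / 2) ((hartley_coeff f (- k) - hartley_coeff f k) / 2)"
proof -
  have cis: "cis (- 2 * pi * (\<Sum>i\<in>UNIV. of_int (k $ i) * x $ i)) = Complex (cos (phase k x)) (- sin (phase k x))" for x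
    by (simp add: complex_eq_iff phase_def mult.assoc)
  have cont: "continuous_on UNIV (\<lambda>x. cos (phase k x))" "continuous_on UNIV (\<lambda>x. sin (phase k x))"
    by (intro continuous_intros)+
  note meas[measurable] = borel_measurable_torus_continuous[OF cont(1)] borel_measurable_torus_continuous[OF cont(2)]
  have int: "integrable torus (\<lambda>x. f x * cos (phase k x))" "integrable torus (\<lambda>x. f x * sin (phase k x))"
    by (rule integrable_mult_bounded[OF f, of _ 1]; simp)+
  have hc: "hartley_coeff f k = (LINT x|torus. f x * cos (phase k x)) + (LINT x|torus. f x * sin (phase k x))"
    "hartley_coeff f (- k) = (LINT x|torus. f x * cos (phase k x)) - (LINT x|torus. f x * sin (phase k x))"
    using int by (simp_all add: hartley_coeff_def cas_def distrib_left right_diff_distrib)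
  have "complex_of_real (f x) * cis (- 2 * pi * (\<Sum>i\<in>UNIV. of_int (k $ i) * x $ i)) =
      of_real (f x * cos (phase k x)) - \<i> * of_real (f x * sin (phase k x))" for x
    unfolding cis by (simp add: complex_eq_iff)
  then have "fourier_coeff f k = (LINT x|torus. of_real (f x * cos (phase k x)) - \<i> * of_real (f x * sin (phase k x)))"
    unfolding fourier_coeff_def by simp
  also have "\<dots> = of_real (LINT x|torus. f x * cos (phase k x)) - \<i> * of_real (LINT x|torus. f x * sin (phase k x))"
    using int by (subst Bochner_Integration.integral_diff) (auto simp del: of_real_mult)
  finally show ?thesis unfolding hc by (simp add: complex_eq_iff)
qed

lemma integrable_rep_L2: "integrable torus (rep_L2 (u :: ('n::finite, real) L2))"
  using square_integrable_inner[of "rep_L2 u" "\<lambda>_. 1"] by auto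

text \<open>The multiplier is real and takes the same value at \<open>k\<close> and
  \<open>- k\<close>, so one complex condition at \<open>k\<close> amounts to the two real
  conditions at \<open>k\<close> and \<open>- k\<close>.\<close>

lemma fourier_multiplier_iff:
  assumes f: "integrable torus f"
  shows "(\<forall>k. fourier_coeff (rep_L2 g) k =
     of_real (exp (- 4 * pi\<^sup>2 * t * (\<Sum>i\<in>UNIV. (of_int (k $ i))\<^sup>2))) * fourier_coeff f k) \<longleftrightarrow>
     (\<forall>k. g \<bullet> hartley k = exp (- t * lam k) * hartley_coeff f k)"
proof -
  have m: "exp (- 4 * pi\<^sup>2 * t * (\<Sum>i\<in>UNIV. (of_int (k $ i))\<^sup>2)) = exp (- t * lam k)" for k :: "int^'n"
    by (simp add: lam_def mult_ac)
  have *: "fourier_coeff (rep_L2 g) k = of_real (exp (- t * lam k)) * fourier_coeff f k \<longleftrightarrow>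
      g \<bullet> hartley k = exp (- t * lam k) * hartley_coeff f k \<and>
      g \<bullet> hartley (- k) = exp (- t * lam (- k)) * hartley_coeff f (- k)" for k
  proof -
    have "(a + b) / 2 = m * ((c + d) / 2) \<and> (b - a) / 2 = m * ((d - c) / 2) \<longleftrightarrow> a = m * c \<and> b = m * d"
      for a b c d m :: real
      by (simp add: field_simps) argo
    then show ?thesis
      by (simp add: fourier_coeff_eq f integrable_rep_L2 complex_eq_iff hartley_coeff_rep)
  qed
  show ?thesis unfolding m * by auto
qed

lemma heat_eqI:
  assumes f: "integrable torus f" and g: "\<And>k. g \<bullet> hartley k = exp (- t * lam k) * hartley_coeff f k"
  shows "heat t f = g"
  unfolding heat_def fourier_multiplier_iff[OF f]
  by (rule the_equality) (auto intro: hartley.eqI simp: g)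

lemma hartley_exists:
  fixes c :: "int^'n \<Rightarrow> real"
  assumes "\<And>K. finite K \<Longrightarrow> (\<Sum>k\<in>K. (c k)\<^sup>2) \<le> B"
  shows "\<exists>g :: ('n::finite, real) L2. \<forall>k. g \<bullet> hartley k = c k"
  using hartley.riesz_fischer[OF assms] by blast

section \<open>Smoothing of integrable functions\<close>

text \<open>Completing the square,
  \<open>a * j\<^sup>2 \<ge> 2 * sqrt a * \<bar>j\<bar> - 1\<close>, replaces the Gaussian sum by a
  geometric one with ratio \<open>q\<close>, whose sum is at most
  \<open>1 + 1 / (2 * sqrt a)\<close>. The factor 6 is 3, a bound for \<open>exp 1\<close>, times
  two half-lines, which both count \<open>j = 0\<close>.\<close>

lemma sum_exp_square_le:
  assumes "0 < a"
  shows "(\<Sum>j\<in>{- int M..int M}. exp (- a * (of_int j)\<^sup>2)) \<le> 6 * (1 + 1 / sqrt a)"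
proof -
  define q where "q = exp (- 2 * sqrt a)"
  have q: "0 < q" "q < 1" using assms by (auto simp: q_def)
  have le: "exp (- a * (of_int j)\<^sup>2) \<le> 3 * q ^ nat \<bar>j\<bar>" for j :: int
  proof -
    have "0 \<le> (sqrt a * \<bar>of_int j\<bar> - 1)\<^sup>2" by simp
    then have "2 * sqrt a * \<bar>of_int j\<bar> - 1 \<le> a * (of_int j)\<^sup>2"
      using assms by (simp add: power2_diff power_mult_distrib)
    then have "exp (- a * (of_int j)\<^sup>2) \<le> exp (1 + \<bar>of_int j\<bar> * (- 2 * sqrt a))" by (simp add: mult_ac)
    also have "\<dots> = exp 1 * q ^ nat \<bar>j\<bar>"
      unfolding q_def exp_add by (simp flip: exp_of_nat_mult)
    also have "\<dots> \<le> 3 * q ^ nat \<bar>j\<bar>"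
      using exp_le q by (intro mult_right_mono) auto
    finally show ?thesis .
  qed
  have geo: "(\<Sum>j\<le>M. q ^ j) \<le> 1 / (1 - q)"
  proof -
    have "(\<Sum>j\<le>M. q ^ j) = (1 - q ^ Suc M) / (1 - q)"
      using q sum_gp_basic[of q M] by (simp add: field_simps)
    also have "\<dots> \<le> 1 / (1 - q)" using q by (intro divide_right_mono) auto
    finally show ?thesis .
  qed
  have "{- int M..int M} = int ` {..M} \<union> (\<lambda>j. - int j) ` {..M}"
  proof (intro equalityI subsetI)
    fix j assume "j \<in> {- int M..int M}"
    then show "j \<in> int ` {..M} \<union> (\<lambda>j. - int j) ` {..M}"
      by (cases "0 \<le> j") (auto intro!: image_eqI[of j int "nat j"] image_eqI[of j "\<lambda>j. - int j" "nat (- j)"])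
  qed auto
  then have "(\<Sum>j\<in>{- int M..int M}. exp (- a * (of_int j)\<^sup>2)) \<le>
      (\<Sum>j\<in>int ` {..M}. exp (- a * (of_int j)\<^sup>2)) + (\<Sum>j\<in>(\<lambda>j. - int j) ` {..M}. exp (- a * (of_int j)\<^sup>2))"
    using sum.union_inter[of "int ` {..M}" "(\<lambda>j. - int j) ` {..M}" "\<lambda>j. exp (- a * (of_int j)\<^sup>2)"]
      sum_nonneg[of "int ` {..M} \<inter> (\<lambda>j. - int j) ` {..M}" "\<lambda>j. exp (- a * (of_int j)\<^sup>2)"]
    by simp
  also have "\<dots> \<le> (\<Sum>j\<le>M. 3 * q ^ j) + (\<Sum>j\<le>M. 3 * q ^ j)"
    using le[of "int _"] le[of "- int _"]
    by (intro add_mono) (subst sum.reindex, auto simp: inj_on_def intro!: sum_mono)+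
  also have "\<dots> = 6 * (\<Sum>j\<le>M. q ^ j)" by (simp add: sum_distrib_left)
  also have "\<dots> \<le> 6 * (1 + 1 / sqrt a)"
  proof -
    define y where "y = 2 * sqrt a"
    have y: "0 < y" using assms by (simp add: y_def)
    have "1 + y \<le> exp y" by (rule exp_ge_add_one_self)
    then have "inverse (exp y) \<le> inverse (1 + y)" using y by (intro le_imp_inverse_le) auto
    moreover have "q = inverse (exp y)" by (simp add: q_def y_def flip: exp_minus)
    ultimately have "q \<le> 1 / (1 + y)" by (simp add: inverse_eq_divide)
    then have "y / (1 + y) \<le> 1 - q" using y by (simp add: field_simps)
    then have "1 / (1 - q) \<le> 1 / (y / (1 + y))" using y q by (intro divide_left_mono) auto
    also have "\<dots> = 1 + 1 / y" using y by (simp add: field_simps)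
    also have "\<dots> \<le> 1 + 1 / sqrt a" using assms by (simp add: y_def field_simps)
    finally have "(\<Sum>j\<le>M. q ^ j) \<le> 1 + 1 / sqrt a" by (rule order_trans[OF geo])
    then show ?thesis by (rule mult_left_mono) simp
  qed
  finally show ?thesis .
qed

text \<open>On a cube of frequencies containing \<open>K\<close> the exponential factorises over the
  coordinates, and the sum becomes a power of the one-dimensional sum.\<close>

lemma sum_exp_lam_le:
  fixes K :: "(int^'n) set"
  assumes "finite K" "0 < s"
  shows "(\<Sum>k\<in>K. exp (- s * lam k)) \<le> (6 * (1 + 1 / sqrt s)) ^ CARD('n)"
proof -
  define a where "a = 4 * pi\<^sup>2 * s"
  \<comment> \<open>A bound for all coordinates of all frequencies in \<open>K\<close>; the inserted
    0 makes the maximum meaningful for empty \<open>K\<close>.\<close>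
  define M where "M = nat (Max (insert 0 ((\<lambda>(k, i). \<bar>k $ i\<bar>) ` (K \<times> UNIV))))"
  define Box where "Box = {k :: int^'n. \<forall>i. k $ i \<in> {- int M..int M}}"
  have "k \<in> Box" if "k \<in> K" for k
  proof -
    have "\<bar>k $ i\<bar> \<le> int M" for i
    proof -
      have "\<bar>k $ i\<bar> \<le> Max (insert 0 ((\<lambda>(k, i). \<bar>k $ i\<bar>) ` (K \<times> UNIV)))"
        using assms(1) that by (intro Max_ge) (auto intro!: image_eqI[of _ _ "(k, i)"])
      then show ?thesis unfolding M_def by linarith
    qed
    then show ?thesis by (auto simp: Box_def abs_le_iff minus_le_iff)
  qed
  then have "K \<subseteq> Box" by blast
  have img: "Box = vec_lambda ` (PiE UNIV (\<lambda>_. {- int M..int M}))"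
  proof (intro equalityI subsetI)
    fix k assume "k \<in> Box"
    then show "k \<in> vec_lambda ` (PiE UNIV (\<lambda>_. {- int M..int M}))"
      by (intro image_eqI[of _ _ "vec_nth k"]) (auto simp: vec_nth_inverse Box_def)
  qed (auto simp: Box_def PiE_iff)
  then have "finite Box" by (auto intro!: finite_PiE)
  have "exp (- s * lam k) = (\<Prod>i\<in>UNIV. exp (- a * (of_int (k $ i))\<^sup>2))" for k :: "int^'n"
  proof -
    have "- s * lam k = (\<Sum>i\<in>UNIV. - a * (of_int (k $ i))\<^sup>2)"
      unfolding sum_distrib_left[symmetric] by (simp add: lam_def a_def)
    then show ?thesis by (simp only: exp_sum finite)
  qed
  then have "(\<Sum>k\<in>Box. exp (- s * lam k)) = (\<Sum>k\<in>Box. \<Prod>i\<in>UNIV. exp (- a * (of_int (k $ i))\<^sup>2))" by simp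
  also have "\<dots> = (\<Sum>g\<in>PiE (UNIV :: 'n set) (\<lambda>_. {- int M..int M}). \<Prod>i\<in>UNIV. exp (- a * (of_int (g i))\<^sup>2))"
    unfolding img by (subst sum.reindex) (auto simp: inj_on_def vec_lambda_inject)
  also have "\<dots> = (\<Prod>i\<in>(UNIV :: 'n set). \<Sum>j\<in>{- int M..int M}. exp (- a * (of_int j)\<^sup>2))"
    by (rule prod_sum_PiE[symmetric]) auto
  also have "\<dots> = (\<Sum>j\<in>{- int M..int M}. exp (- a * (of_int j)\<^sup>2)) ^ CARD('n)" by simp
  also have "\<dots> \<le> (6 * (1 + 1 / sqrt s)) ^ CARD('n)"
  proof (rule power_mono)
    have "1 \<le> pi\<^sup>2" using pi_ge_two by (simp add: one_le_power)
    then have "1 * s \<le> (4 * pi\<^sup>2) * s" using assms(2) by (intro mult_right_mono) auto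
    then have "s \<le> a" by (simp add: a_def)
    then have "6 * (1 + 1 / sqrt a) \<le> 6 * (1 + 1 / sqrt s)"
      using assms(2) by (auto intro!: divide_left_mono mult_pos_pos)
    moreover have "0 < a" using \<open>s \<le> a\<close> assms(2) by simp
    ultimately show "(\<Sum>j\<in>{- int M..int M}. exp (- a * (of_int j)\<^sup>2)) \<le> 6 * (1 + 1 / sqrt s)"
      using sum_exp_square_le[of a M] by linarith
  qed (intro sum_nonneg, simp)
  finally have "(\<Sum>k\<in>Box. exp (- s * lam k)) \<le> (6 * (1 + 1 / sqrt s)) ^ CARD('n)" .
  moreover have "(\<Sum>k\<in>K. exp (- s * lam k)) \<le> (\<Sum>k\<in>Box. exp (- s * lam k))"
    by (rule sum_mono2[OF \<open>finite Box\<close> \<open>K \<subseteq> Box\<close>]) simp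
  ultimately show ?thesis by linarith
qed

text \<open>The coefficients are bounded by twice the \<open>L\<^sup>1\<close> norm, and the squared
  multipliers add up to the trace of the heat semigroup at time \<open>2 * t\<close>.\<close>

lemma sum_heat_coeff_le:
  fixes f :: "real^'n \<Rightarrow> real"
  assumes f: "integrable torus f" and t: "0 < t" and K: "finite K"
  shows "(\<Sum>k\<in>K. (exp (- t * lam k) * hartley_coeff f k)\<^sup>2) \<le>
    (2 * (LINT x|torus. \<bar>f x\<bar>))\<^sup>2 * (6 * (1 + 1 / sqrt (2 * t))) ^ CARD('n)"
proof -
  have "(exp (- t * lam k) * hartley_coeff f k)\<^sup>2 \<le> (2 * (LINT x|torus. \<bar>f x\<bar>))\<^sup>2 * exp (- (2 * t) * lam k)" for k
  proof -
    have "(exp (- t * lam k))\<^sup>2 = exp (- (2 * t) * lam k)" by (simp flip: exp_double)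
    moreover have "(hartley_coeff f k)\<^sup>2 \<le> (2 * (LINT x|torus. \<bar>f x\<bar>))\<^sup>2"
      using power_mono[OF abs_hartley_coeff_le[OF f, of k], of 2] by simp
    ultimately show ?thesis by (simp add: power_mult_distrib mult.commute mult_left_mono)
  qed
  then have "(\<Sum>k\<in>K. (exp (- t * lam k) * hartley_coeff f k)\<^sup>2) \<le>
      (\<Sum>k\<in>K. (2 * (LINT x|torus. \<bar>f x\<bar>))\<^sup>2 * exp (- (2 * t) * lam k))" by (rule sum_mono)
  also have "\<dots> = (2 * (LINT x|torus. \<bar>f x\<bar>))\<^sup>2 * (\<Sum>k\<in>K. exp (- (2 * t) * lam k))"
    by (simp add: sum_distrib_left)
  also have "\<dots> \<le> (2 * (LINT x|torus. \<bar>f x\<bar>))\<^sup>2 * (6 * (1 + 1 / sqrt (2 * t))) ^ CARD('n)"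
    by (intro mult_left_mono sum_exp_lam_le K) (use t in auto)
  finally show ?thesis .
qed

text \<open>At positive times the damped coefficients of an integrable function are square summable,
  so the description in \<open>heat\<close> is met by a class.\<close>

lemma inner_heat:
  fixes f :: "real^'n \<Rightarrow> real"
  assumes f: "integrable torus f" and t: "0 < t"
  shows "heat t f \<bullet> hartley k = exp (- t * lam k) * hartley_coeff f k"
proof -
  obtain g :: "('n, real) L2" where g: "\<And>k. g \<bullet> hartley k = exp (- t * lam k) * hartley_coeff f k"
    using hartley_exists[OF sum_heat_coeff_le[OF f t]] by blast
  then show ?thesis using heat_eqI[OF f g] by simp
qed

text \<open>The heat trace at time \<open>2 * t\<close> is of order \<open>t powr (- N / 2)\<close>,
  and the norm takes its square root. For \<open>t \<le> 1\<close> the constant in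
  \<open>1 + 1 / sqrt (2 * t)\<close> is absorbed by the power, which turns 6 into 12.\<close>

lemma norm_heat_L1:
  fixes f :: "real^'n \<Rightarrow> real"
  assumes f: "integrable torus f" and t: "0 < t" "t \<le> 1"
  shows "norm (heat t f) \<le> 2 * 12 ^ CARD('n) * t powr (- real CARD('n) / 4) * (LINT x|torus. \<bar>f x\<bar>)"
proof (rule hartley.norm_le)
  fix K :: "(int^'n) set" assume K: "finite K"
  define F where "F = (LINT x|torus. \<bar>f x\<bar>)"
  have "1 + 1 / sqrt (2 * t) \<le> 2 * t powr (-1/2)"
  proof -
    have "1 \<le> 1 / sqrt t" using t by simp
    moreover have "1 / sqrt (2 * t) \<le> 1 / sqrt t" using t by (intro divide_left_mono) auto
    moreover have "t powr (-1/2) = 1 / sqrt t"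
      using t by (simp add: powr_minus_divide powr_half_sqrt)
    ultimately show ?thesis by linarith
  qed
  then have "(6 * (1 + 1 / sqrt (2 * t))) ^ CARD('n) \<le> (12 * t powr (-1/2)) ^ CARD('n)"
    using t by (intro power_mono) auto
  also have "\<dots> = 12 ^ CARD('n) * (t powr (- real CARD('n) / 4))\<^sup>2"
    using t by (simp add: power_mult_distrib powr_power)
  \<comment> \<open>The constant is enlarged to its own square so that the bound becomes a perfect
    square.\<close>
  also have "\<dots> \<le> (12 ^ CARD('n) * t powr (- real CARD('n) / 4))\<^sup>2"
    unfolding power_mult_distrib by (intro mult_right_mono) (auto simp: power2_eq_square)
  finally have "(2 * F)\<^sup>2 * (6 * (1 + 1 / sqrt (2 * t))) ^ CARD('n)
      \<le> (2 * F)\<^sup>2 * (12 ^ CARD('n) * t powr (- real CARD('n) / 4))\<^sup>2"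
    by (rule mult_left_mono) simp
  also have "\<dots> = (2 * 12 ^ CARD('n) * t powr (- real CARD('n) / 4) * F)\<^sup>2"
    by (simp add: power_mult_distrib)
  finally show "(\<Sum>k\<in>K. (heat t f \<bullet> hartley k)\<^sup>2) \<le> (2 * 12 ^ CARD('n) * t powr (- real CARD('n) / 4) * (LINT x|torus. \<bar>f x\<bar>))\<^sup>2"
    using sum_heat_coeff_le[OF f t(1) K] by (simp add: inner_heat[OF f t(1)] F_def)
qed auto

section \<open>The semigroup on square integrable classes\<close>

text \<open>Bessel's inequality takes the place of the heat trace, so the time \<open>t = 0\<close>
  is included.\<close>

lemma inner_heat_rep:
  assumes t: "0 \<le> t"
  shows "heat t (rep_L2 u) \<bullet> hartley k = exp (- t * lam k) * (u \<bullet> hartley k)"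
proof -
  have "(\<Sum>k\<in>K. (exp (- t * lam k) * (u \<bullet> hartley k))\<^sup>2) \<le> (norm u)\<^sup>2" if "finite K" for K
  proof -
    have "(exp (- t * lam k) * (u \<bullet> hartley k))\<^sup>2 \<le> (u \<bullet> hartley k)\<^sup>2" for k
      unfolding power_mult_distrib using t by (intro mult_left_le_one_le power_le_one) auto
    then show ?thesis by (intro order_trans[OF sum_mono hartley.bessel[OF that]])
  qed
  then obtain g where "\<And>k. g \<bullet> hartley k = exp (- t * lam k) * (u \<bullet> hartley k)"
    using hartley_exists[of "\<lambda>k. exp (- t * lam k) * (u \<bullet> hartley k)"] by blast
  then show ?thesis using heat_eqI[OF integrable_rep_L2, of g t u] by (simp add: hartley_coeff_rep)
qed

lemma heat_rep_eqI: "0 \<le> t \<Longrightarrow> (\<And>k. g \<bullet> hartley k = exp (- t * lam k) * (u \<bullet> hartley k)) \<Longrightarrow> heat t (rep_L2 u) = g"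
  by (rule hartley.eqI) (simp add: inner_heat_rep)

lemma heat_0_rep [simp]: "heat 0 (rep_L2 u) = u"
  by (rule heat_rep_eqI) auto

lemma norm_heat_rep_le:
  fixes u :: "('n::finite, real) L2"
  assumes "0 \<le> t"
  shows "norm (heat t (rep_L2 u)) \<le> norm u"
proof (rule hartley.norm_le)
  fix K :: "(int^'n) set" assume "finite K"
  have "(heat t (rep_L2 u) \<bullet> hartley k)\<^sup>2 \<le> (u \<bullet> hartley k)\<^sup>2" for k
    unfolding inner_heat_rep[OF assms] power_mult_distrib
    using assms by (intro mult_left_le_one_le power_le_one) auto
  then show "(\<Sum>k\<in>K. (heat t (rep_L2 u) \<bullet> hartley k)\<^sup>2) \<le> (norm u)\<^sup>2"
    by (intro order_trans[OF sum_mono hartley.bessel[OF \<open>finite K\<close>]])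
qed simp

lemma bounded_linear_heat_rep:
  assumes "0 \<le> t"
  shows "bounded_linear (\<lambda>u. heat t (rep_L2 u))"
proof (rule bounded_linear_intro[where K = 1])
  show "heat t (rep_L2 (u + w)) = heat t (rep_L2 u) + heat t (rep_L2 w)" for u w :: "('n::finite, real) L2"
    by (rule heat_rep_eqI[OF assms]) (simp add: inner_add_left inner_heat_rep[OF assms] distrib_left)
  show "heat t (rep_L2 (c *\<^sub>R u)) = c *\<^sub>R heat t (rep_L2 u)" for c and u :: "('n::finite, real) L2"
    by (rule heat_rep_eqI[OF assms]) (simp add: inner_heat_rep[OF assms])
qed (simp add: norm_heat_rep_le[OF assms])

lemma exp_minus_add_mult: "exp (- ((s + t) * l)) = exp (- (s * l)) * exp (- (t * l))" for s t l :: real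
  by (simp add: exp_add[symmetric] algebra_simps)

lemma heat_semigroup:
  assumes f: "integrable torus f" and "0 \<le> s" "0 < t"
  shows "heat s (rep_L2 (heat t f)) = heat (s + t) f"
  by (rule hartley.eqI)
    (use assms in \<open>simp add: inner_heat_rep inner_heat[OF f] exp_minus_add_mult[of s t] mult.assoc del: minus_add_distrib\<close>)

lemma heat_semigroup_rep:
  assumes "0 \<le> s" "0 \<le> t"
  shows "heat s (rep_L2 (heat t (rep_L2 u))) = heat (s + t) (rep_L2 u)"
  by (rule hartley.eqI)
    (use assms in \<open>simp add: inner_heat_rep exp_minus_add_mult[of s t] mult.assoc del: minus_add_distrib\<close>)

lemma heat_diff:
  assumes "integrable torus f" "integrable torus g" "0 < t"
  shows "heat t f - heat t g = heat t (\<lambda>x. f x - g x)"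
  by (rule hartley.eqI)
    (use assms in \<open>simp add: inner_heat inner_diff_left hartley_coeff_diff right_diff_distrib\<close>)

lemma heat_cong_AE:
  assumes "integrable torus f" "integrable torus g" "0 < t" "AE x in torus. f x = g x"
  shows "heat t f = heat t g"
proof (rule hartley.eqI)
  have "hartley_coeff f k = hartley_coeff g k" for k
    unfolding hartley_coeff_def
    by (rule integral_cong_AE) (use assms(1,2) assms(4) integrable_mult_cas in \<open>auto elim: eventually_mono\<close>)
  then show "heat t f \<bullet> hartley k = heat t g \<bullet> hartley k" for k
    by (simp add: inner_heat assms)
qed

text \<open>Mode by mode, \<open>1 + y \<le> exp y\<close> with \<open>y = 2 * t * lam k\<close>
  yields \<open>lam k * exp (- y) \<le> 1 / t\<close>.\<close>

lemma grad_le_heat_rep: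
  fixes u :: "('n::finite, real) L2"
  assumes t: "0 < t"
  shows "grad_le (heat t (rep_L2 u)) (norm u / sqrt t)"
  unfolding grad_le_def
proof (intro conjI allI impI)
  fix K :: "(int^'n) set" assume K: "finite K"
  have "lam k * (heat t (rep_L2 u) \<bullet> hartley k)\<^sup>2 \<le> (1 / t) * (u \<bullet> hartley k)\<^sup>2" for k
  proof -
    have "t * lam k \<le> 1 + (2 * t) * lam k" using t by (simp add: mult_nonneg_nonneg)
    also have "\<dots> \<le> exp ((2 * t) * lam k)" by (rule exp_ge_add_one_self)
    finally have "lam k * exp (- ((2 * t) * lam k)) \<le> 1 / t"
      using t by (simp add: exp_minus field_simps)
    moreover have "(exp (- t * lam k))\<^sup>2 = exp (- ((2 * t) * lam k))" by (simp flip: exp_double)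
    ultimately have "lam k * (exp (- t * lam k))\<^sup>2 * (u \<bullet> hartley k)\<^sup>2 \<le> (1 / t) * (u \<bullet> hartley k)\<^sup>2"
      by (intro mult_right_mono) auto
    then show ?thesis using t by (simp add: inner_heat_rep power_mult_distrib mult.assoc)
  qed
  then have "(\<Sum>k\<in>K. lam k * (heat t (rep_L2 u) \<bullet> hartley k)\<^sup>2) \<le> (\<Sum>k\<in>K. (1 / t) * (u \<bullet> hartley k)\<^sup>2)"
    by (rule sum_mono)
  also have "\<dots> = (1 / t) * (\<Sum>k\<in>K. (u \<bullet> hartley k)\<^sup>2)" by (simp add: sum_distrib_left)
  also have "\<dots> \<le> (1 / t) * (norm u)\<^sup>2"
    using t by (intro mult_left_mono hartley.bessel[OF K]) auto
  also have "\<dots> = (norm u / sqrt t)\<^sup>2" using t by (simp add: power_divide)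
  finally show "(\<Sum>k\<in>K. lam k * (heat t (rep_L2 u) \<bullet> hartley k)\<^sup>2) \<le> (norm u / sqrt t)\<^sup>2" .
qed (use t in auto)

text \<open>With \<open>y = h * lam k\<close>, the factor \<open>1 - exp (- y)\<close> is at most 1
  and at most \<open>y\<close>, so its square is at most \<open>y\<close>. One derivative is thus
  traded for \<open>sqrt h\<close>, which gives continuity in time of the Duhamel integral.\<close>

lemma norm_heat_rep_diff_le:
  fixes u :: "('n::finite, real) L2"
  assumes h: "0 \<le> h" and u: "grad_le u B"
  shows "norm (heat h (rep_L2 u) - u) \<le> sqrt h * B"
proof (rule hartley.norm_le)
  fix K :: "(int^'n) set" assume K: "finite K"
  have "((heat h (rep_L2 u) - u) \<bullet> hartley k)\<^sup>2 \<le> h * (lam k * (u \<bullet> hartley k)\<^sup>2)" for k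
  proof -
    define y where "y = h * lam k"
    have y: "0 \<le> y" using h by (simp add: y_def)
    have "1 - y \<le> exp (- y)" using exp_ge_add_one_self[of "- y"] by simp
    then have "0 \<le> 1 - exp (- y)" "1 - exp (- y) \<le> 1" "1 - exp (- y) \<le> y" using y by auto
    then have "(1 - exp (- y)) * (1 - exp (- y)) \<le> 1 * y" by (intro mult_mono) auto
    then have "(1 - exp (- y))\<^sup>2 \<le> y" by (simp add: power2_eq_square)
    then have "(exp (- y) - 1)\<^sup>2 \<le> y" by (subst power2_commute)
    then have "(exp (- y) - 1)\<^sup>2 * (u \<bullet> hartley k)\<^sup>2 \<le> y * (u \<bullet> hartley k)\<^sup>2"
      by (rule mult_right_mono) simp
    moreover have "(heat h (rep_L2 u) - u) \<bullet> hartley k = (exp (- y) - 1) * (u \<bullet> hartley k)"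
      using h by (simp add: inner_diff_left inner_heat_rep y_def left_diff_distrib)
    ultimately show ?thesis by (simp add: power_mult_distrib y_def mult.assoc)
  qed
  then have "(\<Sum>k\<in>K. ((heat h (rep_L2 u) - u) \<bullet> hartley k)\<^sup>2) \<le> (\<Sum>k\<in>K. h * (lam k * (u \<bullet> hartley k)\<^sup>2))"
    by (rule sum_mono)
  also have "\<dots> = h * (\<Sum>k\<in>K. lam k * (u \<bullet> hartley k)\<^sup>2)" by (simp add: sum_distrib_left)
  also have "\<dots> \<le> h * B\<^sup>2" using u K h by (intro mult_left_mono) (auto simp: grad_le_def)
  also have "\<dots> = (sqrt h * B)\<^sup>2" using h by (simp add: power_mult_distrib)
  finally show "(\<Sum>k\<in>K. ((heat h (rep_L2 u) - u) \<bullet> hartley k)\<^sup>2) \<le> (sqrt h * B)\<^sup>2" .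
qed (use h grad_le_nonneg[OF u] in simp)

text \<open>A finite partial sum of the expansion has finite Dirichlet norm, so the preceding
  estimate applies to it; the contraction property takes care of the remainder.\<close>

lemma heat_rep_tendsto:
  fixes u :: "('n::finite, real) L2"
  assumes "0 < \<epsilon>"
  obtains \<delta> where "0 < \<delta>" "\<And>h. 0 \<le> h \<Longrightarrow> h < \<delta> \<Longrightarrow> norm (heat h (rep_L2 u) - u) < \<epsilon>"
proof -
  obtain K where K: "finite K" "dist (\<Sum>k\<in>K. (u \<bullet> hartley k) *\<^sub>R hartley k) u \<le> \<epsilon> / 4"
    using has_sum_finite_approximation[OF hartley.expansion[of u], of "\<epsilon> / 4"] assms by auto
  define w where "w = (\<Sum>k\<in>K. (u \<bullet> hartley k) *\<^sub>R hartley k)"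
  have wu: "norm (w - u) \<le> \<epsilon> / 4" using K(2) by (simp add: w_def dist_norm)
  define B where "B = sqrt (\<Sum>k\<in>K. lam k * (u \<bullet> hartley k)\<^sup>2)"
  have B: "0 \<le> B" "B\<^sup>2 = (\<Sum>k\<in>K. lam k * (u \<bullet> hartley k)\<^sup>2)" by (auto simp: B_def sum_nonneg)
  have "grad_le w B"
    unfolding grad_le_def
  proof (intro conjI allI impI B)
    fix L :: "(int^'n) set" assume L: "finite L"
    have "(\<Sum>k\<in>L. lam k * (w \<bullet> hartley k)\<^sup>2) = (\<Sum>k\<in>L. if k \<in> K then lam k * (u \<bullet> hartley k)\<^sup>2 else 0)"
      unfolding w_def hartley.inner_sum_basis[OF K(1)] by (intro sum.cong) auto
    also have "\<dots> = (\<Sum>k\<in>L \<inter> K. lam k * (u \<bullet> hartley k)\<^sup>2)" using L by (simp add: sum.inter_restrict)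
    also have "\<dots> \<le> B\<^sup>2" unfolding B by (intro sum_mono2 K) auto
    finally show "(\<Sum>k\<in>L. lam k * (w \<bullet> hartley k)\<^sup>2) \<le> B\<^sup>2" .
  qed
  \<comment> \<open>\<open>B\<close> may vanish, and \<open>b\<close> is used as a divisor.\<close>
  define b where "b = B + 1"
  have b: "0 < b" "B \<le> b" using B(1) by (auto simp: b_def)
  define \<delta> where "\<delta> = (\<epsilon> / (4 * b))\<^sup>2"
  have "0 < \<delta>" using assms b by (simp add: \<delta>_def)
  moreover have "norm (heat h (rep_L2 u) - u) < \<epsilon>" if h: "0 \<le> h" "h < \<delta>" for h
  proof -
    have "sqrt h \<le> \<epsilon> / (4 * b)"
      using h assms b by (intro real_le_lsqrt) (auto simp: \<delta>_def)
    then have "sqrt h * B \<le> \<epsilon> / (4 * b) * b" using B(1) b h assms by (intro mult_mono) auto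
    then have "sqrt h * B \<le> \<epsilon> / 4" using b by simp
    then have 1: "norm (heat h (rep_L2 w) - w) \<le> \<epsilon> / 4"
      using norm_heat_rep_diff_le[OF h(1) \<open>grad_le w B\<close>] by linarith
    have "heat h (rep_L2 u) - u = heat h (rep_L2 (u - w)) + (heat h (rep_L2 w) - w) + (w - u)"
      using linear_diff[OF bounded_linear.linear[OF bounded_linear_heat_rep[OF h(1)]], of u w] by simp
    then have "norm (heat h (rep_L2 u) - u) \<le> norm (heat h (rep_L2 (u - w))) + norm (heat h (rep_L2 w) - w) + norm (w - u)"
      by (metis add.commute norm_triangle_mono norm_triangle_ineq order_refl)
    moreover have "norm (heat h (rep_L2 (u - w))) \<le> \<epsilon> / 4"
      using norm_heat_rep_le[OF h(1), of "u - w"] wu by (simp add: norm_minus_commute)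
    ultimately show ?thesis using 1 wu assms by linarith
  qed
  ultimately show ?thesis by (rule that)
qed

section \<open>Domination and Cauchy-Schwarz for classes\<close>

lemma norm_abs_L2_sq:
  fixes f :: "real^'n \<Rightarrow> 'b::euclidean_space"
  assumes "square_integrable f"
  shows "(norm (abs_L2 f))\<^sup>2 = (LINT x|torus. (norm (f x))\<^sup>2)"
  by (simp add: norm_abs_L2[OF assms])

lemma norm_abs_L2_le:
  fixes f :: "real^'n \<Rightarrow> 'b::euclidean_space" and g :: "real^'n \<Rightarrow> 'c::euclidean_space"
  assumes f: "f \<in> borel_measurable torus" and g: "square_integrable g" and "0 \<le> c"
    and le: "AE x in torus. norm (f x) \<le> c * norm (g x)"
  shows "square_integrable f" "norm (abs_L2 f) \<le> c * norm (abs_L2 g)"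
proof -
  show si: "square_integrable f"
    by (rule square_integrable_bound[OF square_integrable_scaleR[OF g, of c] f]) (use le \<open>0 \<le> c\<close> in simp)
  have "(LINT x|torus. (norm (f x))\<^sup>2) \<le> (LINT x|torus. (c * norm (g x))\<^sup>2)"
  proof (rule integral_mono_AE)
    show "integrable torus (\<lambda>x. (norm (f x))\<^sup>2)" "integrable torus (\<lambda>x. (c * norm (g x))\<^sup>2)"
      using si g by (auto simp: square_integrable_def power_mult_distrib)
    show "AE x in torus. (norm (f x))\<^sup>2 \<le> (c * norm (g x))\<^sup>2"
      using le by eventually_elim (rule power_mono, auto)
  qed
  then have "(norm (abs_L2 f))\<^sup>2 \<le> (c * norm (abs_L2 g))\<^sup>2"
    by (simp add: norm_abs_L2_sq si g power_mult_distrib)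
  then show "norm (abs_L2 f) \<le> c * norm (abs_L2 g)"
    by (rule power2_le_imp_le) (simp add: \<open>0 \<le> c\<close>)
qed

lemma square_integrable_norm:
  fixes g :: "real^'n \<Rightarrow> 'b::euclidean_space"
  assumes "square_integrable g"
  shows "square_integrable (\<lambda>x. norm (g x))" "norm (abs_L2 (\<lambda>x. norm (g x))) = norm (abs_L2 g)"
proof -
  show si: "square_integrable (\<lambda>x. norm (g x))" using assms by (auto simp: square_integrable_def intro: borel_measurable_norm)
  show "norm (abs_L2 (\<lambda>x. norm (g x))) = norm (abs_L2 g)" by (simp add: norm_abs_L2 assms si)
qed

lemma integral_mult_le_norm_L2:
  fixes a :: "real^'n \<Rightarrow> real" and g :: "real^'n \<Rightarrow> 'b::euclidean_space"
  assumes "square_integrable a" "square_integrable g"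
  shows "integrable torus (\<lambda>x. a x * norm (g x))"
    "(LINT x|torus. a x * norm (g x)) \<le> norm (abs_L2 a) * norm (abs_L2 g)"
proof -
  note g = square_integrable_norm[OF assms(2)]
  show "integrable torus (\<lambda>x. a x * norm (g x))"
    using square_integrable_inner[OF assms(1) g(1)] by simp
  have "(LINT x|torus. a x * norm (g x)) = abs_L2 a \<bullet> abs_L2 (\<lambda>x. norm (g x))"
    by (simp add: inner_abs_L2' assms(1) g(1))
  also have "\<dots> \<le> norm (abs_L2 a) * norm (abs_L2 (\<lambda>x. norm (g x)))" by (rule norm_cauchy_schwarz)
  finally show "(LINT x|torus. a x * norm (g x)) \<le> norm (abs_L2 a) * norm (abs_L2 g)" by (simp add: g)
qed

lemma heat_eq_heat_rep_abs:
  assumes "square_integrable f" "0 < t"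
  shows "heat t f = heat t (rep_L2 (abs_L2 f))"
proof (rule heat_cong_AE[OF _ integrable_rep_L2 assms(2)])
  show "integrable torus f" using square_integrable_inner[OF assms(1) square_integrable_const[of 1]] by simp
  show "AE x in torus. f x = rep_L2 (abs_L2 f) x" using rep_abs_L2[OF assms(1)] by eventually_elim simp
qed

text \<open>
  Splitting the factor \<open>a\<close> at height \<open>V * t powr (- \<alpha>)\<close>, where the \<open>L\<^sup>1\<close>--\<open>L\<^sup>2\<close> smoothing of the large part
  balances the \<open>L\<^sup>2\<close> bound of the small part, replaces the interpolated \<open>L\<^sup>r\<close>--\<open>L\<^sup>2\<close> estimate.
\<close>

lemma norm_heat_product:
  fixes f :: "real^'n \<Rightarrow> real" and g :: "real^'n \<Rightarrow> 'b::euclidean_space"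
  assumes t: "0 < t" "t \<le> 1" and f [measurable]: "f \<in> borel_measurable torus"
    and a: "square_integrable a" and g: "square_integrable g"
    and le: "AE x in torus. \<bar>f x\<bar> \<le> a x * norm (g x)"
    and V: "0 \<le> V"
    and tail: "(LINT x|torus. (a x)\<^sup>2 * indicator {x. V * t powr (- \<alpha>) < a x} x) \<le> (V * t powr (real CARD('n) / 4 - \<alpha>))\<^sup>2"
  shows "norm (heat t f) \<le> 3 * 12 ^ CARD('n) * V * t powr (- \<alpha>) * norm (abs_L2 g)"
proof -
  let ?N = "real CARD('n)"
  define \<mu> where "\<mu> = V * t powr (- \<alpha>)"
  have [measurable]: "a \<in> borel_measurable torus" "g \<in> borel_measurable torus"
    using a g by (auto simp: square_integrable_def)
  \<comment> \<open>\<open>a1\<close> is the large part of the weight. It dominates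
    \<open>f - f2\<close>, which is estimated in \<open>L\<^sup>1\<close>, while \<open>f2\<close>
    is estimated in \<open>L\<^sup>2\<close>.\<close>
  define a1 where "a1 x = (if \<mu> < a x then a x else 0)" for x
  define f2 where "f2 x = (if \<mu> < a x then 0 else f x)" for x
  have [measurable]: "a1 \<in> borel_measurable torus" "f2 \<in> borel_measurable torus"
    unfolding a1_def f2_def by measurable
  have \<mu>: "0 \<le> \<mu>" using V by (simp add: \<mu>_def)
  have int: "integrable torus f"
    by (rule Bochner_Integration.integrable_bound[OF integral_mult_le_norm_L2(1)[OF a g]])
      (use le in \<open>auto elim!: eventually_mono\<close>)
  have a1: "square_integrable a1"
    by (rule square_integrable_bound[OF a]) (auto simp: a1_def)
  have "norm (abs_L2 a1) \<le> V * t powr (?N / 4 - \<alpha>)"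
  proof (rule power2_le_imp_le)
    have "(a1 x)\<^sup>2 = (a x)\<^sup>2 * indicator {x. \<mu> < a x} x" for x
      by (auto simp: a1_def indicator_def)
    then show "(norm (abs_L2 a1))\<^sup>2 \<le> (V * t powr (?N / 4 - \<alpha>))\<^sup>2"
      using tail by (simp add: norm_abs_L2_sq[OF a1] \<mu>_def)
  qed (use V in simp)
  have f2: "square_integrable f2" "norm (abs_L2 f2) \<le> \<mu> * norm (abs_L2 g)"
  proof -
    have "AE x in torus. norm (f2 x) \<le> \<mu> * norm (g x)"
      using le
    proof eventually_elim
      case (elim x)
      have "a x * norm (g x) \<le> \<mu> * norm (g x)" if "a x \<le> \<mu>" using that by (intro mult_right_mono) auto
      then show ?case using elim \<mu> by (auto simp: f2_def not_less)
    qed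
    then show "square_integrable f2" "norm (abs_L2 f2) \<le> \<mu> * norm (abs_L2 g)"
      using norm_abs_L2_le[OF _ g \<mu>, of f2] by auto
  qed
  have int2: "integrable torus f2"
    using square_integrable_inner[OF f2(1) square_integrable_const[of 1]] by simp
  have "(LINT x|torus. \<bar>f x - f2 x\<bar>) \<le> (LINT x|torus. a1 x * norm (g x))"
  proof (rule integral_mono_AE)
    show "integrable torus (\<lambda>x. \<bar>f x - f2 x\<bar>)" using int int2 by simp
    show "integrable torus (\<lambda>x. a1 x * norm (g x))" by (rule integral_mult_le_norm_L2[OF a1 g])
    show "AE x in torus. \<bar>f x - f2 x\<bar> \<le> a1 x * norm (g x)"
      using le by eventually_elim (simp add: a1_def f2_def)
  qed
  also have "\<dots> \<le> norm (abs_L2 a1) * norm (abs_L2 g)"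
    by (rule integral_mult_le_norm_L2[OF a1 g])
  also have "\<dots> \<le> V * t powr (?N / 4 - \<alpha>) * norm (abs_L2 g)"
    by (intro mult_right_mono) (fact, simp)
  finally have L1: "(LINT x|torus. \<bar>f x - f2 x\<bar>) \<le> V * t powr (?N / 4 - \<alpha>) * norm (abs_L2 g)" .
  have "norm (heat t (\<lambda>x. f x - f2 x)) \<le> 2 * 12 ^ CARD('n) * t powr (- ?N / 4) * (LINT x|torus. \<bar>f x - f2 x\<bar>)"
    by (rule norm_heat_L1[OF _ t]) (use int int2 in simp)
  also have "\<dots> \<le> 2 * 12 ^ CARD('n) * t powr (- ?N / 4) * (V * t powr (?N / 4 - \<alpha>) * norm (abs_L2 g))"
    by (intro mult_left_mono L1) simp
  also have "\<dots> = 2 * 12 ^ CARD('n) * (t powr (- ?N / 4) * t powr (?N / 4 - \<alpha>)) * V * norm (abs_L2 g)"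
    by (simp only: mult_ac)
  also have "t powr (- ?N / 4) * t powr (?N / 4 - \<alpha>) = t powr (- \<alpha>)"
    by (simp flip: powr_add)
  finally have 1: "norm (heat t (\<lambda>x. f x - f2 x)) \<le> 2 * 12 ^ CARD('n) * (\<mu> * norm (abs_L2 g))"
    by (simp add: \<mu>_def mult_ac)
  have "norm (heat t f2) \<le> norm (abs_L2 f2)"
    using norm_heat_rep_le[of t "abs_L2 f2"] t by (simp add: heat_eq_heat_rep_abs[OF f2(1)])
  \<comment> \<open>This part needs only the constant 1; the larger one lets both parts add up to
    \<open>3 * 12 ^ CARD('n)\<close>.\<close>
  also have "\<dots> \<le> 12 ^ CARD('n) * (\<mu> * norm (abs_L2 g))"
    using f2(2) \<mu> mult_right_mono[of 1 "12 ^ CARD('n)" "\<mu> * norm (abs_L2 g)"] by simp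
  finally have 2: "norm (heat t f2) \<le> 12 ^ CARD('n) * (\<mu> * norm (abs_L2 g))" .
  have "heat t f = heat t (\<lambda>x. f x - f2 x) + heat t f2"
    using heat_diff[OF int int2 t(1)] by (simp add: algebra_simps)
  then have "norm (heat t f) \<le> norm (heat t (\<lambda>x. f x - f2 x)) + norm (heat t f2)"
    by (simp add: norm_triangle_ineq)
  then show ?thesis using 1 2 by (simp add: \<mu>_def mult_ac)
qed

section \<open>Fixed points of the Duhamel map\<close>

text \<open>Translation and reflection reduce both integrals to that of
  \<open>x powr - \<beta>\<close> starting at 0; nonnegativity turns the gauge integral into a
  Lebesgue integral.\<close>

lemma powr_singular_integrable:
  fixes a t \<beta> :: real
  assumes \<beta>: "\<beta> < 1" and at: "a \<le> t"
  shows "set_integrable lebesgue {a<..<t} (\<lambda>\<tau>. (\<tau> - a) powr - \<beta>)"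
    "(LINT \<tau>:{a<..<t}|lebesgue. (\<tau> - a) powr - \<beta>) = (t - a) powr (1 - \<beta>) / (1 - \<beta>)"
    "set_integrable lebesgue {a<..<t} (\<lambda>\<tau>. (t - \<tau>) powr - \<beta>)"
    "(LINT \<tau>:{a<..<t}|lebesgue. (t - \<tau>) powr - \<beta>) = (t - a) powr (1 - \<beta>) / (1 - \<beta>)"
proof -
  have base: "((\<lambda>x. x powr - \<beta>) has_integral (t - a) powr (1 - \<beta>) / (1 - \<beta>)) {0..t - a}"
    using has_integral_powr_from_0[of "- \<beta>" "t - a"] \<beta> at by (simp add: add.commute)
  have 1: "((\<lambda>\<tau>. (\<tau> - a) powr - \<beta>) has_integral (t - a) powr (1 - \<beta>) / (1 - \<beta>)) {a..t}"
    using has_integral_shift_real_ivl[OF base, of "- a"] by simp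
  have "((\<lambda>x. (- x) powr - \<beta>) has_integral (t - a) powr (1 - \<beta>) / (1 - \<beta>)) {-(t - a)..-0}"
    using base by (subst has_integral_reflect_real) simp
  from has_integral_shift_real_ivl[OF this, of "- t"]
  have 2: "((\<lambda>\<tau>. (t - \<tau>) powr - \<beta>) has_integral (t - a) powr (1 - \<beta>) / (1 - \<beta>)) {a..t}"
    by simp
  have *: "set_integrable lebesgue {a<..<t} f \<and> (LINT \<tau>:{a<..<t}|lebesgue. f \<tau>) = I"
    if f: "(f has_integral I) {a..t}" and nonneg: "\<And>x. 0 \<le> f x" for f :: "real \<Rightarrow> real" and I
  proof -
    have f': "(f has_integral I) {a<..<t}" using f by (simp add: has_integral_Icc_iff_Ioo)
    then have "f absolutely_integrable_on {a<..<t}"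
      using nonneg by (intro nonnegative_absolutely_integrable_1) auto
    then show ?thesis using f' by (simp add: set_lebesgue_integral_eq_integral(2) integral_unique)
  qed
  from *[OF 1] *[OF 2]
  show "set_integrable lebesgue {a<..<t} (\<lambda>\<tau>. (\<tau> - a) powr - \<beta>)"
    "(LINT \<tau>:{a<..<t}|lebesgue. (\<tau> - a) powr - \<beta>) = (t - a) powr (1 - \<beta>) / (1 - \<beta>)"
    "set_integrable lebesgue {a<..<t} (\<lambda>\<tau>. (t - \<tau>) powr - \<beta>)"
    "(LINT \<tau>:{a<..<t}|lebesgue. (t - \<tau>) powr - \<beta>) = (t - a) powr (1 - \<beta>) / (1 - \<beta>)"
    by auto
qed

text \<open>This replaces a Beta integral: the smaller of \<open>\<tau> - a\<close> and
  \<open>t - \<tau>\<close> takes both exponents, so the product is bounded by a sum of two pure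
  powers. In the second estimate \<open>sqrt t \<le> sqrt \<tau> + sqrt (t - \<tau>)\<close> lets
  the weight cancel one of the two singularities.\<close>

lemma kernel_le:
  fixes a t \<tau> \<alpha> :: real
  assumes \<alpha>: "0 \<le> \<alpha>" and \<tau>: "0 \<le> a" "a < \<tau>" "\<tau> < t"
  shows "(t - \<tau>) powr - \<alpha> * \<tau> powr (-1/2) \<le> (\<tau> - a) powr - (\<alpha> + 1/2) + (t - \<tau>) powr - (\<alpha> + 1/2)" (is "?k \<le> ?K")
    and "sqrt t * ((t - \<tau>) powr - (\<alpha> + 1/2) * \<tau> powr (-1/2)) \<le>
      2 * ((\<tau> - a) powr - (\<alpha> + 1/2) + (t - \<tau>) powr - (\<alpha> + 1/2))"
proof -
  define x y where "x = \<tau> - a" and "y = t - \<tau>"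
  have xy: "0 < x" "0 < y" "x \<le> \<tau>" using \<tau> by (auto simp: x_def y_def)
  have anti: "u powr - c \<le> w powr - c" if "0 < w" "w \<le> u" "0 \<le> c" for u w c :: real
    using that by (intro powr_mono2') auto
  have "\<tau> powr (-1/2) \<le> x powr - (1/2)" using anti[OF xy(1,3), of "1/2"] by simp
  then have "?k \<le> y powr - \<alpha> * x powr - (1/2)"
    unfolding y_def[symmetric] by (intro mult_left_mono) auto
  also have "\<dots> \<le> x powr - (\<alpha> + 1/2) + y powr - (\<alpha> + 1/2)"
  proof (cases "x \<le> y")
    case True
    then have "y powr - \<alpha> * x powr - (1/2) \<le> x powr - \<alpha> * x powr - (1/2)"
      using anti[of x y \<alpha>] xy \<alpha> by (intro mult_right_mono) auto
    also have "\<dots> = x powr - (\<alpha> + 1/2)" by (simp flip: powr_add)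
    finally show ?thesis by (smt (verit) powr_ge_zero)
  next
    case False
    then have "y powr - \<alpha> * x powr - (1/2) \<le> y powr - \<alpha> * y powr - (1/2)"
      using anti[of y x "1/2"] xy by (intro mult_left_mono) auto
    also have "\<dots> = y powr - (\<alpha> + 1/2)" by (simp flip: powr_add)
    finally show ?thesis by (smt (verit) powr_ge_zero)
  qed
  finally show k: "?k \<le> ?K" by (simp add: x_def y_def)
  have "sqrt t \<le> sqrt \<tau> + sqrt y"
    using sqrt_add_le_add_sqrt[of \<tau> y] \<tau> by (simp add: y_def)
  then have "sqrt t * ((t - \<tau>) powr - (\<alpha> + 1/2) * \<tau> powr (-1/2)) \<le>
      (sqrt \<tau> + sqrt y) * (y powr - (\<alpha> + 1/2) * \<tau> powr (-1/2))"
    unfolding y_def by (rule mult_right_mono) auto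
  also have "\<dots> = (sqrt \<tau> * \<tau> powr (-1/2)) * y powr - (\<alpha> + 1/2) + (sqrt y * y powr - (\<alpha> + 1/2)) * \<tau> powr (-1/2)"
    by (simp add: algebra_simps)
  also have "sqrt \<tau> * \<tau> powr (-1/2) = 1"
    using \<tau> by (simp add: powr_half_sqrt[symmetric] flip: powr_add)
  also have "sqrt y * y powr - (\<alpha> + 1/2) = y powr - \<alpha>"
    using xy by (simp add: powr_half_sqrt[symmetric] flip: powr_add)
  also have "1 * y powr - (\<alpha> + 1/2) + y powr - \<alpha> * \<tau> powr (-1/2) \<le> ?K + ?K"
    using k by (intro add_mono) (auto simp: y_def)
  finally show "sqrt t * ((t - \<tau>) powr - (\<alpha> + 1/2) * \<tau> powr (-1/2)) \<le> 2 * ?K" by simp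
qed

section \<open>Abstract Duhamel integrals on balls of \<open>X_T\<close>\<close>

text \<open>The closed ball of radius \<open>R\<close> in \<open>X_T\<close>, with the weighted
  gradient expressed by \<open>grad_le\<close> so that weak differentiability is part of the
  bound.\<close>

definition x_ball :: "real \<Rightarrow> real \<Rightarrow> (real \<Rightarrow> ('n::finite, real) L2) \<Rightarrow> bool" where
  "x_ball T R u \<longleftrightarrow> continuous_on {0..T} u \<and> (\<forall>t\<in>{0..T}. norm (u t) \<le> R) \<and>
     (\<forall>t\<in>{0<..T}. grad_le (u t) (R / sqrt t))"

lemma x_ball_zero: "0 \<le> R \<Longrightarrow> x_ball T R (\<lambda>_. 0)"
  by (simp add: x_ball_def)

lemma x_ball_mono:
  assumes "x_ball T R u" "R \<le> R'"
  shows "x_ball T R' u"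
proof -
  have "R / sqrt t \<le> R' / sqrt t" if "0 < t" for t using assms(2) that by (intro divide_right_mono) auto
  then show ?thesis using assms unfolding x_ball_def by (auto intro: grad_le_mono order_trans)
qed

lemma set_integral_bounded_linear_apply:
  fixes f :: "'a \<Rightarrow> 'b::{banach,second_countable_topology}" and T :: "'b \<Rightarrow> 'c::{banach,second_countable_topology}"
  assumes "bounded_linear T" "set_integrable M A f"
  shows "(LINT x:A|M. T (f x)) = T (LINT x:A|M. f x)"
  using integral_bounded_linear[OF assms(1) assms(2)[unfolded set_integrable_def]]
    linear_cmul[OF bounded_linear.linear[OF assms(1)]]
  by (simp add: set_lebesgue_integral_def)

text \<open>\<open>N s \<tau> x\<close> stands for the heat flow over time \<open>s\<close> of the
  nonlinearity at time \<open>\<tau>\<close> in the state \<open>x\<close>; before the flow it may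
  fail to be square integrable. The quantifiers over \<open>s\<close> and over states stand inside
  the almost-everywhere clauses, so one null set of times serves every trajectory. \<open>D\<close>
  bounds the distance of two states as measured by \<open>X_T\<close> at time
  \<open>\<tau>\<close>.\<close>

locale duhamel =
  fixes N :: "real \<Rightarrow> real \<Rightarrow> ('n::finite, real) L2 \<Rightarrow> ('n, real) L2"
    and \<alpha> :: real and L :: "real \<Rightarrow> real"
  assumes \<alpha>: "0 \<le> \<alpha>" "\<alpha> < 1/2"
    and L: "0 \<le> L R"
    and N_zero: "AE \<tau> in lebesgue. 0 < \<tau> \<longrightarrow> (\<forall>s>0. N s \<tau> 0 = 0)"
    and N_lipschitz: "AE \<tau> in lebesgue. 0 < \<tau> \<and> \<tau> \<le> 1 \<longrightarrow> (\<forall>s R G x y D. 0 < s \<and> s \<le> 1 \<and> 1 \<le> R \<and>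
      norm x \<le> R \<and> norm y \<le> R \<and> grad_le x G \<and> grad_le y G \<and> norm (x - y) \<le> D \<and> grad_le (x - y) (D / sqrt \<tau>) \<longrightarrow>
      norm (N s \<tau> x - N s \<tau> y) \<le> L R * D * (s powr - \<alpha> * \<tau> powr (-1/2)))"
    and N_semigroup: "AE \<tau> in lebesgue. 0 < \<tau> \<longrightarrow> (\<forall>r s x G. 0 \<le> r \<and> 0 < s \<and> grad_le x G \<longrightarrow>
      heat r (rep_L2 (N s \<tau> x)) = N (r + s) \<tau> x)"
    and N_measurable: "x_ball T R u \<Longrightarrow> t \<le> T \<Longrightarrow>
      (\<lambda>\<tau>. indicator {0<..<t} \<tau> *\<^sub>R N (t - \<tau>) \<tau> (u \<tau>)) \<in> borel_measurable lebesgue"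
begin

text \<open>The power of the interval length that remains after integrating
  \<open>(t - \<tau>) powr - (\<alpha> + 1/2)\<close>.\<close>

definition \<gamma> :: real where "\<gamma> = 1/2 - \<alpha>"
text \<open>One factor 2 stems from the gradient hypothesis of \<open>integral_bounds\<close>,
  another from \<open>kernel_le\<close>, and \<open>2 / \<gamma>\<close> is the total of the two
  singular integrals.\<close>

definition C :: real where "C = 8 / \<gamma>"

lemma \<gamma>: "0 < \<gamma>" and C: "0 < C"
  using \<alpha> by (auto simp: \<gamma>_def C_def)

text \<open>\<open>a\<close> is a time before which the integrand vanishes: the small factor is then
  a power of \<open>t - a\<close>, while the gradient keeps the weight \<open>sqrt t\<close>. One
  integrable majorant \<open>b\<close> controls the norm and, divided by \<open>sqrt t\<close>, the
  gradient.\<close>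

lemma integral_bounds:
  assumes h: "(\<lambda>\<tau>. indicator {0<..<t} \<tau> *\<^sub>R h \<tau>) \<in> borel_measurable lebesgue"
    and a: "0 \<le> a" "a \<le> t" "0 < t" and M: "0 \<le> M"
    and bd: "AE \<tau> in lebesgue. 0 < \<tau> \<and> \<tau> < t \<longrightarrow> (\<tau> < a \<longrightarrow> h \<tau> = 0) \<and>
      (a < \<tau> \<longrightarrow> norm (h \<tau>) \<le> M * ((t - \<tau>) powr - \<alpha> * \<tau> powr (-1/2)) \<and>
        grad_le (h \<tau>) (2 * M * ((t - \<tau>) powr - (\<alpha> + 1/2) * \<tau> powr (-1/2))))"
  shows "set_integrable lebesgue {0<..<t} h"
    and "norm (LINT \<tau>:{0<..<t}|lebesgue. h \<tau>) \<le> C * M * (t - a) powr \<gamma>"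
    and "grad_le (LINT \<tau>:{0<..<t}|lebesgue. h \<tau>) (C * M * (t - a) powr \<gamma> / sqrt t)"
proof -
  define k where "k \<tau> = (\<tau> - a) powr - (\<alpha> + 1/2) + (t - \<tau>) powr - (\<alpha> + 1/2)" for \<tau>
  define b where "b \<tau> = 4 * M * (indicator {a<..<t} \<tau> *\<^sub>R k \<tau>)" for \<tau>
  have \<beta>: "\<alpha> + 1/2 < 1" "1 - (\<alpha> + 1/2) = \<gamma>" using \<alpha> by (auto simp: \<gamma>_def)
  note ps = powr_singular_integrable[OF \<beta>(1) a(2)]
  have k_int: "set_integrable lebesgue {a<..<t} k"
    unfolding k_def by (intro set_integral_add ps)
  have "(LINT \<tau>:{a<..<t}|lebesgue. k \<tau>) = 2 * ((t - a) powr \<gamma> / \<gamma>)"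
    unfolding k_def by (subst set_integral_add(2)) (use ps \<beta>(2) in auto)
  then have b: "integrable lebesgue b" "(LINT \<tau>|lebesgue. b \<tau>) = C * M * (t - a) powr \<gamma>"
    using k_int by (simp_all add: b_def[abs_def] set_integrable_def set_lebesgue_integral_def C_def)
  \<comment> \<open>The hypothesis is silent at \<open>\<tau> = a\<close>, so this single time is
    discarded.\<close>
  have "AE \<tau> in lebesgue. \<tau> \<noteq> a"
    using AE_not_in[of "{a}" lebesgue] by (auto simp: negligible_iff_null_sets[symmetric])
  then have le: "AE \<tau> in lebesgue. norm (indicator {0<..<t} \<tau> *\<^sub>R h \<tau>) \<le> b \<tau> \<and>
      grad_le (indicator {0<..<t} \<tau> *\<^sub>R h \<tau>) (b \<tau> / sqrt t)"
    using bd
  proof eventually_elim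
    case (elim \<tau>)
    show ?case
    proof (cases "a < \<tau> \<and> \<tau> < t")
      case True
      then have \<tau>: "0 < \<tau>" "a < \<tau>" "\<tau> < t" using a by auto
      note ker = kernel_le[OF \<alpha>(1) a(1) \<tau>(2,3), folded k_def]
      have k0: "0 \<le> k \<tau>" by (simp add: k_def)
      have "norm (h \<tau>) \<le> M * k \<tau>"
        using elim(2) \<tau> ker(1) M by (auto intro: order_trans mult_left_mono)
      also have "\<dots> \<le> b \<tau>" using M k0 True by (simp add: b_def mult_right_mono)
      finally have 1: "norm (h \<tau>) \<le> b \<tau>" .
      have "2 * M * (sqrt t * ((t - \<tau>) powr - (\<alpha> + 1/2) * \<tau> powr (-1/2))) \<le> 2 * M * (2 * k \<tau>)"
        using ker(2) M by (intro mult_left_mono) auto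
      also have "\<dots> = b \<tau>" using True by (simp add: b_def)
      finally have "2 * M * ((t - \<tau>) powr - (\<alpha> + 1/2) * \<tau> powr (-1/2)) \<le> b \<tau> / sqrt t"
        using a(3) by (simp add: pos_le_divide_eq mult_ac)
      then have "grad_le (h \<tau>) (b \<tau> / sqrt t)" using elim(2) \<tau> by (auto intro: grad_le_mono)
      then show ?thesis using 1 True a by simp
    next
      case False
      then have "indicator {0<..<t} \<tau> *\<^sub>R h \<tau> = 0" "b \<tau> = 0"
        using elim by (auto simp: b_def indicator_def)
      then show ?thesis by (simp only:) simp
    qed
  qed
  show int: "set_integrable lebesgue {0<..<t} h"
    unfolding set_integrable_def
    by (rule Bochner_Integration.integrable_bound[OF b(1) h]) (rule eventually_mono[OF le], auto intro: order_trans[OF _ abs_ge_self])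
  have "norm (LINT \<tau>:{0<..<t}|lebesgue. h \<tau>) \<le> (LINT \<tau>|lebesgue. norm (indicator {0<..<t} \<tau> *\<^sub>R h \<tau>))"
    unfolding set_lebesgue_integral_def by (rule integral_norm_bound)
  also have "\<dots> \<le> (LINT \<tau>|lebesgue. b \<tau>)"
    by (rule integral_mono_AE[OF integrable_norm[OF int[unfolded set_integrable_def]] b(1)])
      (rule eventually_mono[OF le], simp)
  finally show "norm (LINT \<tau>:{0<..<t}|lebesgue. h \<tau>) \<le> C * M * (t - a) powr \<gamma>" by (simp add: b)
  have "grad_le (LINT \<tau>|lebesgue. indicator {0<..<t} \<tau> *\<^sub>R h \<tau>) (LINT \<tau>|lebesgue. b \<tau> / sqrt t)"
  proof (rule grad_le_integral[OF int[unfolded set_integrable_def]])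
    show "integrable lebesgue (\<lambda>\<tau>. b \<tau> / sqrt t)" using b(1) by simp
    show "AE \<tau> in lebesgue. grad_le (indicator {0<..<t} \<tau> *\<^sub>R h \<tau>) (b \<tau> / sqrt t)"
      using le by eventually_elim simp
  qed
  then show "grad_le (LINT \<tau>:{0<..<t}|lebesgue. h \<tau>) (C * M * (t - a) powr \<gamma> / sqrt t)"
    by (simp add: set_lebesgue_integral_def b)
qed

text \<open>The gradient bound follows from the semigroup law: \<open>N s\<close> is the heat flow
  over time \<open>s / 2\<close> of \<open>N (s / 2)\<close>, so the norm bound serves one half and
  \<open>grad_le_heat_rep\<close> the other. The loss \<open>2 powr (\<alpha> + 1/2)\<close> is at
  most 2.\<close>

lemma N_bounds:
  "AE \<tau> in lebesgue. 0 < \<tau> \<and> \<tau> \<le> 1 \<longrightarrow> (\<forall>s R G x y D. 0 < s \<and> s \<le> 1 \<and> 1 \<le> R \<and>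
      norm x \<le> R \<and> norm y \<le> R \<and> grad_le x G \<and> grad_le y G \<and> norm (x - y) \<le> D \<and> grad_le (x - y) (D / sqrt \<tau>) \<longrightarrow>
      norm (N s \<tau> x - N s \<tau> y) \<le> L R * D * (s powr - \<alpha> * \<tau> powr (-1/2)) \<and>
      grad_le (N s \<tau> x - N s \<tau> y) (2 * (L R * D) * (s powr - (\<alpha> + 1/2) * \<tau> powr (-1/2))))"
  using N_lipschitz N_semigroup
proof eventually_elim
  case (elim \<tau>)
  show ?case
  proof (intro impI allI, elim conjE)
    fix s R G D :: real and x y :: "('n, real) L2"
    assume \<tau>: "0 < \<tau>" "\<tau> \<le> 1" and s: "0 < s" "s \<le> 1" and R: "1 \<le> R" "norm x \<le> R" "norm y \<le> R"
      and G: "grad_le x G" "grad_le y G" and D: "norm (x - y) \<le> D" "grad_le (x - y) (D / sqrt \<tau>)"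
    have lip: "norm (N r \<tau> x - N r \<tau> y) \<le> L R * D * (r powr - \<alpha> * \<tau> powr (-1/2))" if "0 < r" "r \<le> 1" for r
      using elim(1) \<tau> R G D that by blast
    define r where "r = s / 2"
    have r: "0 < r" "r \<le> 1" "r + r = s" using s by (auto simp: r_def)
    have M: "0 \<le> L R * D" 
      by (intro mult_nonneg_nonneg L order_trans[OF norm_ge_zero D(1)])
    have sg: "heat r (rep_L2 (N r \<tau> z)) = N s \<tau> z" if "grad_le z G" for z
      using elim(2)[rule_format, OF \<tau>(1), of r r z G] r that by simp
    have "N s \<tau> x - N s \<tau> y = heat r (rep_L2 (N r \<tau> x)) - heat r (rep_L2 (N r \<tau> y))"
      by (simp only: sg G)
    also have "\<dots> = heat r (rep_L2 (N r \<tau> x - N r \<tau> y))"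
      by (rule linear_diff[OF bounded_linear.linear[OF bounded_linear_heat_rep[OF less_imp_le[OF r(1)]]], symmetric])
    finally have "grad_le (N s \<tau> x - N s \<tau> y) (norm (N r \<tau> x - N r \<tau> y) / sqrt r)"
      using grad_le_heat_rep[OF r(1)] by simp
    moreover have "norm (N r \<tau> x - N r \<tau> y) / sqrt r \<le> 2 * (L R * D) * (s powr - (\<alpha> + 1/2) * \<tau> powr (-1/2))"
    proof -
      have "r powr - \<alpha> / sqrt r = r powr (- \<alpha> - 1/2)"
        unfolding powr_diff using r by (simp add: powr_half_sqrt)
      then have "r powr - \<alpha> / sqrt r = r powr - (\<alpha> + 1/2)" by simp
      also have "\<dots> = 2 powr (\<alpha> + 1/2) * s powr - (\<alpha> + 1/2)"
      proof -
        have "(s / 2) powr - c = 2 powr c * s powr - c" for c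
          using s by (simp add: powr_divide powr_minus divide_simps)
        then show ?thesis unfolding r_def .
      qed
      also have "\<dots> \<le> 2 powr 1 * s powr - (\<alpha> + 1/2)"
        using \<alpha> by (intro mult_right_mono powr_mono) auto
      finally have *: "r powr - \<alpha> / sqrt r \<le> 2 * s powr - (\<alpha> + 1/2)" by simp
      have "norm (N r \<tau> x - N r \<tau> y) / sqrt r \<le> L R * D * (r powr - \<alpha> * \<tau> powr (-1/2)) / sqrt r"
        using lip[OF r(1,2)] r by (intro divide_right_mono) auto
      also have "\<dots> = (L R * D * \<tau> powr (-1/2)) * (r powr - \<alpha> / sqrt r)" by simp
      also have "\<dots> \<le> (L R * D * \<tau> powr (-1/2)) * (2 * s powr - (\<alpha> + 1/2))"
        using * M by (intro mult_left_mono) auto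
      finally show ?thesis by (simp add: mult_ac)
    qed
    ultimately show "norm (N s \<tau> x - N s \<tau> y) \<le> L R * D * (s powr - \<alpha> * \<tau> powr (-1/2)) \<and>
      grad_le (N s \<tau> x - N s \<tau> y) (2 * (L R * D) * (s powr - (\<alpha> + 1/2) * \<tau> powr (-1/2)))"
      using lip[OF s] grad_le_mono by blast
  qed
qed

lemma x_ballD:
  assumes "x_ball T R u" "\<tau> \<in> {0<..T}"
  shows "norm (u \<tau>) \<le> R" "grad_le (u \<tau>) (R / sqrt \<tau>)"
  using assms by (auto simp: x_ball_def)

definition history :: "(real \<Rightarrow> ('n, real) L2) \<Rightarrow> real \<Rightarrow> ('n, real) L2" where
  "history u t = (LINT \<tau>:{0<..<t}|lebesgue. N (t - \<tau>) \<tau> (u \<tau>))"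

text \<open>Comparison with the state 0, at which \<open>N\<close> vanishes; the distance
  \<open>D\<close> is then the radius.\<close>

lemma N_x_ball_bounds:
  assumes u: "x_ball T R u" and T: "T \<le> 1" and R: "1 \<le> R"
  shows "AE \<tau> in lebesgue. 0 < \<tau> \<and> \<tau> \<le> T \<longrightarrow> (\<forall>s. 0 < s \<and> s \<le> 1 \<longrightarrow>
    norm (N s \<tau> (u \<tau>)) \<le> L R * R * (s powr - \<alpha> * \<tau> powr (-1/2)) \<and>
    grad_le (N s \<tau> (u \<tau>)) (2 * (L R * R) * (s powr - (\<alpha> + 1/2) * \<tau> powr (-1/2))))"
  using N_bounds N_zero
proof eventually_elim
  case (elim \<tau>)
  show ?case
  proof (intro impI allI)
    fix s :: real assume \<tau>: "0 < \<tau> \<and> \<tau> \<le> T" and s: "0 < s \<and> s \<le> 1"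
    have "norm (u \<tau>) \<le> R" "grad_le (u \<tau>) (R / sqrt \<tau>)" using x_ballD[OF u, of \<tau>] \<tau> by auto
    moreover have "grad_le (0 :: ('n, real) L2) (R / sqrt \<tau>)" using R \<tau> by simp
    ultimately show "norm (N s \<tau> (u \<tau>)) \<le> L R * R * (s powr - \<alpha> * \<tau> powr (-1/2)) \<and>
      grad_le (N s \<tau> (u \<tau>)) (2 * (L R * R) * (s powr - (\<alpha> + 1/2) * \<tau> powr (-1/2)))"
      using elim(1)[rule_format, of s R "u \<tau>" 0 "R / sqrt \<tau>" R] elim(2)[rule_format, of s] \<tau> s R T by simp
  qed
qed

lemma history_bounds:
  assumes u: "x_ball T R u" and T: "T \<le> 1" and R: "1 \<le> R" and t: "0 < t" "t \<le> T"
  shows "set_integrable lebesgue {0<..<t} (\<lambda>\<tau>. N (t - \<tau>) \<tau> (u \<tau>))"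
    and "norm (history u t) \<le> C * (L R * R) * t powr \<gamma>"
    and "grad_le (history u t) (C * (L R * R) * t powr \<gamma> / sqrt t)"
proof -
  have M: "0 \<le> L R * R" using L[of R] R by simp
  have bd: "AE \<tau> in lebesgue. 0 < \<tau> \<and> \<tau> < t \<longrightarrow> (\<tau> < 0 \<longrightarrow> N (t - \<tau>) \<tau> (u \<tau>) = 0) \<and>
      (0 < \<tau> \<longrightarrow> norm (N (t - \<tau>) \<tau> (u \<tau>)) \<le> L R * R * ((t - \<tau>) powr - \<alpha> * \<tau> powr (-1/2)) \<and>
        grad_le (N (t - \<tau>) \<tau> (u \<tau>)) (2 * (L R * R) * ((t - \<tau>) powr - (\<alpha> + 1/2) * \<tau> powr (-1/2))))"
    using N_x_ball_bounds[OF u T R] by eventually_elim (use t T in auto)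
  note ib = integral_bounds[OF N_measurable[OF u t(2)] order_refl less_imp_le[OF t(1)] t(1) M bd]
  show "set_integrable lebesgue {0<..<t} (\<lambda>\<tau>. N (t - \<tau>) \<tau> (u \<tau>))" by (rule ib)
  show "norm (history u t) \<le> C * (L R * R) * t powr \<gamma>"
    "grad_le (history u t) (C * (L R * R) * t powr \<gamma> / sqrt t)"
    using ib(2,3) by (simp_all add: history_def)
qed

lemma history_0 [simp]: "history u 0 = 0"
  by (simp add: history_def set_lebesgue_integral_def)

text \<open>\<open>D\<close> is measured only on \<open>{a<..t}\<close>, where the trajectories may
  differ. This is what allows uniqueness to be continued beyond a time \<open>a\<close>.\<close>

lemma history_diff_bounds:
  assumes u: "x_ball T R u" and w: "x_ball T R w" and T: "T \<le> 1" and R: "1 \<le> R"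
    and a: "0 \<le> a" "a < t" "t \<le> T" and eq: "\<And>\<tau>. \<tau> \<in> {0<..a} \<Longrightarrow> u \<tau> = w \<tau>"
    and D: "\<And>\<tau>. \<tau> \<in> {a<..t} \<Longrightarrow> norm (u \<tau> - w \<tau>) \<le> D"
      "\<And>\<tau>. \<tau> \<in> {a<..t} \<Longrightarrow> grad_le (u \<tau> - w \<tau>) (D / sqrt \<tau>)"
  shows "norm (history u t - history w t) \<le> C * (L R * D) * (t - a) powr \<gamma>"
    and "grad_le (history u t - history w t) (C * (L R * D) * (t - a) powr \<gamma> / sqrt t)"
proof -
  define h where "h \<tau> = N (t - \<tau>) \<tau> (u \<tau>) - N (t - \<tau>) \<tau> (w \<tau>)" for \<tau>
  have "0 \<le> D" using order_trans[OF norm_ge_zero D(1)[of t]] a by simp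
  then have M: "0 \<le> L R * D" using L[of R] by simp
  have t: "0 < t" using a by simp
  have meas: "(\<lambda>\<tau>. indicator {0<..<t} \<tau> *\<^sub>R h \<tau>) \<in> borel_measurable lebesgue"
    unfolding h_def scaleR_diff_right
    by (intro borel_measurable_diff N_measurable[OF u a(3)] N_measurable[OF w a(3)])
  have bd: "AE \<tau> in lebesgue. 0 < \<tau> \<and> \<tau> < t \<longrightarrow> (\<tau> < a \<longrightarrow> h \<tau> = 0) \<and>
      (a < \<tau> \<longrightarrow> norm (h \<tau>) \<le> L R * D * ((t - \<tau>) powr - \<alpha> * \<tau> powr (-1/2)) \<and>
        grad_le (h \<tau>) (2 * (L R * D) * ((t - \<tau>) powr - (\<alpha> + 1/2) * \<tau> powr (-1/2))))"
    using N_bounds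
  proof eventually_elim
    case (elim \<tau>)
    show ?case
    proof (intro impI conjI)
      assume "0 < \<tau> \<and> \<tau> < t" "\<tau> < a"
      then show "h \<tau> = 0" using eq[of \<tau>] by (simp add: h_def)
    next
      assume \<tau>: "0 < \<tau> \<and> \<tau> < t" "a < \<tau>"
      note ux = x_ballD[OF u, of \<tau>] x_ballD[OF w, of \<tau>] D[of \<tau>]
      show "norm (h \<tau>) \<le> L R * D * ((t - \<tau>) powr - \<alpha> * \<tau> powr (-1/2))"
        "grad_le (h \<tau>) (2 * (L R * D) * ((t - \<tau>) powr - (\<alpha> + 1/2) * \<tau> powr (-1/2)))"
        using elim[rule_format, of "t - \<tau>" R "u \<tau>" "w \<tau>" "R / sqrt \<tau>" D] ux \<tau> a T R
        by (simp_all add: h_def)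
    qed
  qed
  note ib = integral_bounds[OF meas a(1) less_imp_le[OF a(2)] t M bd]
  have "history u t - history w t = (LINT \<tau>:{0<..<t}|lebesgue. h \<tau>)"
    unfolding history_def h_def
    by (rule set_integral_diff(2)[symmetric]) (rule history_bounds[OF _ T R t a(3)], fact)+
  then show "norm (history u t - history w t) \<le> C * (L R * D) * (t - a) powr \<gamma>"
    "grad_le (history u t - history w t) (C * (L R * D) * (t - a) powr \<gamma> / sqrt t)"
    using ib(2,3) by simp_all
qed

text \<open>The integral up to \<open>t'\<close> is split at \<open>t\<close>. The later part is a
  Duhamel integral over a short interval; the earlier part is the heat flow over time
  \<open>t' - t\<close> of \<open>history u t\<close>, whose displacement is controlled by the
  gradient of \<open>history u t\<close>.\<close>

lemma history_increment:
  assumes u: "x_ball T R u" and T: "T \<le> 1" and R: "1 \<le> R" and t: "0 < t" "t < t'" "t' \<le> T"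
  shows "norm (history u t' - history u t) \<le>
    C * (L R * R) * (t' - t) powr \<gamma> + sqrt (t' - t) * (C * (L R * R) * t powr \<gamma> / sqrt t)"
proof -
  have M: "0 \<le> L R * R" using L[of R] R by simp
  have t': "0 < t'" "t \<le> T" using t by auto
  define h1 where "h1 \<tau> = (if \<tau> < t then N (t' - \<tau>) \<tau> (u \<tau>) else 0)" for \<tau>
  define h2 where "h2 \<tau> = (if \<tau> < t then 0 else N (t' - \<tau>) \<tau> (u \<tau>))" for \<tau>
  note hb = history_bounds[OF u T R t(1) t'(2)] history_bounds[OF u T R t'(1) t(3)]
  have meas: "(\<lambda>\<tau>. indicator {0<..<t'} \<tau> *\<^sub>R h2 \<tau>) \<in> borel_measurable lebesgue"
  proof -
    have "(\<lambda>\<tau>. indicator {t..} \<tau> *\<^sub>R (indicator {0<..<t'} \<tau> *\<^sub>R N (t' - \<tau>) \<tau> (u \<tau>))) \<in> borel_measurable lebesgue"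
      by (rule borel_measurable_scaleR[OF borel_measurable_indicator N_measurable[OF u t(3)]])
        (auto intro: sets_completionI_sets)
    moreover have "(\<lambda>\<tau>. indicator {0<..<t'} \<tau> *\<^sub>R h2 \<tau>) =
        (\<lambda>\<tau>. indicator {t..} \<tau> *\<^sub>R (indicator {0<..<t'} \<tau> *\<^sub>R N (t' - \<tau>) \<tau> (u \<tau>)))"
      by (auto simp: h2_def indicator_def)
    ultimately show ?thesis by simp
  qed
  have bd: "AE \<tau> in lebesgue. 0 < \<tau> \<and> \<tau> < t' \<longrightarrow> (\<tau> < t \<longrightarrow> h2 \<tau> = 0) \<and>
      (t < \<tau> \<longrightarrow> norm (h2 \<tau>) \<le> L R * R * ((t' - \<tau>) powr - \<alpha> * \<tau> powr (-1/2)) \<and>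
        grad_le (h2 \<tau>) (2 * (L R * R) * ((t' - \<tau>) powr - (\<alpha> + 1/2) * \<tau> powr (-1/2))))"
    using N_x_ball_bounds[OF u T R] by eventually_elim (use t T in \<open>auto simp: h2_def\<close>)
  note ib = integral_bounds[OF meas less_imp_le[OF t(1)] less_imp_le[OF t(2)] t'(1) M bd]
  have h2_eq: "(\<lambda>\<tau>. N (t' - \<tau>) \<tau> (u \<tau>) - h2 \<tau>) = h1"
    by (auto simp: h1_def h2_def)
  have "history u t' - (LINT \<tau>:{0<..<t'}|lebesgue. h2 \<tau>) = (LINT \<tau>:{0<..<t'}|lebesgue. h1 \<tau>)"
    unfolding history_def h2_eq[symmetric] by (rule set_integral_diff(2)[OF hb(4) ib(1), symmetric])
  also have "\<dots> = (LINT \<tau>:{0<..<t}|lebesgue. N (t' - \<tau>) \<tau> (u \<tau>))"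
    unfolding set_lebesgue_integral_def
    by (rule Bochner_Integration.integral_cong) (use t in \<open>auto simp: h1_def indicator_def\<close>)
  also have "\<dots> = (LINT \<tau>:{0<..<t}|lebesgue. heat (t' - t) (rep_L2 (N (t - \<tau>) \<tau> (u \<tau>))))"
    unfolding set_lebesgue_integral_def
  proof (rule integral_cong_AE)
    have bl: "bounded_linear (\<lambda>x. heat (t' - t) (rep_L2 x) :: ('n, real) L2)"
      using t by (intro bounded_linear_heat_rep) simp
    have eq: "indicator {0<..<t} \<tau> *\<^sub>R heat (t' - t) (rep_L2 (N (t - \<tau>) \<tau> (u \<tau>))) =
        heat (t' - t) (rep_L2 (indicator {0<..<t} \<tau> *\<^sub>R N (t - \<tau>) \<tau> (u \<tau>)))" for \<tau>
      using linear_cmul[OF bounded_linear.linear[OF bl]] by simp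
    show "(\<lambda>\<tau>. indicator {0<..<t} \<tau> *\<^sub>R heat (t' - t) (rep_L2 (N (t - \<tau>) \<tau> (u \<tau>)))) \<in> borel_measurable lebesgue"
      unfolding eq by (rule measurable_compose[OF N_measurable[OF u t'(2)]
        borel_measurable_continuous_onI[OF bounded_linear.continuous_on[OF bl continuous_on_id]]])
    have "(\<lambda>\<tau>. indicator {0<..<t} \<tau> *\<^sub>R (indicator {0<..<t'} \<tau> *\<^sub>R N (t' - \<tau>) \<tau> (u \<tau>))) \<in> borel_measurable lebesgue"
      by (rule borel_measurable_scaleR[OF borel_measurable_indicator N_measurable[OF u t(3)]])
        (auto intro: sets_completionI_sets)
    moreover have "indicator {0<..<t} \<tau> *\<^sub>R (indicator {0<..<t'} \<tau> *\<^sub>R N (t' - \<tau>) \<tau> (u \<tau>)) =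
        indicator {0<..<t} \<tau> *\<^sub>R N (t' - \<tau>) \<tau> (u \<tau>)" for \<tau>
      using t by (auto simp: indicator_def)
    ultimately show "(\<lambda>\<tau>. indicator {0<..<t} \<tau> *\<^sub>R N (t' - \<tau>) \<tau> (u \<tau>)) \<in> borel_measurable lebesgue"
      by (simp only:)
    show "AE \<tau> in lebesgue. indicator {0<..<t} \<tau> *\<^sub>R N (t' - \<tau>) \<tau> (u \<tau>) =
        indicator {0<..<t} \<tau> *\<^sub>R heat (t' - t) (rep_L2 (N (t - \<tau>) \<tau> (u \<tau>)))"
      using N_semigroup
    proof eventually_elim
      case (elim \<tau>)
      show ?case
      proof (cases "\<tau> \<in> {0<..<t}")
        case True
        then have "grad_le (u \<tau>) (R / sqrt \<tau>)" using x_ballD[OF u, of \<tau>] t by auto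
        then have "heat (t' - t) (rep_L2 (N (t - \<tau>) \<tau> (u \<tau>))) = N ((t' - t) + (t - \<tau>)) \<tau> (u \<tau>)"
          using elim[rule_format, of "t' - t" "t - \<tau>" "u \<tau>" "R / sqrt \<tau>"] True t by simp
        then show ?thesis by simp
      qed simp
    qed
  qed
  also have "\<dots> = heat (t' - t) (rep_L2 (history u t))"
    unfolding history_def using t
    by (intro set_integral_bounded_linear_apply[OF bounded_linear_heat_rep hb(1)]) simp
  finally have "history u t' - history u t =
      (LINT \<tau>:{0<..<t'}|lebesgue. h2 \<tau>) + (heat (t' - t) (rep_L2 (history u t)) - history u t)"
    by (simp add: algebra_simps)
  also have "norm \<dots> \<le> C * (L R * R) * (t' - t) powr \<gamma> + sqrt (t' - t) * (C * (L R * R) * t powr \<gamma> / sqrt t)"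
    using t by (intro norm_triangle_mono ib(2) norm_heat_rep_diff_le hb(3)) simp
  finally show ?thesis .
qed

end

section \<open>Continuity in time\<close>

text \<open>The increment from \<open>r\<close> to \<open>r + h\<close> is the heat flow of the
  increment at time 0, so by contraction one \<open>\<delta>\<close> serves all times.\<close>

lemma continuous_on_heat_rep:
  fixes u :: "('n::finite, real) L2"
  shows "continuous_on {0..} (\<lambda>t. heat t (rep_L2 u))"
proof (rule continuous_on_iff[THEN iffD2], intro ballI allI impI)
  fix s \<epsilon> :: real assume s: "s \<in> {0..}" and "0 < \<epsilon>"
  obtain \<delta> where \<delta>: "0 < \<delta>" "\<And>h. 0 \<le> h \<Longrightarrow> h < \<delta> \<Longrightarrow> norm (heat h (rep_L2 u) - u) < \<epsilon>"
    using heat_rep_tendsto[OF \<open>0 < \<epsilon>\<close>, of u] by blast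
  have *: "dist (heat (r + h) (rep_L2 u)) (heat r (rep_L2 u)) < \<epsilon>" if "0 \<le> r" "0 \<le> h" "h < \<delta>" for r h
  proof -
    have "heat (r + h) (rep_L2 u) - heat r (rep_L2 u) = heat r (rep_L2 (heat h (rep_L2 u))) - heat r (rep_L2 u)"
      using that by (simp add: heat_semigroup_rep)
    also have "\<dots> = heat r (rep_L2 (heat h (rep_L2 u) - u))"
      by (rule linear_diff[OF bounded_linear.linear[OF bounded_linear_heat_rep[OF that(1)]], symmetric])
    finally show ?thesis
      using norm_heat_rep_le[OF that(1), of "heat h (rep_L2 u) - u"] \<delta>(2)[OF that(2,3)] by (simp add: dist_norm)
  qed
  have "dist (heat t (rep_L2 u)) (heat s (rep_L2 u)) < \<epsilon>" if t: "t \<in> {0..}" "dist t s < \<delta>" for t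
  proof (cases "s \<le> t")
    case True
    then show ?thesis using *[of s "t - s"] t s by (simp add: dist_real_def)
  next
    case False
    then show ?thesis using *[of t "s - t"] t s by (simp add: dist_real_def dist_commute)
  qed
  then show "\<exists>\<delta>>0. \<forall>t\<in>{0..}. dist t s < \<delta> \<longrightarrow> dist (heat t (rep_L2 u)) (heat s (rep_L2 u)) < \<epsilon>"
    using \<delta>(1) by blast
qed

context duhamel
begin

text \<open>At \<open>s = 0\<close> the size bound \<open>t powr \<gamma>\<close> suffices. At
  \<open>s > 0\<close> the increments are compared from times \<open>r > s / 2\<close>, where the
  factor \<open>1 / sqrt r\<close> stays bounded.\<close>

lemma continuous_on_history:
  assumes u: "x_ball T R u" and T: "T \<le> 1" and R: "1 \<le> R"
  shows "continuous_on {0..T} (history u)"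
  unfolding continuous_on_def
proof
  fix s assume s: "s \<in> {0..T}"
  define M where "M = C * (L R * R)"
  have M: "0 \<le> M" using C L[of R] R by (simp add: M_def)
  show "(history u \<longlongrightarrow> history u s) (at s within {0..T})"
  proof (cases "s = 0")
    case True
    show ?thesis
    proof (rule Lim_null_comparison[THEN LIM_zero_cancel])
      show "\<forall>\<^sub>F t in at s within {0..T}. norm (history u t - history u s) \<le> M * t powr \<gamma>"
      proof (rule eventually_at_topological[THEN iffD2], intro exI[of _ UNIV] conjI ballI impI)
        fix t assume "t \<noteq> s" "t \<in> {0..T}"
        then show "norm (history u t - history u s) \<le> M * t powr \<gamma>"
          using history_bounds(2)[OF u T R, of t] True by (simp add: M_def)
      qed auto
      have "((\<lambda>t. t powr \<gamma>) \<longlongrightarrow> 0 powr \<gamma>) (at s within {0..T})"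
      proof (rule tendsto_powr')
        show "((\<lambda>t. t) \<longlongrightarrow> 0) (at s within {0..T})" using True by (simp add: tendsto_ident_at)
        show "0 \<noteq> 0 \<or> 0 < \<gamma> \<and> (\<forall>\<^sub>F x in at s within {0..T}. 0 \<le> x)"
          using \<gamma> by (auto simp: eventually_at_topological)
      qed simp
      then show "((\<lambda>t. M * t powr \<gamma>) \<longlongrightarrow> 0) (at s within {0..T})"
        by (intro tendsto_mult_right_zero) simp
    qed
  next
    case False
    then have s0: "0 < s" using s by simp
    define c where "c = M / sqrt (s / 2)"
    have le: "norm (history u t - history u r) \<le> M * (t - r) powr \<gamma> + sqrt (t - r) * c"
      if "s / 2 < r" "r < t" "t \<le> T" for r t
    proof -
      have r: "0 < r" "r \<le> 1" using that s0 T by auto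
      have "M * r powr \<gamma> / sqrt r \<le> M * 1 / sqrt (s / 2)"
        using that s0 M r \<gamma> by (intro frac_le mult_left_mono mult_nonneg_nonneg powr_le_one_le) (auto intro: powr_le1)
      then have "sqrt (t - r) * (M * r powr \<gamma> / sqrt r) \<le> sqrt (t - r) * c"
        unfolding c_def using that by (intro mult_left_mono) auto
      then show ?thesis
        using history_increment[OF u T R r(1) that(2,3)] unfolding M_def[symmetric] by linarith
    qed
    show ?thesis
    proof (rule Lim_null_comparison[THEN LIM_zero_cancel])
      show "\<forall>\<^sub>F t in at s within {0..T}. norm (history u t - history u s) \<le> M * \<bar>t - s\<bar> powr \<gamma> + sqrt \<bar>t - s\<bar> * c"
      proof (rule eventually_at_topological[THEN iffD2], intro exI[of _ "{s/2<..}"] conjI ballI impI)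
        fix t assume t: "t \<in> {s/2<..}" "t \<noteq> s" "t \<in> {0..T}"
        show "norm (history u t - history u s) \<le> M * \<bar>t - s\<bar> powr \<gamma> + sqrt \<bar>t - s\<bar> * c"
        proof (cases "s < t")
          case True
          then show ?thesis using le[of s t] s0 t by simp
        next
          case False
          then show ?thesis using le[of t s] t s by (simp add: norm_minus_commute abs_minus_commute)
        qed
      qed (use s0 in auto)
      have 0: "((\<lambda>t. \<bar>t - s\<bar>) \<longlongrightarrow> 0) (at s within {0..T})"
        using tendsto_rabs[OF tendsto_diff[OF tendsto_ident_at tendsto_const[of s]], of s "{0..T}"] by simp
      have "((\<lambda>t. \<bar>t - s\<bar> powr \<gamma>) \<longlongrightarrow> 0 powr \<gamma>) (at s within {0..T})"
        by (rule tendsto_powr'[OF 0 tendsto_const]) (use \<gamma> in simp)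
      moreover have "((\<lambda>t. sqrt \<bar>t - s\<bar>) \<longlongrightarrow> sqrt 0) (at s within {0..T})"
        by (intro tendsto_real_sqrt 0)
      ultimately show "((\<lambda>t. M * \<bar>t - s\<bar> powr \<gamma> + sqrt \<bar>t - s\<bar> * c) \<longlongrightarrow> 0) (at s within {0..T})"
        by (intro tendsto_add_zero tendsto_mult_right_zero tendsto_mult_left_zero) simp_all
    qed
  qed
qed

section \<open>The Duhamel map: contraction, uniqueness and existence\<close>

definition Phi :: "('n, real) L2 \<Rightarrow> (real \<Rightarrow> ('n, real) L2) \<Rightarrow> real \<Rightarrow> ('n, real) L2" where
  "Phi u0 u t = heat t (rep_L2 u0) + history u t"

lemma Phi_x_ball:
  assumes u: "x_ball T R u" and T: "0 < T" "T \<le> 1" and R: "1 \<le> R"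
    and small: "norm u0 + C * (L R * R) * T powr \<gamma> \<le> R"
  shows "x_ball T R (Phi u0 u)"
proof -
  have M: "0 \<le> C * (L R * R)" using C L[of R] R by simp
  have pow: "C * (L R * R) * t powr \<gamma> \<le> C * (L R * R) * T powr \<gamma>" if "0 \<le> t" "t \<le> T" for t
    using that \<gamma> M by (intro mult_left_mono powr_mono2) auto
  have "continuous_on {0..T} (Phi u0 u)"
    unfolding Phi_def[abs_def]
    by (intro continuous_on_add continuous_on_history[OF u T(2) R] continuous_on_subset[OF continuous_on_heat_rep]) auto
  moreover have "norm (Phi u0 u t) \<le> R" if t: "t \<in> {0..T}" for t
  proof -
    have "norm (history u t) \<le> C * (L R * R) * t powr \<gamma>"
      using history_bounds(2)[OF u T(2) R, of t] t by (cases "t = 0") auto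
    moreover have "norm (heat t (rep_L2 u0)) \<le> norm u0" using t by (intro norm_heat_rep_le) simp
    ultimately show ?thesis
      using pow[of t] t small norm_triangle_ineq[of "heat t (rep_L2 u0)" "history u t"]
      unfolding Phi_def by auto
  qed
  moreover have "grad_le (Phi u0 u t) (R / sqrt t)" if t: "t \<in> {0<..T}" for t
  proof -
    have "grad_le (Phi u0 u t) (norm u0 / sqrt t + C * (L R * R) * t powr \<gamma> / sqrt t)"
      unfolding Phi_def using t by (intro grad_le_add grad_le_heat_rep history_bounds(3)[OF u T(2) R]) auto
    moreover have "norm u0 / sqrt t + C * (L R * R) * t powr \<gamma> / sqrt t \<le> R / sqrt t"
      unfolding add_divide_distrib[symmetric] using t pow[of t] small by (intro divide_right_mono) auto
    ultimately show ?thesis by (rule grad_le_mono)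
  qed
  ultimately show ?thesis by (auto simp: x_ball_def)
qed

lemma Phi_0 [simp]: "Phi u0 u 0 = u0"
  by (simp add: Phi_def)

text \<open>The heat flow of the datum cancels and the trajectories agree up to \<open>a\<close>, so
  smallness concerns only the length \<open>b - a\<close>, not the position of the interval.\<close>

lemma Phi_contraction:
  assumes u: "x_ball T R u" and w: "x_ball T R w" and T: "T \<le> 1" and R: "1 \<le> R"
    and a: "0 \<le> a" "b \<le> T" and small: "C * L R * (b - a) powr \<gamma> \<le> 1/2"
    and eq: "\<And>\<tau>. \<tau> \<in> {0<..a} \<Longrightarrow> u \<tau> = w \<tau>"
    and D: "\<And>\<tau>. \<tau> \<in> {a<..b} \<Longrightarrow> norm (u \<tau> - w \<tau>) \<le> D"
      "\<And>\<tau>. \<tau> \<in> {a<..b} \<Longrightarrow> grad_le (u \<tau> - w \<tau>) (D / sqrt \<tau>)"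
    and t: "t \<in> {a<..b}"
  shows "norm (Phi u0 u t - Phi u0 w t) \<le> D / 2" "grad_le (Phi u0 u t - Phi u0 w t) (D / 2 / sqrt t)"
proof -
  have "0 \<le> D" using order_trans[OF norm_ge_zero D(1)[OF t]] .
  have "C * L R * (t - a) powr \<gamma> \<le> C * L R * (b - a) powr \<gamma>"
    using t \<gamma> C L[of R] by (intro mult_left_mono powr_mono2) auto
  then have "(C * L R * (t - a) powr \<gamma>) * D \<le> 1/2 * D"
    using small \<open>0 \<le> D\<close> by (intro mult_right_mono) auto
  then have le: "C * (L R * D) * (t - a) powr \<gamma> \<le> D / 2" by (simp add: mult_ac)
  have d: "Phi u0 u t - Phi u0 w t = history u t - history w t" by (simp add: Phi_def)
  have hb: "norm (history u t - history w t) \<le> C * (L R * D) * (t - a) powr \<gamma>"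
    "grad_le (history u t - history w t) (C * (L R * D) * (t - a) powr \<gamma> / sqrt t)"
    by (rule history_diff_bounds[OF u w T R a(1) _ _ eq D]; use t a in auto)+
  show "norm (Phi u0 u t - Phi u0 w t) \<le> D / 2" using hb(1) le unfolding d by linarith
  show "grad_le (Phi u0 u t - Phi u0 w t) (D / 2 / sqrt t)"
    unfolding d by (rule grad_le_mono[OF hb(2)]) (use le t a in \<open>intro divide_right_mono; simp\<close>)
qed

text \<open>On each step the solutions differ by at most \<open>2 * R\<close>. As both are fixed
  points, every use of the contraction halves the bound at all times of the step at once, and the
  bound tends to 0.\<close>

lemma fixed_point_unique:
  assumes u: "x_ball T R u" and w: "x_ball T R w" and T: "0 < T" "T \<le> 1" and R: "1 \<le> R"
    and fu: "\<And>t. t \<in> {0..T} \<Longrightarrow> u t = Phi u0 u t" and fw: "\<And>t. t \<in> {0..T} \<Longrightarrow> w t = Phi u0 w t"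
    and t: "t \<in> {0..T}"
  shows "u t = w t"
proof -
  \<comment> \<open>With \<open>x = C * L R\<close> this makes
    \<open>x * \<eta> powr \<gamma>\<close> equal to \<open>x / (2 * (x + 1))\<close>, which is at
    most \<open>1/2\<close>; the added 1 keeps \<open>\<eta>\<close> positive when
    \<open>x = 0\<close>.\<close>
  define \<eta> where "\<eta> = (1 / (2 * (C * L R + 1))) powr (1 / \<gamma>)"
  have CL: "0 \<le> C * L R" using C L[of R] by simp
  have \<eta>: "0 < \<eta>" using CL by (simp add: \<eta>_def)
  have "\<eta> powr \<gamma> = 1 / (2 * (C * L R + 1))"
    using \<gamma> CL by (simp add: \<eta>_def powr_powr)
  moreover have "x * (1 / (2 * (x + 1))) \<le> 1/2" if "0 \<le> x" for x :: real
    using that by (simp add: pos_divide_le_eq)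
  ultimately have small: "C * L R * \<eta> powr \<gamma> \<le> 1/2"
    using CL by simp
  have step: "\<forall>t\<in>{0<..T}. t \<le> real n * \<eta> \<longrightarrow> u t = w t" for n
  proof (induction n)
    case (Suc n)
    define a where "a = real n * \<eta>"
    define b where "b = min T (a + \<eta>)"
    have a: "0 \<le> a" using \<eta> by (simp add: a_def)
    have b: "b \<le> T" "b - a \<le> \<eta>" by (auto simp: b_def)
    have eq: "u \<tau> = w \<tau>" if "\<tau> \<in> {0<..a}" "\<tau> \<le> T" for \<tau>
      using Suc.IH that by (simp add: a_def)
    have new: "u r = w r" if r: "r \<in> {a<..b}" for r
    proof -
      have "C * L R * (b - a) powr \<gamma> \<le> C * L R * \<eta> powr \<gamma>"
        using r b \<gamma> CL by (intro mult_left_mono powr_mono2) auto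
      then have sm: "C * L R * (b - a) powr \<gamma> \<le> 1/2" using small by linarith
      have bound: "\<forall>t\<in>{a<..b}. norm (u t - w t) \<le> 2 * R * (1/2) ^ m \<and> grad_le (u t - w t) (2 * R * (1/2) ^ m / sqrt t)" for m
      proof (induction m)
        case 0
        show ?case
        proof
          fix t assume t: "t \<in> {a<..b}"
          then have tT: "t \<in> {0<..T}" using a b by auto
          have "norm (u t - w t) \<le> R + R"
            using x_ballD(1)[OF u tT] x_ballD(1)[OF w tT] norm_triangle_ineq4[of "u t" "w t"] by linarith
          moreover have "grad_le (u t - w t) (R / sqrt t + R / sqrt t)"
            by (rule grad_le_diff[OF x_ballD(2)[OF u tT] x_ballD(2)[OF w tT]])
          ultimately show "norm (u t - w t) \<le> 2 * R * (1/2) ^ 0 \<and> grad_le (u t - w t) (2 * R * (1/2) ^ 0 / sqrt t)"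
            by (simp add: add_divide_distrib[symmetric])
        qed
      next
        case (Suc m)
        show ?case
        proof
          fix t assume t: "t \<in> {a<..b}"
          have "r \<le> T" using r b by auto
          have eq': "u \<tau> = w \<tau>" if "\<tau> \<in> {0<..a}" for \<tau>
            using eq[OF that] that r b by auto
          have "u t = Phi u0 u t" "w t = Phi u0 w t" using t a b by (auto intro!: fu fw)
          then show "norm (u t - w t) \<le> 2 * R * (1/2) ^ Suc m \<and> grad_le (u t - w t) (2 * R * (1/2) ^ Suc m / sqrt t)"
            using Phi_contraction[OF u w T(2) R a b(1) sm eq' _ _ t, of "2 * R * (1/2) ^ m" u0] Suc.IH by simp
        qed
      qed
      have "(\<lambda>m. 2 * R * (1/2) ^ m) \<longlonglongrightarrow> 2 * R * 0"
        by (intro tendsto_mult_left LIMSEQ_power_zero) simp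
      then have "norm (u r - w r) \<le> 2 * R * 0"
        by (rule tendsto_lowerbound) (use bound r in \<open>auto intro!: always_eventually\<close>)
      then show ?thesis by simp
    qed
    show ?case
    proof (intro ballI impI)
      fix t assume t: "t \<in> {0<..T}" "t \<le> real (Suc n) * \<eta>"
      have "real (Suc n) * \<eta> = a + \<eta>" by (simp add: a_def algebra_simps)
      then have "t \<in> {0<..a} \<or> t \<in> {a<..b}" using t by (auto simp: b_def)
      then show "u t = w t" using new[of t] eq[of t] t by auto
    qed
  qed simp
  show ?thesis
  proof (cases "t = 0")
    case True
    then show ?thesis using fu[OF t] fw[OF t] by simp
  next
    case False
    obtain n where "t \<le> real n * \<eta>" using reals_Archimedean3[OF \<eta>] less_imp_le by blast
    then show ?thesis using step[of n] t False by simp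
  qed
qed

text \<open>Picard iteration from 0, with the limit taken at each time separately and both bounds
  passing to it. Half of the radius is reserved for the datum and half for the Duhamel
  integral.\<close>

lemma fixed_point_exists:
  assumes T: "0 < T" "T \<le> 1" and R: "1 \<le> R"
    and small: "norm u0 \<le> R / 2" "C * L R * T powr \<gamma> \<le> 1/2"
  obtains u where "x_ball T R u" "\<And>t. t \<in> {0..T} \<Longrightarrow> u t = Phi u0 u t"
proof -
  define X where "X n = (Phi u0 ^^ n) (\<lambda>_. 0)" for n
  have X_Suc: "X (Suc n) = Phi u0 (X n)" for n by (simp add: X_def)
  have "C * (L R * R) * T powr \<gamma> \<le> 1/2 * R"
    using mult_right_mono[OF small(2), of R] R by (simp add: mult_ac)
  then have sm: "norm u0 + C * (L R * R) * T powr \<gamma> \<le> R" using small(1) by simp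
  have X: "x_ball T R (X n)" for n
  proof (induction n)
    case 0
    show ?case using R by (simp add: X_def x_ball_zero)
  next
    case (Suc n)
    then show ?case unfolding X_Suc by (rule Phi_x_ball[OF _ T R sm])
  qed
  have step: "\<forall>t\<in>{0<..T}. norm (X (Suc n) t - X n t) \<le> R * (1/2) ^ n \<and> grad_le (X (Suc n) t - X n t) (R * (1/2) ^ n / sqrt t)" for n
  proof (induction n)
    case 0
    show ?case using x_ballD[OF X[of 1]] by (simp add: X_def)
  next
    case (Suc n)
    show ?case
    proof
      fix t assume "t \<in> {0<..T}"
      then show "norm (X (Suc (Suc n)) t - X (Suc n) t) \<le> R * (1/2) ^ Suc n \<and>
          grad_le (X (Suc (Suc n)) t - X (Suc n) t) (R * (1/2) ^ Suc n / sqrt t)"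
        using Phi_contraction[OF X[of "Suc n"] X[of n] T(2) R order_refl order_refl, of "R * (1/2) ^ n" t u0] small(2) Suc.IH
        by (simp add: X_Suc[of "Suc n"] X_Suc[of n])
    qed
  qed
  \<comment> \<open>The tail from index \<open>n\<close> on of the geometric series
    \<open>R * (1/2) ^ j\<close>.\<close>
  define e where "e n = 2 * R * (1/2) ^ n" for n :: nat
  have e: "e \<longlonglongrightarrow> 0"
    unfolding e_def using tendsto_mult_left[OF LIMSEQ_power_zero[of "1/2 :: real"], of "2 * R"] by simp
  have e0: "0 \<le> e n" for n using R by (simp add: e_def)
  have dist: "norm (X (n + m) t - X n t) \<le> e n \<and> grad_le (X (n + m) t - X n t) (e n / sqrt t)" if t: "t \<in> {0<..T}" for n m t
  proof -
    \<comment> \<open>The difference \<open>e n - e (n + m)\<close> telescopes in the induction; the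
      bound \<open>e n\<close> alone would not be inductive.\<close>
    have "norm (X (n + m) t - X n t) \<le> e n - e (n + m) \<and> grad_le (X (n + m) t - X n t) ((e n - e (n + m)) / sqrt t)"
    proof (induction m)
      case (Suc m)
      have split: "X (n + Suc m) t - X n t = (X (Suc (n + m)) t - X (n + m) t) + (X (n + m) t - X n t)" by simp
      have sum: "R * (1/2) ^ (n + m) + (e n - e (n + m)) = e n - e (n + Suc m)" by (simp add: e_def)
      have "norm (X (n + Suc m) t - X n t) \<le> e n - e (n + Suc m)"
        unfolding split sum[symmetric] using step[of "n + m"] t Suc by (intro norm_triangle_mono) auto
      moreover have "grad_le (X (n + Suc m) t - X n t) (R * (1/2) ^ (n + m) / sqrt t + (e n - e (n + m)) / sqrt t)"
        unfolding split using step[of "n + m"] t Suc by (intro grad_le_add) auto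
      ultimately show ?case by (simp only: add_divide_distrib[symmetric] sum)
    qed simp
    moreover have "(e n - e (n + m)) / sqrt t \<le> e n / sqrt t"
      using e0[of "n + m"] t by (intro divide_right_mono) auto
    ultimately show ?thesis using e0[of "n + m"] by (auto intro: grad_le_mono)
  qed
  \<comment> \<open>The starting iterate vanishes and need not have the right initial value; all
    later ones do. Limits at time 0 are therefore taken along \<open>Suc n\<close>.\<close>
  have X0: "X (Suc n) 0 = u0" for n by (simp add: X_Suc)
  have "\<exists>l. (\<lambda>n. X n t) \<longlonglongrightarrow> l" if t: "t \<in> {0..T}" for t
  proof (cases "t = 0")
    case True
    have "(\<lambda>n. X (Suc n) 0) \<longlonglongrightarrow> u0" by (simp add: X0)
    then have "(\<lambda>n. X n 0) \<longlonglongrightarrow> u0" by (rule LIMSEQ_imp_Suc)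
    then show ?thesis using True by blast
  next
    case False
    then have t: "t \<in> {0<..T}" using t by simp
    have "Cauchy (\<lambda>n. X n t)"
    proof (rule metric_CauchyI)
      fix r :: real assume "0 < r"
      then obtain n where n: "\<And>m. m \<ge> n \<Longrightarrow> e m < r / 2"
        using order_tendstoD(2)[OF e, of "r / 2"] by (auto simp: eventually_sequentially)
      have near: "norm (X m t - X n t) < r / 2" if "m \<ge> n" for m
        using dist[OF t, of n "m - n"] n[of n] that by simp
      have "dist (X m t) (X k t) < r" if "m \<ge> n" "k \<ge> n" for m k
        using near[OF that(1)] near[OF that(2)] dist_triangle2[of "X m t" "X k t" "X n t"] by (simp add: dist_norm)
      then show "\<exists>n. \<forall>m\<ge>n. \<forall>k\<ge>n. dist (X m t) (X k t) < r" by blast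
    qed
    then show ?thesis using Cauchy_convergent convergent_def by blast
  qed
  then obtain u where lim: "\<And>t. t \<in> {0..T} \<Longrightarrow> (\<lambda>n. X n t) \<longlonglongrightarrow> u t" by metis
  have u_diff: "norm (u t - X n t) \<le> e n" "grad_le (u t - X n t) (e n / sqrt t)" if t: "t \<in> {0<..T}" for t n
  proof -
    have l: "(\<lambda>m. X (n + m) t - X n t) \<longlonglongrightarrow> u t - X n t"
      using LIMSEQ_ignore_initial_segment[OF lim, of t n] t by (intro tendsto_intros) (simp_all add: add.commute)
    show "norm (u t - X n t) \<le> e n"
      by (rule tendsto_upperbound[OF tendsto_norm[OF l]]) (use dist[OF t] in \<open>auto intro: always_eventually\<close>)
    show "grad_le (u t - X n t) (e n / sqrt t)"
      by (rule grad_le_LIMSEQ[OF l]) (use dist[OF t] in \<open>auto intro: always_eventually\<close>)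
  qed
  have u0: "u 0 = u0"
  proof (rule LIMSEQ_unique)
    show "(\<lambda>n. X (Suc n) 0) \<longlonglongrightarrow> u 0" using T by (intro LIMSEQ_Suc lim) simp
    show "(\<lambda>n. X (Suc n) 0) \<longlonglongrightarrow> u0" by (simp add: X0)
  qed
  have u_diff': "norm (X (Suc n) t - u t) \<le> e (Suc n)" if t: "t \<in> {0..T}" for t n
    using u_diff(1)[of t "Suc n"] t e0[of "Suc n"] u0 by (cases "t = 0") (auto simp: X0 norm_minus_commute)
  have "continuous_on {0..T} u"
  proof (rule uniform_limit_theorem)
    show "\<forall>\<^sub>F n in sequentially. continuous_on {0..T} (X (Suc n))"
      using X by (auto simp: x_ball_def)
    show "uniform_limit {0..T} (\<lambda>n. X (Suc n)) u sequentially"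
    proof (rule uniform_limitI)
      fix r :: real assume "0 < r"
      have "\<forall>\<^sub>F n in sequentially. e (Suc n) < r"
        using order_tendstoD(2)[OF LIMSEQ_Suc[OF e] \<open>0 < r\<close>] .
      then show "\<forall>\<^sub>F n in sequentially. \<forall>t\<in>{0..T}. dist (X (Suc n) t) (u t) < r"
      proof eventually_elim
        case (elim n)
        then show ?case using le_less_trans[OF u_diff'] by (simp add: dist_norm)
      qed
    qed
  qed simp
  moreover have "norm (u t) \<le> R" if "t \<in> {0..T}" for t
    by (rule tendsto_upperbound[OF tendsto_norm[OF lim[OF that]]])
      (use X that in \<open>auto simp: x_ball_def intro: always_eventually\<close>)
  moreover have "grad_le (u t) (R / sqrt t)" if "t \<in> {0<..T}" for t
    by (rule grad_le_LIMSEQ[OF lim]) (use X that in \<open>auto simp: x_ball_def intro: always_eventually\<close>)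
  ultimately have u: "x_ball T R u" by (simp add: x_ball_def)
  have "u t = Phi u0 u t" if t: "t \<in> {0..T}" for t
  proof (cases "t = 0")
    case True
    then show ?thesis by (simp add: u0)
  next
    case False
    then have t: "t \<in> {0<..T}" using t by simp
    have le: "norm (Phi u0 u t - X (Suc n) t) \<le> e n / 2" for n
      unfolding X_Suc
      by (rule Phi_contraction(1)[OF u X[of n] T(2) R order_refl order_refl _ _ u_diff t]) (use small(2) in simp_all)
    have "(\<lambda>n. e n / 2) \<longlonglongrightarrow> 0"
      by (rule tendsto_divide_zero[OF e])
    then have "(\<lambda>n. Phi u0 u t - X (Suc n) t) \<longlonglongrightarrow> 0"
      by (rule Lim_null_comparison[OF always_eventually[OF allI[OF le]]])
    then have "(\<lambda>n. Phi u0 u t - (Phi u0 u t - X (Suc n) t)) \<longlonglongrightarrow> Phi u0 u t - 0"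
      by (intro tendsto_diff tendsto_const)
    then have "(\<lambda>n. X (Suc n) t) \<longlonglongrightarrow> Phi u0 u t" by simp
    moreover have "(\<lambda>n. X (Suc n) t) \<longlonglongrightarrow> u t" using t by (intro LIMSEQ_Suc lim) simp
    ultimately show ?thesis using LIMSEQ_unique by blast
  qed
  with u show ?thesis by (rule that)
qed

end

section \<open>Heat flow of products\<close>

text \<open>The mean value theorem, with the intermediate power bounded by that at the larger end
  point. The end point 0 is treated by hand because differentiating a real power asks for a positive
  base.\<close>

lemma powr_diff_le:
  fixes x y p :: real
  assumes p: "1 \<le> p" and xy: "0 \<le> x" "0 \<le> y"
  shows "\<bar>x powr p - y powr p\<bar> \<le> p * (x powr (p - 1) + y powr (p - 1)) * \<bar>x - y\<bar>"
proof -
  have mvt: "\<bar>x powr p - y powr p\<bar> \<le> p * (x powr (p - 1) + y powr (p - 1)) * \<bar>x - y\<bar>"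
    if "0 \<le> x" "x < y" for x y :: real
  proof (cases "x = 0")
    case True
    have "y powr p = y powr (p - 1) * y" using that powr_add[of y "p - 1" 1] by simp
    moreover have "1 * (y powr (p - 1) * y) \<le> p * (y powr (p - 1) * y)"
      using p that by (intro mult_right_mono) auto
    ultimately show ?thesis using True that by (simp add: mult.assoc)
  next
    case False
    then have x: "0 < x" using that by simp
    have "\<exists>z>x. z < y \<and> y powr p - x powr p = (y - x) * (p * z powr (p - 1))"
      by (rule MVT2) (use x that in \<open>auto intro!: has_real_derivative_powr\<close>)
    then obtain z where z: "x < z" "z < y" "y powr p - x powr p = (y - x) * (p * z powr (p - 1))" by blast
    have zy: "z powr (p - 1) \<le> y powr (p - 1)" using z x p by (intro powr_mono2) auto
    have "x powr p \<le> y powr p" using that p by (intro powr_mono2) auto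
    then have "\<bar>x powr p - y powr p\<bar> = (y - x) * (p * z powr (p - 1))" using z(3) by simp
    also have "\<dots> \<le> (y - x) * (p * (x powr (p - 1) + y powr (p - 1)))"
      using that p zy by (intro mult_left_mono) (auto intro: add_increasing)
    finally show ?thesis using that by (simp add: mult_ac)
  qed
  show ?thesis
  proof (cases x y rule: linorder_cases)
    case less
    then show ?thesis using mvt[of x y] xy by simp
  next
    case greater
    then show ?thesis using mvt[of y x] xy by (simp add: abs_minus_commute add.commute)
  qed simp
qed

text \<open>
  The hypothesis of \<open>norm_heat_product\<close> at all times at once: the form in which a bound \<open>V\<close> on the
  \<open>L\<^sup>q\<close> norm with \<open>\<alpha> = CARD('n) / (2 * q)\<close>, including \<open>q = \<infinity>\<close>, is used.
\<close>

definition tail_le :: "real \<Rightarrow> (real^'n \<Rightarrow> real) \<Rightarrow> real \<Rightarrow> bool" where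
  "tail_le \<alpha> a V \<longleftrightarrow> square_integrable a \<and> (AE x in torus. 0 \<le> a x) \<and> 0 \<le> V \<and>
     (\<forall>t. 0 < t \<and> t \<le> 1 \<longrightarrow> (LINT x|torus. (a x)\<^sup>2 * indicator {x. V * t powr (- \<alpha>) < a x} x)
        \<le> (V * t powr (real CARD('n) / 4 - \<alpha>))\<^sup>2)"

text \<open>For \<open>\<alpha> = 0\<close> the level is \<open>V\<close> at every positive time,
  and the set above it is null.\<close>

lemma tail_le_bounded:
  fixes a :: "real^'n \<Rightarrow> real"
  assumes a: "a \<in> borel_measurable torus" "AE x in torus. 0 \<le> a x" "AE x in torus. a x \<le> V"
    and V: "0 \<le> V"
  shows "tail_le 0 a V"
  unfolding tail_le_def
proof (intro conjI allI impI)
  show "square_integrable a"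
    by (rule square_integrable_bound[OF square_integrable_const[of V] a(1)])
      (use a(2,3) in eventually_elim, simp)
  fix t :: real assume "0 < t \<and> t \<le> 1"
  then have "AE x in torus. (a x)\<^sup>2 * indicator {x. V * t powr (- 0) < a x} x = 0"
    using a(3) by (auto simp: indicator_def elim!: eventually_mono)
  then have "(LINT x|torus. (a x)\<^sup>2 * indicator {x. V * t powr (- 0) < a x} x) = 0"
    by (rule integral_eq_zero_AE)
  then show "(LINT x|torus. (a x)\<^sup>2 * indicator {x. V * t powr (- 0) < a x} x)
      \<le> (V * t powr (real CARD('n) / 4 - 0))\<^sup>2" by simp
qed (use a V in auto)

text \<open>Chebyshev's inequality: above the level \<open>\<mu>\<close> the square is at most
  \<open>\<mu> powr (2 - q) * a x powr q\<close>. The relation between \<open>\<alpha>\<close> and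
  \<open>q\<close> makes the resulting power of \<open>t\<close> equal to
  \<open>2 * (N / 4 - \<alpha>)\<close>.\<close>

lemma tail_le_Lq:
  fixes a :: "real^'n \<Rightarrow> real"
  assumes q: "2 \<le> q" and \<alpha>: "\<alpha> = real CARD('n) / (2 * q)" and V: "0 < V"
    and a [measurable]: "a \<in> borel_measurable torus" and nonneg: "\<And>x. 0 \<le> a x"
    and int: "integrable torus (\<lambda>x. a x powr q)" and le: "(LINT x|torus. a x powr q) \<le> V powr q"
  shows "tail_le \<alpha> a V"
  unfolding tail_le_def
proof (intro conjI allI impI)
  have "(a x)\<^sup>2 \<le> 1 + a x powr q" for x
  proof (cases "a x \<le> 1")
    case True
    then have "(a x)\<^sup>2 \<le> 1" using nonneg by (simp add: power_le_one)
    then show ?thesis by (simp add: add_increasing2)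
  next
    case False
    then have "a x powr 2 \<le> a x powr q" using q by (intro powr_mono) auto
    then show ?thesis using False by (simp add: powr_numeral)
  qed
  then have dom: "norm ((a x)\<^sup>2) \<le> norm (1 + a x powr q)" for x by simp
  have int2: "integrable torus (\<lambda>x. (a x)\<^sup>2)"
  proof (rule Bochner_Integration.integrable_bound)
    show "integrable torus (\<lambda>x. 1 + a x powr q)" using int by simp
    show "AE x in torus. norm ((a x)\<^sup>2) \<le> norm (1 + a x powr q)" using dom by (rule AE_I2)
  qed measurable
  then show si: "square_integrable a" by (simp add: square_integrable_def)
  fix t :: real assume t: "0 < t \<and> t \<le> 1"
  define \<mu> where "\<mu> = V * t powr - \<alpha>"
  have \<mu>: "0 < \<mu>" using V t by (simp add: \<mu>_def)
  have pt: "(a x)\<^sup>2 * indicator {x. \<mu> < a x} x \<le> \<mu> powr (2 - q) * a x powr q" for x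
  proof (cases "\<mu> < a x")
    case True
    have "(a x)\<^sup>2 = a x powr (2 - q) * a x powr q"
      using True \<mu> by (simp add: powr_numeral flip: powr_add)
    also have "\<dots> \<le> \<mu> powr (2 - q) * a x powr q"
      using True \<mu> q by (intro mult_right_mono powr_mono2') auto
    finally show ?thesis using True by simp
  qed simp
  have "(LINT x|torus. (a x)\<^sup>2 * indicator {x. \<mu> < a x} x) \<le> (LINT x|torus. \<mu> powr (2 - q) * a x powr q)"
  proof (rule integral_mono)
    show "integrable torus (\<lambda>x. (a x)\<^sup>2 * indicator {x. \<mu> < a x} x)"
      by (rule Bochner_Integration.integrable_bound[OF int2]) (auto simp: indicator_def)
    show "integrable torus (\<lambda>x. \<mu> powr (2 - q) * a x powr q)" using int by simp
  qed (rule pt)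
  also have "\<dots> \<le> \<mu> powr (2 - q) * V powr q" using le by (simp add: mult_left_mono)
  also have "\<dots> = V powr (2 - q) * V powr q * t powr (- \<alpha> * (2 - q))"
    unfolding \<mu>_def using V t by (simp add: powr_mult powr_powr)
  also have "V powr (2 - q) * V powr q = V\<^sup>2" using V by (simp add: powr_numeral flip: powr_add)
  also have "- \<alpha> * (2 - q) = (real CARD('n) / 4 - \<alpha>) * 2" using q by (simp add: \<alpha> field_simps)
  also have "t powr ((real CARD('n) / 4 - \<alpha>) * 2) = (t powr (real CARD('n) / 4 - \<alpha>))\<^sup>2"
    using t unfolding powr_powr[symmetric] by (simp add: powr_numeral)
  finally show "(LINT x|torus. (a x)\<^sup>2 * indicator {x. V * t powr - \<alpha> < a x} x)
      \<le> (V * t powr (real CARD('n) / 4 - \<alpha>))\<^sup>2"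
    by (simp add: \<mu>_def power_mult_distrib)
qed (use nonneg V in auto)

text \<open>The tail condition at \<open>t = 1\<close> bounds the part above the level
  \<open>V\<close>; the part below contributes at most \<open>V\<^sup>2\<close> on a torus of
  measure 1.\<close>

lemma tail_le_norm:
  fixes a :: "real^'n \<Rightarrow> real"
  assumes "tail_le \<alpha> a V"
  shows "square_integrable a" "norm (abs_L2 a) \<le> 2 * V"
proof -
  show a: "square_integrable a" using assms by (simp add: tail_le_def)
  then have [measurable]: "a \<in> borel_measurable torus" by (simp add: square_integrable_def)
  have V: "0 \<le> V" and nonneg: "AE x in torus. 0 \<le> a x" using assms by (auto simp: tail_le_def)
  have tail: "(LINT x|torus. (a x)\<^sup>2 * indicator {x. V < a x} x) \<le> V\<^sup>2"
    using assms unfolding tail_le_def by (auto dest!: spec[of _ 1])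
  have int: "integrable torus (\<lambda>x. (a x)\<^sup>2)" using a by (simp add: square_integrable_def)
  have int1: "integrable torus (\<lambda>x. (a x)\<^sup>2 * indicator {x. V < a x} x)"
    by (rule Bochner_Integration.integrable_bound[OF int]) (auto simp: indicator_def)
  have "(LINT x|torus. (a x)\<^sup>2) \<le> (LINT x|torus. (a x)\<^sup>2 * indicator {x. V < a x} x + V\<^sup>2)"
  proof (rule integral_mono_AE[OF int])
    show "AE x in torus. (a x)\<^sup>2 \<le> (a x)\<^sup>2 * indicator {x. V < a x} x + V\<^sup>2"
      using nonneg by eventually_elim (auto simp: indicator_def intro: power_mono)
  qed (use int1 in simp)
  also have "\<dots> \<le> V\<^sup>2 + V\<^sup>2" using int1 tail by simp
  also have "\<dots> \<le> (2 * V)\<^sup>2" by (simp add: power2_eq_square)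
  finally have "(norm (abs_L2 a))\<^sup>2 \<le> (2 * V)\<^sup>2" by (simp add: norm_abs_L2_sq[OF a])
  then show "norm (abs_L2 a) \<le> 2 * V" by (rule power2_le_imp_le) (use V in simp)
qed

lemma tail_le_heat:
  fixes f :: "real^'n \<Rightarrow> real" and g :: "real^'n \<Rightarrow> 'b::euclidean_space"
  assumes a: "tail_le \<alpha> a V" and t: "0 < t" "t \<le> 1" and f: "f \<in> borel_measurable torus" and g: "square_integrable g"
    and le: "AE x in torus. \<bar>f x\<bar> \<le> a x * norm (g x)"
  shows "norm (heat t f) \<le> 3 * 12 ^ CARD('n) * V * t powr (- \<alpha>) * norm (abs_L2 g)"
  using a by (intro norm_heat_product[OF t f _ g le]) (use t in \<open>auto simp: tail_le_def\<close>)

text \<open>For \<open>q = 2 / (p - 1)\<close> the \<open>q\<close>th power of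
  \<open>\<bar>f x\<bar> powr (p - 1)\<close> is the square of \<open>f x\<close>, so the
  \<open>L\<^sup>2\<close> norm controls the weight. In \<open>4 * p * R\<close> the factor
  \<open>2 * p\<close> accounts for the two summands, and \<open>2 * R\<close> absorbs the sum of
  the two squared norms because \<open>R \<ge> 1\<close> and \<open>q \<ge> 2\<close>.\<close>

lemma tail_le_source:
  fixes f g :: "real^'n \<Rightarrow> real"
  assumes p: "1 \<le> p" "p < 2" and R: "1 \<le> R"
    and f: "square_integrable f" "norm (abs_L2 f) \<le> R" and g: "square_integrable g" "norm (abs_L2 g) \<le> R"
  shows "tail_le (real CARD('n) * (p - 1) / 4) (\<lambda>x. p * (\<bar>f x\<bar> powr (p - 1) + \<bar>g x\<bar> powr (p - 1))) (4 * p * R)"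
proof -
  have [measurable]: "f \<in> borel_measurable torus" "g \<in> borel_measurable torus"
    using f g by (auto simp: square_integrable_def)
  show ?thesis
  proof (cases "p = 1")
    case True
    have le1: "\<bar>x\<bar> powr 0 \<le> 1" for x :: real by simp
    have "\<bar>f x\<bar> powr 0 + \<bar>g x\<bar> powr 0 \<le> 4 * R" for x
      using le1[of "f x"] le1[of "g x"] R by linarith
    then show ?thesis using True R by (simp del: powr_zero_eq_one) (intro tail_le_bounded; simp)
  next
    case False
    define q where "q = 2 / (p - 1)"
    have q: "2 \<le> q" "(p - 1) * q = 2" using p False by (auto simp: q_def field_simps)
    define b where "b x = \<bar>f x\<bar> powr (p - 1) + \<bar>g x\<bar> powr (p - 1)" for x
    have b0: "0 \<le> b x" for x by (simp add: b_def)
    have [measurable]: "b \<in> borel_measurable torus" unfolding b_def by measurable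
    have pt: "(p * b x) powr q \<le> (2 * p) powr q * ((f x)\<^sup>2 + (g x)\<^sup>2)" for x
    proof -
      define m where "m = max \<bar>f x\<bar> \<bar>g x\<bar>"
      have "b x \<le> 2 * m powr (p - 1)"
      proof -
        have "\<bar>f x\<bar> powr (p - 1) \<le> m powr (p - 1)" "\<bar>g x\<bar> powr (p - 1) \<le> m powr (p - 1)"
          using p by (auto simp: m_def intro!: powr_mono2)
        then show ?thesis by (simp add: b_def)
      qed
      then have "p * b x \<le> 2 * p * m powr (p - 1)" using p by simp
      then have "(p * b x) powr q \<le> (2 * p * m powr (p - 1)) powr q"
        using p q b0 by (intro powr_mono2) auto
      also have "\<dots> = (2 * p) powr q * m powr 2"
        using p q(2) by (subst powr_mult) (auto simp: powr_powr)
      also have "m powr 2 = m\<^sup>2" by (simp add: m_def powr_numeral)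
      also have "m\<^sup>2 \<le> (f x)\<^sup>2 + (g x)\<^sup>2" by (auto simp: m_def max_def)
      finally show ?thesis by (simp add: mult_left_mono)
    qed
    have fg: "integrable torus (\<lambda>x. (f x)\<^sup>2 + (g x)\<^sup>2)" using f g by (simp add: square_integrable_def)
    have int: "integrable torus (\<lambda>x. (p * b x) powr q)"
      by (rule Bochner_Integration.integrable_bound[where f = "\<lambda>x. (2 * p) powr q * ((f x)\<^sup>2 + (g x)\<^sup>2)"])
        (use fg pt in auto)
    have "(LINT x|torus. (p * b x) powr q) \<le> (LINT x|torus. (2 * p) powr q * ((f x)\<^sup>2 + (g x)\<^sup>2))"
      by (rule integral_mono[OF int]) (use fg pt in auto)
    also have "\<dots> = (2 * p) powr q * ((norm (abs_L2 f))\<^sup>2 + (norm (abs_L2 g))\<^sup>2)"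
      using f g by (simp add: norm_abs_L2_sq) (simp add: square_integrable_def)
    also have "\<dots> \<le> (2 * p) powr q * (2 * R) powr q"
    proof (rule mult_left_mono)
      have "(norm (abs_L2 f))\<^sup>2 \<le> R\<^sup>2" "(norm (abs_L2 g))\<^sup>2 \<le> R\<^sup>2" using f g by (auto intro: power_mono)
      moreover have "(2 * R)\<^sup>2 \<le> (2 * R) powr q"
        using powr_mono[OF q(1), of "2 * R"] R by (simp add: powr_numeral)
      moreover have "(2 * R)\<^sup>2 = 4 * R\<^sup>2" by (simp add: power_mult_distrib)
      ultimately show "(norm (abs_L2 f))\<^sup>2 + (norm (abs_L2 g))\<^sup>2 \<le> (2 * R) powr q"
        using zero_le_power2[of R] by linarith
    qed simp
    also have "\<dots> = (4 * p * R) powr q" using p R by (subst powr_mult[symmetric]) (auto simp: mult.assoc)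
    finally have le: "(LINT x|torus. (p * b x) powr q) \<le> (4 * p * R) powr q" .
    have "tail_le (real CARD('n) * (p - 1) / 4) (\<lambda>x. p * b x) (4 * p * R)"
      by (rule tail_le_Lq[OF q(1) _ _ _ _ int le]) (use p R b0 False in \<open>auto simp: q_def\<close>)
    then show ?thesis by (simp add: b_def)
  qed
qed

text \<open>The norm has two forms: an essential supremum for \<open>p = 1\<close>, otherwise the
  root of an integral whose finiteness must be extracted before it can be read as the integral of a
  real function.\<close>

lemma tail_le_velocity:
  fixes w :: "real^'n \<Rightarrow> real^'m"
  assumes p: "1 \<le> p" "p < 2" and V: "0 < V"
    and w: "w \<in> borel_measurable torus" "torus_norm (velocity_exponent p) w \<le> ennreal V"
  shows "tail_le (real CARD('n) * (p - 1) / 4) (\<lambda>x. norm (w x)) V"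
proof -
  note [measurable] = w(1)
  show ?thesis
  proof (cases "p = 1")
    case True
    then have "esssup torus (\<lambda>x. ennreal (norm (w x))) \<le> ennreal V"
      using w(2) by (simp add: torus_norm_def velocity_exponent_def)
    then have "AE x in torus. norm (w x) \<le> V"
      using esssup_AE[of "\<lambda>x. ennreal (norm (w x))" torus] V
      by (auto elim!: eventually_mono dest: order_trans)
    then show ?thesis using True V by (simp, intro tail_le_bounded) auto
  next
    case False
    define q where "q = 2 / (p - 1)"
    have q: "2 \<le> q" using p False by (auto simp: q_def field_simps)
    have ve: "velocity_exponent p = ennreal q" "ennreal q \<noteq> \<infinity>" "enn2real (ennreal q) = q"
      using False p by (auto simp: velocity_exponent_def q_def)
    define I where "I = (\<integral>\<^sup>+x. ennreal (norm (w x) powr q) \<partial>torus)"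
    have "I \<noteq> \<infinity>" and le: "ennreal (enn2real I powr (1 / q)) \<le> ennreal V"
      using w(2) unfolding torus_norm_def ve(1) using ve(2,3) 
      by (auto simp: I_def Let_def top_unique split: if_splits)
    then have "I < \<infinity>" by (simp add: less_top)
    then have int: "integrable torus (\<lambda>x. norm (w x) powr q)"
      by (intro integrableI_bounded) (auto simp: I_def)
    have LI: "(LINT x|torus. norm (w x) powr q) = enn2real I"
      unfolding I_def by (rule integral_eq_nn_integral) auto
    have "enn2real I powr (1 / q) \<le> V" using le V by (simp add: ennreal_le_iff)
    then have "(enn2real I powr (1 / q)) powr q \<le> V powr q" using q by (intro powr_mono2) auto
    then have "enn2real I \<le> V powr q" using q by (simp add: powr_powr)
    then have "(LINT x|torus. norm (w x) powr q) \<le> V powr q" by (simp add: LI)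
    then show ?thesis
      by (intro tail_le_Lq[OF q _ V _ _ int]) (use False in \<open>auto simp: q_def\<close>)
  qed
qed

section \<open>The nonlinear terms\<close>

definition source :: "real \<Rightarrow> real \<Rightarrow> ('n::finite, real) L2 \<Rightarrow> ('n, real) L2" where
  "source p s u = heat s (\<lambda>x. \<bar>rep_L2 u x\<bar> powr p)"

definition transport :: "(real \<Rightarrow> real^'n \<Rightarrow> real^'n) \<Rightarrow> real \<Rightarrow> real \<Rightarrow> ('n::finite, real) L2 \<Rightarrow> ('n, real) L2" where
  "transport v s \<tau> u = heat s (\<lambda>x. v \<tau> x \<bullet> rep_L2 (grad u) x)"

definition mean :: "real \<Rightarrow> ('n::finite, real) L2 \<Rightarrow> real" where
  "mean p u = (LINT x|torus. \<bar>rep_L2 u x\<bar> powr p)"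

text \<open>The coefficients \<open>1\<close>, \<open>-1\<close>, \<open>-1\<close> give the
  equation. Setting one coefficient to 1 and the others to 0 isolates a single term, whose
  integrability then comes from the same locale.\<close>

definition nonlinearity :: "real \<Rightarrow> (real \<Rightarrow> real^'n \<Rightarrow> real^'n) \<Rightarrow> real \<Rightarrow> real \<Rightarrow> real \<Rightarrow>
    real \<Rightarrow> real \<Rightarrow> ('n::finite, real) L2 \<Rightarrow> ('n, real) L2" where
  "nonlinearity p v c d m s \<tau> u =
     c *\<^sub>R source p s u + d *\<^sub>R transport v s \<tau> u + (m * mean p u) *\<^sub>R hartley 0"

lemma norm_hartley [simp]: "norm (hartley k) = 1"
  using hartley.orthonormal[of k k] by (simp add: norm_eq_sqrt_inner)

lemma abs_L2_rep_diff:
  "square_integrable (\<lambda>x. rep_L2 u x - rep_L2 w x)" "abs_L2 (\<lambda>x. rep_L2 u x - rep_L2 w x) = u - w"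
  by (auto simp: minus_L2_def)

context
  fixes p :: real
  assumes p: "1 \<le> p" "p < 2"
begin

text \<open>For exponents below 2 the power is dominated by \<open>1 + y\<^sup>2\<close>, integrable
  on a space of finite measure.\<close>

lemma integrable_power_rep: "integrable torus (\<lambda>x. \<bar>rep_L2 u x\<bar> powr p)"
proof (rule Bochner_Integration.integrable_bound)
  show "integrable torus (\<lambda>x. 1 + (rep_L2 u x)\<^sup>2)"
    using square_integrable_rep[of u] by (simp add: square_integrable_def)
  have le: "\<bar>y\<bar> powr p \<le> 1 + y\<^sup>2" for y :: real
  proof (cases "\<bar>y\<bar> \<le> 1")
    case True
    then have "\<bar>y\<bar> powr p \<le> 1" using p by (intro powr_le1) auto
    then show ?thesis by (simp add: add_increasing2)
  next
    case False
    then have "\<bar>y\<bar> powr p \<le> \<bar>y\<bar> powr 2" using p by (intro powr_mono) auto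
    then show ?thesis using False by (simp add: powr_numeral)
  qed
  show "AE x in torus. norm (\<bar>rep_L2 u x\<bar> powr p) \<le> norm (1 + (rep_L2 u x)\<^sup>2)"
    using le by (intro AE_I2) simp
qed measurable

context
  fixes u w :: "('n::finite, real) L2" and R :: real
  assumes R: "1 \<le> R" "norm u \<le> R" "norm w \<le> R"
begin

abbreviation weight :: "real^'n \<Rightarrow> real" where
  "weight \<equiv> (\<lambda>x. p * (\<bar>rep_L2 u x\<bar> powr (p - 1) + \<bar>rep_L2 w x\<bar> powr (p - 1)))"

lemma tail_le_weight: "tail_le (real CARD('n) * (p - 1) / 4) weight (4 * p * R)"
  using tail_le_source[OF p R(1), of "rep_L2 u" "rep_L2 w"] R by auto

lemma power_rep_diff_le:
  "\<bar>\<bar>rep_L2 u x\<bar> powr p - \<bar>rep_L2 w x\<bar> powr p\<bar> \<le> weight x * norm (rep_L2 u x - rep_L2 w x)"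
proof -
  have "\<bar>\<bar>rep_L2 u x\<bar> powr p - \<bar>rep_L2 w x\<bar> powr p\<bar> \<le> weight x * \<bar>\<bar>rep_L2 u x\<bar> - \<bar>rep_L2 w x\<bar>\<bar>"
    by (rule powr_diff_le[OF p(1)]) auto
  also have "\<dots> \<le> weight x * \<bar>rep_L2 u x - rep_L2 w x\<bar>"
    using p by (intro mult_left_mono abs_triangle_ineq3) auto
  finally show ?thesis by simp
qed

text \<open>Cauchy-Schwarz, where \<open>tail_le_norm\<close> doubles the tail constant
  \<open>4 * p * R\<close> of the weight.\<close>

lemma integral_power_rep_diff_le:
  "(LINT x|torus. \<bar>\<bar>rep_L2 u x\<bar> powr p - \<bar>rep_L2 w x\<bar> powr p\<bar>) \<le> 8 * p * R * norm (u - w)"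
proof -
  note a = tail_le_norm[OF tail_le_weight]
  note m = integral_mult_le_norm_L2[OF a(1) abs_L2_rep_diff(1)[of u w]]
  have "(LINT x|torus. \<bar>\<bar>rep_L2 u x\<bar> powr p - \<bar>rep_L2 w x\<bar> powr p\<bar>) \<le>
      (LINT x|torus. weight x * norm (rep_L2 u x - rep_L2 w x))"
  proof (rule integral_mono)
    show "integrable torus (\<lambda>x. \<bar>\<bar>rep_L2 u x\<bar> powr p - \<bar>rep_L2 w x\<bar> powr p\<bar>)"
      by (intro integrable_abs Bochner_Integration.integrable_diff integrable_power_rep)
  qed (rule m(1), rule power_rep_diff_le)
  also have "\<dots> \<le> norm (abs_L2 weight) * norm (u - w)" using m(2) by (simp only: abs_L2_rep_diff)
  also have "\<dots> \<le> (2 * (4 * p * R)) * norm (u - w)" using a(2) by (rule mult_right_mono) simp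
  finally show ?thesis by simp
qed

lemma source_lipschitz:
  assumes s: "0 < s" "s \<le> 1"
  shows "norm (source p s u - source p s w) \<le>
    3 * 12 ^ CARD('n) * (4 * p * R) * s powr - (real CARD('n) * (p - 1) / 4) * norm (u - w)"
proof -
  have "source p s u - source p s w = heat s (\<lambda>x. \<bar>rep_L2 u x\<bar> powr p - \<bar>rep_L2 w x\<bar> powr p)"
    unfolding source_def by (rule heat_diff[OF integrable_power_rep integrable_power_rep s(1)])
  moreover have "norm (heat s (\<lambda>x. \<bar>rep_L2 u x\<bar> powr p - \<bar>rep_L2 w x\<bar> powr p)) \<le>
      3 * 12 ^ CARD('n) * (4 * p * R) * s powr - (real CARD('n) * (p - 1) / 4) * norm (abs_L2 (\<lambda>x. rep_L2 u x - rep_L2 w x))"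
    by (rule tail_le_heat[OF tail_le_weight s _ abs_L2_rep_diff(1)])
      (measurable, rule AE_I2, rule power_rep_diff_le)
  ultimately show ?thesis by (simp only: abs_L2_rep_diff)
qed

lemma hartley_coeff_power_lipschitz:
  "\<bar>hartley_coeff (\<lambda>x. \<bar>rep_L2 u x\<bar> powr p) k - hartley_coeff (\<lambda>x. \<bar>rep_L2 w x\<bar> powr p) k\<bar> \<le> 16 * p * R * norm (u - w)"
proof -
  have "\<bar>hartley_coeff (\<lambda>x. \<bar>rep_L2 u x\<bar> powr p - \<bar>rep_L2 w x\<bar> powr p) k\<bar> \<le>
      2 * (LINT x|torus. \<bar>\<bar>rep_L2 u x\<bar> powr p - \<bar>rep_L2 w x\<bar> powr p\<bar>)"
    by (intro abs_hartley_coeff_le Bochner_Integration.integrable_diff integrable_power_rep)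
  then show ?thesis
    using integral_power_rep_diff_le by (simp add: hartley_coeff_diff integrable_power_rep)
qed

lemma mean_lipschitz: "\<bar>mean p u - mean p w\<bar> \<le> 8 * p * R * norm (u - w)"
proof -
  have "mean p u - mean p w = (LINT x|torus. \<bar>rep_L2 u x\<bar> powr p - \<bar>rep_L2 w x\<bar> powr p)"
    unfolding mean_def by (rule Bochner_Integration.integral_diff[symmetric]) (rule integrable_power_rep)+
  then show ?thesis using order_trans[OF integral_abs_bound integral_power_rep_diff_le] by simp
qed

end

lemma mean_eq_hartley_coeff: "mean p u = hartley_coeff (\<lambda>x. \<bar>rep_L2 u x\<bar> powr p) 0"
  by (simp add: mean_def hartley_coeff_def)

lemma power_rep_zero: "AE x in torus. \<bar>rep_L2 (0 :: ('n::finite, real) L2) x\<bar> powr p = 0"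
  using rep_zero_L2 by eventually_elim simp

lemma mean_zero: "mean p 0 = 0"
  unfolding mean_def by (rule integral_eq_zero_AE[OF power_rep_zero])

lemma source_zero: "0 < s \<Longrightarrow> source p s 0 = 0"
  unfolding source_def
  by (rule heat_eqI[OF integrable_power_rep])
    (auto simp: hartley_coeff_def intro!: integral_eq_zero_AE eventually_mono[OF power_rep_zero])

text \<open>The coefficients of the power are Lipschitz on balls of \<open>L\<^sup>2\<close>. Their
  continuity along a trajectory is what measurability of source and mean rests on.\<close>

lemma continuous_on_hartley_coeff_power:
  fixes u :: "real \<Rightarrow> ('n::finite, real) L2"
  assumes u: "continuous_on S u" "\<And>t. t \<in> S \<Longrightarrow> norm (u t) \<le> R" and R: "1 \<le> R"
  shows "continuous_on S (\<lambda>t. hartley_coeff (\<lambda>x. \<bar>rep_L2 (u t) x\<bar> powr p) k)"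
proof (rule continuous_on_compose2[OF _ u(1)])
  show "continuous_on (cball 0 R) (\<lambda>w :: ('n, real) L2. hartley_coeff (\<lambda>x. \<bar>rep_L2 w x\<bar> powr p) k)"
  proof (rule lipschitz_on_continuous_on, rule lipschitz_onI)
    show "dist (hartley_coeff (\<lambda>x. \<bar>rep_L2 u x\<bar> powr p) k) (hartley_coeff (\<lambda>x. \<bar>rep_L2 w x\<bar> powr p) k)
        \<le> 16 * p * R * dist u w" if "u \<in> cball 0 R" "w \<in> cball 0 R" for u w :: "('n, real) L2"
      using hartley_coeff_power_lipschitz[OF R, of u w k] that by (simp add: dist_real_def dist_norm)
  qed (use p R in simp)
qed (use u in auto)

end

section \<open>Measurability of the Duhamel integrands\<close>

lemma borel_measurable_indicator_continuous:
  fixes f :: "real \<Rightarrow> 'b::real_normed_vector"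
  assumes "continuous_on {0..T} f" "t \<le> T"
  shows "(\<lambda>\<tau>. indicator {0<..<t} \<tau> *\<^sub>R f \<tau>) \<in> borel_measurable lebesgue"
proof -
  have "(\<lambda>\<tau>. indicator {0<..<t} \<tau> *\<^sub>R f \<tau>) \<in> borel_measurable borel"
    by (rule borel_measurable_continuous_on_indicator) (auto intro: continuous_on_subset[OF assms(1)] simp: assms(2) less_le_trans[OF _ assms(2)] less_imp_le)
  then show ?thesis by (simp add: measurable_completion)
qed

lemma measurable_source_history:
  fixes u :: "real \<Rightarrow> ('n::finite, real) L2"
  assumes p: "1 \<le> p" "p < 2" and u: "x_ball T R u" and t: "t \<le> T"
  shows "(\<lambda>\<tau>. indicator {0<..<t} \<tau> *\<^sub>R source p (t - \<tau>) (u \<tau>)) \<in> borel_measurable lebesgue"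
    and "(\<lambda>\<tau>. indicator {0<..<t} \<tau> *\<^sub>R mean p (u \<tau>)) \<in> borel_measurable lebesgue"
proof -
  have c: "continuous_on {0..T} (\<lambda>\<tau>. hartley_coeff (\<lambda>x. \<bar>rep_L2 (u \<tau>) x\<bar> powr p) k)" for k
    by (rule continuous_on_hartley_coeff_power[OF p, of _ _ "max 1 R"])
      (use u in \<open>auto simp: x_ball_def le_max_iff_disj\<close>)
  show "(\<lambda>\<tau>. indicator {0<..<t} \<tau> *\<^sub>R mean p (u \<tau>)) \<in> borel_measurable lebesgue"
    unfolding mean_eq_hartley_coeff[OF p] by (rule borel_measurable_indicator_continuous[OF c t])
  show "(\<lambda>\<tau>. indicator {0<..<t} \<tau> *\<^sub>R source p (t - \<tau>) (u \<tau>)) \<in> borel_measurable lebesgue"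
  proof (rule hartley.borel_measurable_coordinates)
    fix k
    have "(\<lambda>\<tau>. indicator {0<..<t} \<tau> *\<^sub>R (exp (- (t - \<tau>) * lam k) * hartley_coeff (\<lambda>x. \<bar>rep_L2 (u \<tau>) x\<bar> powr p) k))
        \<in> borel_measurable lebesgue"
      by (intro borel_measurable_indicator_continuous[OF _ t] continuous_intros c)
    moreover have "(indicator {0<..<t} \<tau> *\<^sub>R source p (t - \<tau>) (u \<tau>)) \<bullet> hartley k =
        indicator {0<..<t} \<tau> *\<^sub>R (exp (- (t - \<tau>) * lam k) * hartley_coeff (\<lambda>x. \<bar>rep_L2 (u \<tau>) x\<bar> powr p) k)" for \<tau>
      by (cases "\<tau> \<in> {0<..<t}") (auto simp: source_def inner_heat[OF integrable_power_rep[OF p]])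
    ultimately show "(\<lambda>\<tau>. (indicator {0<..<t} \<tau> *\<^sub>R source p (t - \<tau>) (u \<tau>)) \<bullet> hartley k) \<in> borel_measurable lebesgue"
      by (simp only:)
  qed
qed

text \<open>Continuity of the gradient in time is not assumed, but each of its coefficients is a
  constant multiple of a coefficient of \<open>u \<tau>\<close> and hence continuous.\<close>

lemma measurable_component_grad:
  fixes u :: "real \<Rightarrow> ('n::finite, real) L2"
  assumes u: "x_ball T R u" and t: "t \<le> T"
  shows "(\<lambda>\<tau>. indicator {0<..<t} \<tau> *\<^sub>R component i (grad (u \<tau>))) \<in> borel_measurable lebesgue"
proof (rule hartley.borel_measurable_coordinates)
  fix k
  have "continuous_on {0..T} u" using u by (simp add: x_ball_def)
  then have "(\<lambda>\<tau>. indicator {0<..<t} \<tau> *\<^sub>R (- 2 * pi * of_int (k $ i) * (u \<tau> \<bullet> hartley (- k)))) \<in> borel_measurable lebesgue"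
    by (intro borel_measurable_indicator_continuous[OF _ t] continuous_intros)
  moreover have "(indicator {0<..<t} \<tau> *\<^sub>R component i (grad (u \<tau>))) \<bullet> hartley k =
      indicator {0<..<t} \<tau> *\<^sub>R (- 2 * pi * of_int (k $ i) * (u \<tau> \<bullet> hartley (- k)))" for \<tau>
  proof (cases "\<tau> \<in> {0<..<t}")
    case True
    then have "grad_le (u \<tau>) (R / sqrt \<tau>)" using u t by (auto simp: x_ball_def)
    then show ?thesis by (simp add: grad_coefficient)
  qed simp
  ultimately show "(\<lambda>\<tau>. (indicator {0<..<t} \<tau> *\<^sub>R component i (grad (u \<tau>))) \<bullet> hartley k) \<in> borel_measurable lebesgue"
    by simp
qed

lemma torus_norm_imp_L2:
  fixes w :: "real^'n \<Rightarrow> real^'m"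
  assumes p: "1 \<le> p" "p < 2" and V: "0 < V"
    and w: "w \<in> borel_measurable torus" "torus_norm (velocity_exponent p) w \<le> ennreal V"
  shows "square_integrable w" "norm (abs_L2 w) \<le> 2 * V"
proof -
  note n = tail_le_norm[OF tail_le_velocity[OF assms]]
  show si: "square_integrable w"
    by (rule square_integrable_bound[OF n(1) w(1)]) auto
  show "norm (abs_L2 w) \<le> 2 * V" using n(2) by (simp add: square_integrable_norm[OF si])
qed

text \<open>Moving the factor \<open>cas k\<close> onto the velocity writes the \<open>k\<close>th
  coefficient of a pointwise inner product as a finite sum of inner products in
  \<open>L\<^sup>2\<close>, into which limits of the velocity can be taken.\<close>

definition modulate :: "int^'n \<Rightarrow> 'm \<Rightarrow> (real^'n \<Rightarrow> real^'m) \<Rightarrow> ('n::finite, real) L2" where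
  "modulate k i w = abs_L2 (\<lambda>x. w x $ i * cas k x)"

lemma modulate_bound:
  assumes w: "square_integrable w"
  shows "square_integrable (\<lambda>x. w x $ i * cas k x)" "norm (modulate k i w) \<le> 2 * norm (abs_L2 w)"
proof -
  have [measurable]: "(\<lambda>x. w x $ i) \<in> borel_measurable torus"
    using square_integrable_vec_nth[OF w, of i] by (simp add: square_integrable_def)
  have "\<bar>w x $ i * cas k x\<bar> \<le> norm (w x) * 2" for x
    unfolding abs_mult by (intro mult_mono component_le_norm_cart abs_cas_le) auto
  then have le: "AE x in torus. norm (w x $ i * cas k x) \<le> 2 * norm (w x)"
    by (intro AE_I2) (simp add: mult.commute)
  show "square_integrable (\<lambda>x. w x $ i * cas k x)" "norm (modulate k i w) \<le> 2 * norm (abs_L2 w)"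
    using norm_abs_L2_le[OF _ w _ le] by (auto simp: modulate_def)
qed

lemma modulate_diff:
  assumes "square_integrable w" "square_integrable z"
  shows "modulate k i w - modulate k i z = modulate k i (\<lambda>x. w x - z x)"
  unfolding modulate_def
  by (subst minus_abs_L2) (simp_all add: modulate_bound(1)[OF assms(1)] modulate_bound(1)[OF assms(2)] left_diff_distrib)

lemma integrable_inner_L2:
  "square_integrable w \<Longrightarrow> integrable torus (\<lambda>x. w x \<bullet> rep_L2 g x)"
  by auto

lemma hartley_coeff_inner:
  fixes w :: "real^'n \<Rightarrow> real^'m" and g :: "('n::finite, real^'m) L2"
  assumes w: "square_integrable w"
  shows "hartley_coeff (\<lambda>x. w x \<bullet> rep_L2 g x) k = (\<Sum>i\<in>UNIV. modulate k i w \<bullet> component i g)"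
proof -
  have eq: "modulate k i w \<bullet> component i g = (LINT x|torus. w x $ i * cas k x * rep_L2 g x $ i)" for i
    unfolding modulate_def component_def by (subst inner_abs_L2') (auto simp: modulate_bound[OF w])
  have int: "integrable torus (\<lambda>x. w x $ i * cas k x * rep_L2 g x $ i)" for i
    using square_integrable_inner[OF modulate_bound(1)[OF w, of i k] square_integrable_vec_nth[OF square_integrable_rep, of g i]] by simp
  have "(w x \<bullet> rep_L2 g x) * cas k x = (\<Sum>i\<in>UNIV. w x $ i * cas k x * rep_L2 g x $ i)" for x
    by (simp add: inner_vec_def sum_distrib_left mult_ac)
  then show ?thesis unfolding hartley_coeff_def eq using int by simp
qed

text \<open>Strong measurability supplies simple functions \<open>s j\<close> of time whose
  modulated components are measurable. Their convergence in \<open>L\<^sup>q\<close> implies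
  convergence in \<open>L\<^sup>2\<close>, so the coefficients of the transport term are limits, for
  almost every time, of inner products with the gradient components.\<close>

lemma measurable_transport_history:
  fixes u :: "real \<Rightarrow> ('n::finite, real) L2" and v :: "real \<Rightarrow> real^'n \<Rightarrow> real^'n"
  assumes p: "1 \<le> p" "p < 2" and u: "x_ball T R u" and t: "t \<le> T"
    and v: "strongly_measurable_Lq (velocity_exponent p) v"
    and good: "AE \<tau> in lebesgue. 0 < \<tau> \<longrightarrow> v \<tau> \<in> borel_measurable torus \<and> square_integrable (v \<tau>)"
  shows "(\<lambda>\<tau>. indicator {0<..<t} \<tau> *\<^sub>R transport v (t - \<tau>) \<tau> (u \<tau>)) \<in> borel_measurable lebesgue"
proof (rule hartley.borel_measurable_coordinates)
  fix k
  obtain s where s: "\<And>j. simple_function (lebesgue_on {0<..}) (s j)" "\<And>j \<tau>. 0 < \<tau> \<Longrightarrow> in_Lq (velocity_exponent p) (s j \<tau>)"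
    "AE \<tau> in lebesgue_on {0<..}. (\<lambda>j. torus_norm (velocity_exponent p) (\<lambda>x. s j \<tau> x - v \<tau> x)) \<longlonglongrightarrow> 0"
    using v unfolding strongly_measurable_Lq_def by blast
  define G where "G i \<tau> = indicator {0<..<t} \<tau> *\<^sub>R component i (grad (u \<tau>))" for i \<tau>
  have [measurable]: "G i \<in> borel_measurable lebesgue" for i
    unfolding G_def by (rule measurable_component_grad[OF u t])
  define W where "W j i \<tau> = indicator {0<..} \<tau> *\<^sub>R modulate k i (s j \<tau>)" for j i \<tau>
  have [measurable]: "W j i \<in> borel_measurable lebesgue" for j i
  proof -
    have "(\<lambda>\<tau>. modulate k i (s j \<tau>)) \<in> borel_measurable (lebesgue_on {0<..})"
      by (rule measurable_compose[OF measurable_simple_function[OF s(1)]]) simp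
    then show ?thesis unfolding W_def by (subst (asm) borel_measurable_restrict_space_iff) auto
  qed
  define S where "S j \<tau> = (\<Sum>i\<in>UNIV. W j i \<tau> \<bullet> G i \<tau>)" for j \<tau>
  have [measurable]: "S j \<in> borel_measurable lebesgue" for j
    unfolding S_def by measurable
  \<comment> \<open>\<open>lim\<close> has a value at every time and is measurable in time; it
    agrees with the wanted coefficient wherever the sequence converges to it, hence almost
    everywhere.\<close>
  define F where "F \<tau> = exp (- (t - \<tau>) * lam k) * lim (\<lambda>j. S j \<tau>)" for \<tau>
  have "(\<lambda>\<tau>. lim (\<lambda>j. S j \<tau>)) \<in> borel_measurable lebesgue" by measurable
  moreover have "(\<lambda>\<tau>. exp (- (t - \<tau>) * lam k)) \<in> borel_measurable lebesgue"
  proof -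
    have "(\<lambda>\<tau>. exp (- (t - \<tau>) * lam k)) \<in> borel_measurable borel"
      by (intro borel_measurable_continuous_onI continuous_intros)
    then show ?thesis by (simp add: measurable_completion)
  qed
  ultimately have F: "F \<in> borel_measurable lebesgue"
    unfolding F_def by (rule borel_measurable_times[rotated])
  show "(\<lambda>\<tau>. (indicator {0<..<t} \<tau> *\<^sub>R transport v (t - \<tau>) \<tau> (u \<tau>)) \<bullet> hartley k) \<in> borel_measurable lebesgue"
  proof (rule borel_measurable_AE[OF F])
    have "AE \<tau> in lebesgue. 0 < \<tau> \<longrightarrow> (\<lambda>j. torus_norm (velocity_exponent p) (\<lambda>x. s j \<tau> x - v \<tau> x)) \<longlonglongrightarrow> 0"
      using s(3) by (subst (asm) AE_restrict_space_iff) auto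
    then show "AE \<tau> in lebesgue. F \<tau> = (indicator {0<..<t} \<tau> *\<^sub>R transport v (t - \<tau>) \<tau> (u \<tau>)) \<bullet> hartley k"
      using good
    proof eventually_elim
      case (elim \<tau>)
      show ?case
      proof (cases "\<tau> \<in> {0<..<t}")
        case False
        then have "S j \<tau> = 0" for j by (simp add: S_def G_def)
        then have "F \<tau> = 0" by (simp add: F_def)
        then show ?thesis using False by simp
      next
        case True
        then have \<tau>: "0 < \<tau>" "\<tau> < t" by auto
        have vm: "v \<tau> \<in> borel_measurable torus" and v2: "square_integrable (v \<tau>)" using elim(2) \<tau> by auto
        have sm: "s j \<tau> \<in> borel_measurable torus" for j using s(2)[OF \<tau>(1)] by (simp add: in_Lq_def)
        have lim: "(\<lambda>j. W j i \<tau>) \<longlonglongrightarrow> modulate k i (v \<tau>)" for i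
        proof (rule metric_LIMSEQ_I)
          fix r :: real assume r: "0 < r"
          \<comment> \<open>The passage to \<open>L\<^sup>2\<close> and the factor
            \<open>cas k\<close> cost 2 each, and \<open>4 * (r / 5) < r\<close>.\<close>
          have "\<forall>\<^sub>F j in sequentially. torus_norm (velocity_exponent p) (\<lambda>x. s j \<tau> x - v \<tau> x) < ennreal (r / 5)"
            using elim(1) \<tau> r by (intro order_tendstoD(2)) auto
          then obtain m where m: "\<And>j. j \<ge> m \<Longrightarrow> torus_norm (velocity_exponent p) (\<lambda>x. s j \<tau> x - v \<tau> x) < ennreal (r / 5)"
            unfolding eventually_sequentially by blast
          have "dist (W j i \<tau>) (modulate k i (v \<tau>)) < r" if "j \<ge> m" for j
          proof -
            have d: "square_integrable (\<lambda>x. s j \<tau> x - v \<tau> x)" "norm (abs_L2 (\<lambda>x. s j \<tau> x - v \<tau> x)) \<le> 2 * (r / 5)"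
              by (rule torus_norm_imp_L2[OF p]; use r sm vm m[OF that] in \<open>auto intro: less_imp_le\<close>)+
            have s2: "square_integrable (s j \<tau>)" using square_integrable_add[OF d(1) v2] by simp
            have "dist (W j i \<tau>) (modulate k i (v \<tau>)) = norm (modulate k i (\<lambda>x. s j \<tau> x - v \<tau> x))"
              using \<tau> by (simp add: W_def dist_norm modulate_diff[OF s2 v2])
            also have "\<dots> \<le> 2 * (2 * (r / 5))" using modulate_bound(2)[OF d(1), of k i] d(2) by linarith
            also have "\<dots> < r" using r by simp
            finally show ?thesis .
          qed
          then show "\<exists>m. \<forall>j\<ge>m. dist (W j i \<tau>) (modulate k i (v \<tau>)) < r" by blast
        qed
        have "(\<lambda>j. S j \<tau>) \<longlonglongrightarrow> (\<Sum>i\<in>UNIV. modulate k i (v \<tau>) \<bullet> G i \<tau>)"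
          unfolding S_def by (intro tendsto_sum tendsto_inner lim tendsto_const)
        then have "lim (\<lambda>j. S j \<tau>) = (\<Sum>i\<in>UNIV. modulate k i (v \<tau>) \<bullet> component i (grad (u \<tau>)))"
          using True by (simp add: limI G_def)
        then have "F \<tau> = exp (- (t - \<tau>) * lam k) * hartley_coeff (\<lambda>x. v \<tau> x \<bullet> rep_L2 (grad (u \<tau>)) x) k"
          by (simp add: F_def hartley_coeff_inner[OF v2])
        then show ?thesis
          using True \<tau> by (simp add: transport_def inner_heat[OF integrable_inner_L2[OF v2]])
      qed
    qed
  qed
qed

section \<open>Estimates for the transport term and the full nonlinearity\<close>

lemma transport_zero:
  fixes v :: "real \<Rightarrow> real^'n::finite \<Rightarrow> real^'n"
  assumes "square_integrable (v \<tau>)" "0 < s"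
  shows "transport v s \<tau> 0 = 0"
proof -
  have "grad (0 :: ('n, real) L2) = 0"
    using grad_le_iff[of "0 :: ('n, real) L2" 0] by simp
  then have z: "AE x in torus. v \<tau> x \<bullet> rep_L2 (grad (0 :: ('n, real) L2)) x = 0"
    using rep_zero_L2[where 'a = 'n and 'b = "real^'n"] by (auto elim: eventually_mono)
  show ?thesis
    unfolding transport_def
    by (rule heat_eqI[OF integrable_inner_L2[OF assms(1)]])
      (auto simp: hartley_coeff_def intro!: integral_eq_zero_AE eventually_mono[OF z])
qed

text \<open>The transport term is linear in the state, so only the bound \<open>B\<close> for
  \<open>u - w\<close> enters the result; \<open>G\<close> and \<open>G'\<close> merely guarantee
  the two gradients.\<close>

lemma transport_lipschitz:
  fixes u w :: "('n::finite, real) L2" and v :: "real \<Rightarrow> real^'n \<Rightarrow> real^'n"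
  assumes v: "tail_le \<alpha> (\<lambda>x. norm (v \<tau> x)) V" "square_integrable (v \<tau>)" and s: "0 < s" "s \<le> 1"
    and g: "grad_le u G" "grad_le w G'" "grad_le (u - w) B"
  shows "norm (transport v s \<tau> u - transport v s \<tau> w) \<le> 3 * 12 ^ CARD('n) * V * s powr - \<alpha> * B"
proof -
  let ?f = "\<lambda>x. v \<tau> x \<bullet> rep_L2 (grad (u - w)) x"
  have "transport v s \<tau> u - transport v s \<tau> w = heat s (\<lambda>x. v \<tau> x \<bullet> rep_L2 (grad u) x - v \<tau> x \<bullet> rep_L2 (grad w) x)"
    unfolding transport_def by (rule heat_diff[OF integrable_inner_L2[OF v(2)] integrable_inner_L2[OF v(2)] s(1)])
  also have "\<dots> = heat s ?f"
  proof (rule heat_cong_AE[OF _ _ s(1)])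
    show "AE x in torus. v \<tau> x \<bullet> rep_L2 (grad u) x - v \<tau> x \<bullet> rep_L2 (grad w) x = ?f x"
      using rep_minus_L2[of "grad u" "grad w"] unfolding grad_diff[OF g(1,2)]
      by eventually_elim (simp add: inner_diff_right)
  qed (intro Bochner_Integration.integrable_diff integrable_inner_L2 v(2))+
  also have "norm \<dots> \<le> 3 * 12 ^ CARD('n) * V * s powr - \<alpha> * norm (abs_L2 (rep_L2 (grad (u - w))))"
  proof (rule tail_le_heat[OF v(1) s _ square_integrable_rep])
    show "?f \<in> borel_measurable torus" by (rule borel_measurable_integrable[OF integrable_inner_L2[OF v(2)]])
    show "AE x in torus. \<bar>?f x\<bar> \<le> norm (v \<tau> x) * norm (rep_L2 (grad (u - w)) x)"
      by (intro AE_I2 Cauchy_Schwarz_ineq2)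
  qed
  also have "\<dots> \<le> 3 * 12 ^ CARD('n) * V * s powr - \<alpha> * B"
    using g(3) v(1) by (intro mult_left_mono) (auto simp: grad_le_iff tail_le_def)
  finally show ?thesis .
qed

lemma heat_hartley_0:
  assumes "0 \<le> r"
  shows "heat r (rep_L2 (hartley 0)) = hartley 0"
  by (rule heat_rep_eqI[OF assms]) (simp add: hartley.orthonormal)

text \<open>The constant collects \<open>4 * p * R\<close> from the source, \<open>8 * p * R\<close>
  from the mean and \<open>V\<close> from transport. The source lacks the singularity in
  \<open>\<tau>\<close> and the mean lacks both; the missing factors are at least 1 because
  \<open>s\<close> and \<open>\<tau>\<close> are at most 1. The absolute value keeps the constant
  nonnegative for every real \<open>R\<close>, as the locale demands.\<close>

lemma duhamel_nonlinearity:
  fixes v :: "real \<Rightarrow> real^'n::finite \<Rightarrow> real^'n"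
  assumes p: "1 \<le> p" "p < 2" "real CARD('n) * (p - 1) / 4 < 1/2" and V: "0 < V"
    and v: "strongly_measurable_Lq (velocity_exponent p) v"
    and good: "AE \<tau> in lebesgue. 0 < \<tau> \<longrightarrow> v \<tau> \<in> borel_measurable torus \<and> torus_norm (velocity_exponent p) (v \<tau>) \<le> ennreal V"
    and c: "\<bar>c\<bar> \<le> 1" "\<bar>d\<bar> \<le> 1" "\<bar>m\<bar> \<le> 1"
  shows "duhamel (nonlinearity p v c d m) (real CARD('n) * (p - 1) / 4) (\<lambda>R. 3 * 12 ^ CARD('n) * (12 * p * \<bar>R\<bar> + V))"
proof
  let ?\<alpha> = "real CARD('n) * (p - 1) / 4"
  let ?K = "3 * 12 ^ CARD('n) :: real"
  have good': "AE \<tau> in lebesgue. 0 < \<tau> \<longrightarrow> v \<tau> \<in> borel_measurable torus \<and> square_integrable (v \<tau>)"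
    using good by eventually_elim (auto intro: torus_norm_imp_L2[OF p(1,2) V])
  show "0 \<le> ?\<alpha>" "?\<alpha> < 1/2" using p by auto
  show "0 \<le> ?K * (12 * p * \<bar>R\<bar> + V)" for R using p V by simp
  show "AE \<tau> in lebesgue. 0 < \<tau> \<longrightarrow> (\<forall>s>0. nonlinearity p v c d m s \<tau> 0 = 0)"
    using good' by eventually_elim
      (auto simp: nonlinearity_def source_zero[OF p(1,2)] transport_zero mean_zero[OF p(1,2)])
  show "AE \<tau> in lebesgue. 0 < \<tau> \<longrightarrow> (\<forall>r s x G. 0 \<le> r \<and> 0 < s \<and> grad_le x G \<longrightarrow>
      heat r (rep_L2 (nonlinearity p v c d m s \<tau> x)) = nonlinearity p v c d m (r + s) \<tau> x)"
    using good'
  proof eventually_elim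
    case (elim \<tau>)
    show ?case
    proof (intro impI allI, elim conjE)
      fix r s G :: real and x :: "('n, real) L2" assume \<tau>: "0 < \<tau>" and r: "0 \<le> r" and s: "0 < s"
      note lin = bounded_linear.linear[OF bounded_linear_heat_rep[OF r]]
      have v2: "square_integrable (v \<tau>)" using elim \<tau> by blast
      have "heat r (rep_L2 (nonlinearity p v c d m s \<tau> x)) =
          c *\<^sub>R heat r (rep_L2 (source p s x)) + d *\<^sub>R heat r (rep_L2 (transport v s \<tau> x)) + (m * mean p x) *\<^sub>R heat r (rep_L2 (hartley 0))"
        unfolding nonlinearity_def by (simp only: linear_add[OF lin] linear_cmul[OF lin])
      then show "heat r (rep_L2 (nonlinearity p v c d m s \<tau> x)) = nonlinearity p v c d m (r + s) \<tau> x"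
        unfolding nonlinearity_def source_def transport_def
        by (simp only: heat_semigroup[OF integrable_power_rep[OF p(1,2)] r s]
          heat_semigroup[OF integrable_inner_L2[OF v2] r s] heat_hartley_0[OF r])
    qed
  qed
  show "(\<lambda>\<tau>. indicator {0<..<t} \<tau> *\<^sub>R nonlinearity p v c d m (t - \<tau>) \<tau> (u \<tau>)) \<in> borel_measurable lebesgue"
    if u: "x_ball T R u" and t: "t \<le> T" for T R u t
  proof -
    have "(\<lambda>\<tau>. c *\<^sub>R (indicator {0<..<t} \<tau> *\<^sub>R source p (t - \<tau>) (u \<tau>)) +
        d *\<^sub>R (indicator {0<..<t} \<tau> *\<^sub>R transport v (t - \<tau>) \<tau> (u \<tau>)) +
        (m * (indicator {0<..<t} \<tau> *\<^sub>R mean p (u \<tau>))) *\<^sub>R hartley 0) \<in> borel_measurable lebesgue"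
      by (intro borel_measurable_add borel_measurable_scaleR borel_measurable_times borel_measurable_const
        measurable_source_history[OF p(1,2) u t] measurable_transport_history[OF p(1,2) u t v good'])
    moreover have "(\<lambda>\<tau>. c *\<^sub>R (indicator {0<..<t} \<tau> *\<^sub>R source p (t - \<tau>) (u \<tau>)) +
        d *\<^sub>R (indicator {0<..<t} \<tau> *\<^sub>R transport v (t - \<tau>) \<tau> (u \<tau>)) +
        (m * (indicator {0<..<t} \<tau> *\<^sub>R mean p (u \<tau>))) *\<^sub>R hartley 0) =
        (\<lambda>\<tau>. indicator {0<..<t} \<tau> *\<^sub>R nonlinearity p v c d m (t - \<tau>) \<tau> (u \<tau>))"
      by (auto simp: nonlinearity_def indicator_def)
    ultimately show ?thesis by (simp only:)
  qed
  show "AE \<tau> in lebesgue. 0 < \<tau> \<and> \<tau> \<le> 1 \<longrightarrow> (\<forall>s R G x y D. 0 < s \<and> s \<le> 1 \<and> 1 \<le> R \<and>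
      norm x \<le> R \<and> norm y \<le> R \<and> grad_le x G \<and> grad_le y G \<and> norm (x - y) \<le> D \<and> grad_le (x - y) (D / sqrt \<tau>) \<longrightarrow>
      norm (nonlinearity p v c d m s \<tau> x - nonlinearity p v c d m s \<tau> y) \<le>
        ?K * (12 * p * \<bar>R\<bar> + V) * D * (s powr - ?\<alpha> * \<tau> powr (-1/2)))"
    using good
  proof eventually_elim
    case (elim \<tau>)
    show ?case
    proof (intro impI allI, elim conjE)
      fix s R G D :: real and x y :: "('n, real) L2"
      assume \<tau>: "0 < \<tau>" "\<tau> \<le> 1" and s: "0 < s" "s \<le> 1" and R: "1 \<le> R" "norm x \<le> R" "norm y \<le> R"
        and G: "grad_le x G" "grad_le y G" and D: "norm (x - y) \<le> D" "grad_le (x - y) (D / sqrt \<tau>)"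
      define S where "S = s powr - ?\<alpha>"
      define h where "h = \<tau> powr (-1/2)"
      have D0: "0 \<le> D" by (rule order_trans[OF norm_ge_zero D(1)])
      have S: "1 \<le> S"
        using powr_mono2'[of "- ?\<alpha>" s 1] s p by (simp add: S_def)
      have h: "1 \<le> h" using powr_mono2'[of "-1/2" \<tau> 1] \<tau> by (simp add: h_def)
      have hs: "D / sqrt \<tau> = h * D"
        using \<tau> by (simp add: h_def powr_minus_divide powr_half_sqrt)
      have w: "v \<tau> \<in> borel_measurable torus" "torus_norm (velocity_exponent p) (v \<tau>) \<le> ennreal V"
        using elim \<tau> by auto
      have 1: "norm (source p s x - source p s y) \<le> ?K * (4 * p * R) * S * (h * D)"
      proof -
        have "norm (source p s x - source p s y) \<le> ?K * (4 * p * R) * S * norm (x - y)"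
          unfolding S_def by (rule source_lipschitz[OF p(1,2) R s])
        also have "\<dots> \<le> ?K * (4 * p * R) * S * (h * D)"
          using p R S D(1) mult_right_mono[OF h D0] by (intro mult_left_mono) auto
        finally show ?thesis .
      qed
      have 2: "norm (transport v s \<tau> x - transport v s \<tau> y) \<le> ?K * V * S * (h * D)"
        unfolding S_def hs[symmetric]
        by (rule transport_lipschitz[where v = v and \<tau> = \<tau>, OF tail_le_velocity[OF p(1,2) V w] torus_norm_imp_L2(1)[OF p(1,2) V w] s G D(2)])
      have 3: "\<bar>mean p x - mean p y\<bar> \<le> ?K * (8 * p * R) * S * (h * D)"
      proof -
        have "\<bar>mean p x - mean p y\<bar> \<le> (8 * p * R) * norm (x - y)"
          using mean_lipschitz[OF p(1,2) R] by simp
        also have "\<dots> \<le> (8 * p * R) * (h * D)"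
          using p R D(1) mult_right_mono[OF h D0] by (intro mult_left_mono) auto
        also have "\<dots> = 1 * 1 * ((8 * p * R) * (h * D))" by simp
        also have "\<dots> \<le> ?K * S * ((8 * p * R) * (h * D))"
        proof (intro mult_right_mono mult_mono)
          have "(1 :: real) \<le> 12 ^ CARD('n)" by (rule one_le_power) simp
          then show "1 \<le> ?K" by linarith
        qed (use S p R h D0 in auto)
        finally show ?thesis by (simp add: mult_ac)
      qed
      have mean_le: "norm ((mean p x - mean p y) *\<^sub>R (hartley 0 :: ('n, real) L2)) \<le> ?K * (8 * p * R) * S * (h * D)"
        using 3 by simp
      have scale: "norm (a *\<^sub>R z) \<le> B" if "\<bar>a\<bar> \<le> 1" "norm z \<le> B" for a B and z :: "('n, real) L2"
        using mult_left_le_one_le[of "norm z" "\<bar>a\<bar>"] that by simp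
      have "nonlinearity p v c d m s \<tau> x - nonlinearity p v c d m s \<tau> y =
          c *\<^sub>R (source p s x - source p s y) + d *\<^sub>R (transport v s \<tau> x - transport v s \<tau> y)
          + m *\<^sub>R ((mean p x - mean p y) *\<^sub>R hartley 0)"
        by (simp add: nonlinearity_def algebra_simps)
      also have "norm \<dots> \<le> ?K * (4 * p * R) * S * (h * D) + ?K * V * S * (h * D) + ?K * (8 * p * R) * S * (h * D)"
        by (intro norm_triangle_mono scale[OF c(1) 1] scale[OF c(2) 2] scale[OF c(3) mean_le])
      also have "\<dots> = ?K * (12 * p * \<bar>R\<bar> + V) * D * (S * h)"
        using R by (simp add: algebra_simps)
      finally show "norm (nonlinearity p v c d m s \<tau> x - nonlinearity p v c d m s \<tau> y) \<le>
          ?K * (12 * p * \<bar>R\<bar> + V) * D * (s powr - ?\<alpha> * \<tau> powr (-1/2))"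
        by (simp add: S_def h_def)
    qed
  qed
qed

section \<open>Mild solutions in \<open>X_T\<close>\<close>

lemma x_ball_imp_X_space:
  assumes "x_ball T R u"
  shows "u \<in> X_space T"
proof -
  have "sqrt t * norm (grad (u t)) \<le> R" if "t \<in> {0<..T}" for t
  proof -
    have "norm (grad (u t)) \<le> R / sqrt t" using assms that by (auto simp: x_ball_def grad_le_iff)
    then show ?thesis using that by (simp add: pos_le_divide_eq mult.commute)
  qed
  then have "bdd_above ((\<lambda>t. sqrt t * norm (grad (u t))) ` {0<..T})" by (rule bdd_aboveI2)
  then show ?thesis using assms by (auto simp: X_space_def x_ball_def grad_le_iff)
qed

text \<open>Compactness of the time interval bounds the norm. The radius is raised to at least 1
  because the Lipschitz bound of the locale is stated for \<open>1 \<le> R\<close>.\<close>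

lemma X_space_imp_x_ball:
  assumes "u \<in> X_space T"
  obtains R where "1 \<le> R" "x_ball T R u"
proof -
  have c: "continuous_on {0..T} u" and g: "\<And>t. t \<in> {0<..T} \<Longrightarrow> \<exists>g. has_weak_gradient (u t) g"
    and b: "bdd_above ((\<lambda>t. sqrt t * norm (grad (u t))) ` {0<..T})"
    using assms by (auto simp: X_space_def)
  have "bounded (u ` {0..T})" by (intro compact_imp_bounded compact_continuous_image c) simp
  then obtain R1 where "\<forall>x\<in>u ` {0..T}. norm x \<le> R1" unfolding bounded_iff by blast
  then have R1: "norm (u t) \<le> R1" if "t \<in> {0..T}" for t using that by blast
  obtain R2 where "\<forall>x\<in>(\<lambda>t. sqrt t * norm (grad (u t))) ` {0<..T}. x \<le> R2"
    using b unfolding bdd_above_def by blast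
  then have R2: "sqrt t * norm (grad (u t)) \<le> R2" if "t \<in> {0<..T}" for t using that by blast
  define R where "R = max 1 (max R1 R2)"
  have "grad_le (u t) (R / sqrt t)" if t: "t \<in> {0<..T}" for t
  proof -
    have "sqrt t * norm (grad (u t)) \<le> R" using R2[OF t] by (simp add: R_def)
    then have "norm (grad (u t)) \<le> R / sqrt t" using t by (simp add: pos_le_divide_eq mult.commute)
    then show ?thesis using g[OF t] by (simp add: grad_le_iff)
  qed
  moreover have "norm (u t) \<le> R" if "t \<in> {0..T}" for t
    using R1[OF that] by (simp add: R_def)
  ultimately have "x_ball T R u" using c by (simp add: x_ball_def)
  then show ?thesis by (intro that[of R]) (simp_all add: R_def)
qed

text \<open>In a ball the integrability clauses hold automatically, by \<open>history_bounds\<close>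
  for the instances that isolate one term each, and what remains is the fixed point equation. The
  scalar mean is recovered from its multiple of \<open>hartley 0\<close> by an inner
  product.\<close>

lemma mild_solution_iff:
  fixes v :: "real \<Rightarrow> real^'n::finite \<Rightarrow> real^'n" and u0 :: "('n, real) L2"
  assumes p: "1 \<le> p" "p < 2" "real CARD('n) * (p - 1) / 4 < 1/2" and V: "0 < V"
    and v: "strongly_measurable_Lq (velocity_exponent p) v"
    and good: "AE \<tau> in lebesgue. 0 < \<tau> \<longrightarrow> v \<tau> \<in> borel_measurable torus \<and> torus_norm (velocity_exponent p) (v \<tau>) \<le> ennreal V"
    and T: "T \<le> 1" and R: "1 \<le> R" and u: "x_ball T R u"
  shows "mild_solution p v u0 T u \<longleftrightarrow> (\<forall>t\<in>{0..T}. u t = duhamel.Phi (nonlinearity p v 1 (-1) (-1)) u0 u t)"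
proof -
  note inst = duhamel_nonlinearity[OF p V v good]
  interpret D: duhamel "nonlinearity p v 1 (-1) (-1)" "real CARD('n) * (p - 1) / 4" "\<lambda>R. 3 * 12 ^ CARD('n) * (12 * p * \<bar>R\<bar> + V)"
    by (rule inst) auto
  interpret S: duhamel "nonlinearity p v 1 0 0" "real CARD('n) * (p - 1) / 4" "\<lambda>R. 3 * 12 ^ CARD('n) * (12 * p * \<bar>R\<bar> + V)"
    by (rule inst) auto
  interpret G: duhamel "nonlinearity p v 0 1 0" "real CARD('n) * (p - 1) / 4" "\<lambda>R. 3 * 12 ^ CARD('n) * (12 * p * \<bar>R\<bar> + V)"
    by (rule inst) auto
  interpret M: duhamel "nonlinearity p v 0 0 1" "real CARD('n) * (p - 1) / 4" "\<lambda>R. 3 * 12 ^ CARD('n) * (12 * p * \<bar>R\<bar> + V)"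
    by (rule inst) auto
  have eq: "nonlinearity p v 1 0 0 s \<tau> w = source p s w" "nonlinearity p v 0 1 0 s \<tau> w = transport v s \<tau> w"
    "nonlinearity p v 0 0 1 s \<tau> w = mean p w *\<^sub>R hartley 0" for s \<tau> w
    by (simp_all add: nonlinearity_def)
  have *: "set_integrable lebesgue {0<..<t} (\<lambda>\<tau>. source p (t - \<tau>) (u \<tau>)) \<and>
      set_integrable lebesgue {0<..<t} (\<lambda>\<tau>. transport v (t - \<tau>) \<tau> (u \<tau>)) \<and>
      set_integrable lebesgue {0<..<t} (\<lambda>\<tau>. mean p (u \<tau>)) \<and>
      D.history u t = (LINT \<tau>:{0<..<t}|lebesgue. source p (t - \<tau>) (u \<tau>))
        - (LINT \<tau>:{0<..<t}|lebesgue. transport v (t - \<tau>) \<tau> (u \<tau>))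
        - (LINT \<tau>:{0<..<t}|lebesgue. mean p (u \<tau>)) *\<^sub>R hartley 0" if t: "t \<in> {0..T}" for t
  proof (cases "t = 0")
    case True
    then show ?thesis by (simp add: set_integrable_def set_lebesgue_integral_def)
  next
    case False
    then have t: "0 < t" "t \<le> T" using t by auto
    have si: "set_integrable lebesgue {0<..<t} (\<lambda>\<tau>. source p (t - \<tau>) (u \<tau>))"
      "set_integrable lebesgue {0<..<t} (\<lambda>\<tau>. transport v (t - \<tau>) \<tau> (u \<tau>))"
      "set_integrable lebesgue {0<..<t} (\<lambda>\<tau>. mean p (u \<tau>) *\<^sub>R (hartley 0 :: ('n, real) L2))"
      using S.history_bounds(1)[OF u T R t] G.history_bounds(1)[OF u T R t] M.history_bounds(1)[OF u T R t]
      by (simp_all only: eq)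
    have m: "set_integrable lebesgue {0<..<t} (\<lambda>\<tau>. mean p (u \<tau>))"
    proof -
      have "integrable lebesgue (\<lambda>\<tau>. (indicator {0<..<t} \<tau> *\<^sub>R mean p (u \<tau>) *\<^sub>R (hartley 0 :: ('n, real) L2)) \<bullet> hartley 0)"
        by (rule integrable_bounded_linear[OF bounded_linear_inner_left si(3)[unfolded set_integrable_def]])
      then show ?thesis unfolding set_integrable_def by (simp add: hartley.orthonormal)
    qed
    have "D.history u t = (LINT \<tau>:{0<..<t}|lebesgue. source p (t - \<tau>) (u \<tau>) - transport v (t - \<tau>) \<tau> (u \<tau>) - mean p (u \<tau>) *\<^sub>R hartley 0)"
      unfolding D.history_def nonlinearity_def by simp
    also have "\<dots> = (LINT \<tau>:{0<..<t}|lebesgue. source p (t - \<tau>) (u \<tau>))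
        - (LINT \<tau>:{0<..<t}|lebesgue. transport v (t - \<tau>) \<tau> (u \<tau>))
        - (LINT \<tau>:{0<..<t}|lebesgue. mean p (u \<tau>) *\<^sub>R hartley 0)"
      by (simp only: set_integral_diff[OF set_integral_diff(1)[OF si(1,2)] si(3)] set_integral_diff(2)[OF si(1,2)])
    also have "(LINT \<tau>:{0<..<t}|lebesgue. mean p (u \<tau>) *\<^sub>R (hartley 0 :: ('n, real) L2)) =
        (LINT \<tau>:{0<..<t}|lebesgue. mean p (u \<tau>)) *\<^sub>R hartley 0"
      by (rule set_integral_bounded_linear_apply[OF bounded_linear_scaleR_left m])
    finally show ?thesis using si m by blast
  qed
  have one: "abs_L2 (\<lambda>_. 1) = (hartley 0 :: ('n, real) L2)" by (simp add: hartley_def)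
  have "continuous_on {0..T} u" "\<forall>t\<in>{0<..T}. \<exists>g. has_weak_gradient (u t) g"
    using u by (auto simp: x_ball_def grad_le_iff)
  then have "mild_solution p v u0 T u \<longleftrightarrow> (\<forall>t\<in>{0..T}.
      set_integrable lebesgue {0<..<t} (\<lambda>\<tau>. source p (t - \<tau>) (u \<tau>)) \<and>
      set_integrable lebesgue {0<..<t} (\<lambda>\<tau>. transport v (t - \<tau>) \<tau> (u \<tau>)) \<and>
      set_integrable lebesgue {0<..<t} (\<lambda>\<tau>. mean p (u \<tau>)) \<and>
      u t = heat t (rep_L2 u0) + (LINT \<tau>:{0<..<t}|lebesgue. source p (t - \<tau>) (u \<tau>))
        - (LINT \<tau>:{0<..<t}|lebesgue. transport v (t - \<tau>) \<tau> (u \<tau>))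
        - (LINT \<tau>:{0<..<t}|lebesgue. mean p (u \<tau>)) *\<^sub>R hartley 0)"
    unfolding mild_solution_def Let_def source_def[symmetric] transport_def[symmetric] mean_def[symmetric] one by blast
  also have "\<dots> \<longleftrightarrow> (\<forall>t\<in>{0..T}. u t = D.Phi u0 u t)"
  proof (intro ball_cong refl)
    fix t assume t: "t \<in> {0..T}"
    have "D.Phi u0 u t = heat t (rep_L2 u0) + (LINT \<tau>:{0<..<t}|lebesgue. source p (t - \<tau>) (u \<tau>))
        - (LINT \<tau>:{0<..<t}|lebesgue. transport v (t - \<tau>) \<tau> (u \<tau>))
        - (LINT \<tau>:{0<..<t}|lebesgue. mean p (u \<tau>)) *\<^sub>R hartley 0"
      unfolding D.Phi_def using *[OF t] by (simp only: add_diff_eq)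
    then show "(set_integrable lebesgue {0<..<t} (\<lambda>\<tau>. source p (t - \<tau>) (u \<tau>)) \<and>
        set_integrable lebesgue {0<..<t} (\<lambda>\<tau>. transport v (t - \<tau>) \<tau> (u \<tau>)) \<and>
        set_integrable lebesgue {0<..<t} (\<lambda>\<tau>. mean p (u \<tau>)) \<and>
        u t = heat t (rep_L2 u0) + (LINT \<tau>:{0<..<t}|lebesgue. source p (t - \<tau>) (u \<tau>))
          - (LINT \<tau>:{0<..<t}|lebesgue. transport v (t - \<tau>) \<tau> (u \<tau>))
          - (LINT \<tau>:{0<..<t}|lebesgue. mean p (u \<tau>)) *\<^sub>R hartley 0) \<longleftrightarrow> u t = D.Phi u0 u t"
      using *[OF t] by (simp only: simp_thms)
  qed
  finally show ?thesis .
qed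

lemma velocity_bound:
  fixes v :: "real \<Rightarrow> real^'n::finite \<Rightarrow> real^'n"
  assumes "in_Linf_Lq q v" "enn2real (Linf_Lq_norm q v) < V"
  shows "AE \<tau> in lebesgue. 0 < \<tau> \<longrightarrow> v \<tau> \<in> borel_measurable torus \<and> torus_norm q (v \<tau>) \<le> ennreal V"
proof -
  have fin: "Linf_Lq_norm q v < \<infinity>" and lq: "AE \<tau> in lebesgue_on {0<..}. in_Lq q (v \<tau>)"
    using assms(1) by (auto simp: in_Linf_Lq_def)
  have "Linf_Lq_norm q v = ennreal (enn2real (Linf_Lq_norm q v))" using fin by simp
  also have "\<dots> \<le> ennreal V" using assms(2) by (intro ennreal_leI) simp
  finally have le: "Linf_Lq_norm q v \<le> ennreal V" .
  have "AE \<tau> in lebesgue_on {0<..}. torus_norm q (v \<tau>) \<le> Linf_Lq_norm q v"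
    unfolding Linf_Lq_norm_def by (rule esssup_AE)
  with lq have "AE \<tau> in lebesgue_on {0<..}. v \<tau> \<in> borel_measurable torus \<and> torus_norm q (v \<tau>) \<le> ennreal V"
    by eventually_elim (use le in \<open>auto simp: in_Lq_def\<close>)
  then show ?thesis by (subst (asm) AE_restrict_space_iff) auto
qed

section \<open>The existence time\<close>

lemma small_time_exists:
  fixes c \<gamma> :: real
  assumes "0 \<le> c" "0 < \<gamma>"
  obtains T where "0 < T" "T \<le> 1" "c * T powr \<gamma> \<le> 1/2"
proof
  \<comment> \<open>Adding 1 to \<open>c\<close> keeps \<open>T\<close> positive when
    \<open>c = 0\<close>.\<close>
  define T where "T = min 1 ((1 / (2 * (c + 1))) powr (1 / \<gamma>))"
  show "0 < T" "T \<le> 1" using assms by (auto simp: T_def)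
  have "T powr \<gamma> \<le> ((1 / (2 * (c + 1))) powr (1 / \<gamma>)) powr \<gamma>"
    using \<open>0 < T\<close> assms by (intro powr_mono2) (auto simp: T_def)
  also have "\<dots> = 1 / (2 * (c + 1))" using assms by (simp add: powr_powr)
  finally have "c * T powr \<gamma> \<le> c * (1 / (2 * (c + 1)))" using assms by (intro mult_left_mono)
  also have "\<dots> \<le> 1/2" using assms by (simp add: pos_divide_le_eq)
  finally show "c * T powr \<gamma> \<le> 1/2" .
qed

theorem theorem2p2:
  fixes p :: real
  assumes "CARD('n::finite) \<ge> 2"
    and "1 \<le> p" and "p < 1 + 2 / real CARD('n)"
  shows "\<exists>life :: real \<Rightarrow> real \<Rightarrow> real.
     (\<forall>V U. 0 < life V U \<and> life V U \<le> 1) \<and>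
     (\<forall>(u0 :: ('n, real) L2) (v :: real \<Rightarrow> real^'n \<Rightarrow> real^'n).
        in_Linf_Lq (velocity_exponent p) v \<and>
        (AE t in lebesgue_on {0<..}. divergence_free (v t)) \<longrightarrow>
        (let T = life (enn2real (Linf_Lq_norm (velocity_exponent p) v)) (norm u0) in
         \<exists>u \<in> X_space T. mild_solution p v u0 T u \<and>
           (\<forall>w \<in> X_space T. mild_solution p v u0 T w \<longrightarrow> (\<forall>t\<in>{0..T}. w t = u t))))"
proof -
  let ?\<alpha> = "real CARD('n) * (p - 1) / 4"
  let ?L = "\<lambda>V R. 3 * 12 ^ CARD('n) * (12 * p * \<bar>R\<bar> + V) :: real"
  define \<gamma> where "\<gamma> = 1/2 - ?\<alpha>"
  have N: "2 \<le> real CARD('n)" using assms(1) by simp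
  have "p - 1 < 2 / real CARD('n)" using assms(3) by simp
  then have pN: "(p - 1) * real CARD('n) < 2" using N by (subst (asm) pos_less_divide_eq) auto
  have "2 / real CARD('n) \<le> 1" using N by simp
  then have "p < 2" using assms(3) by linarith
  then have p: "1 \<le> p" "p < 2" "?\<alpha> < 1/2" using assms(2) pN by (auto simp: mult.commute)
  have \<gamma>: "0 < \<gamma>" using p(3) by (simp add: \<gamma>_def)
  \<comment> \<open>The smallness hypothesis of \<open>fixed_point_exists\<close> with
    \<open>8 / \<gamma>\<close> in place of \<open>C\<close>. Absolute values make it satisfiable
    for all real arguments, since \<open>life\<close> must lie in the unit interval for every
    \<open>V\<close> and \<open>U\<close>.\<close>
  define ok where "ok V U T \<longleftrightarrow> 0 < T \<and> T \<le> 1 \<and>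
      8 / \<gamma> * ?L (\<bar>V\<bar> + 1) (2 * (\<bar>U\<bar> + 1)) * T powr \<gamma> \<le> 1/2" for V U T :: real
  have "\<exists>T. ok V U T" for V U
  proof -
    have "0 \<le> 8 / \<gamma> * ?L (\<bar>V\<bar> + 1) (2 * (\<bar>U\<bar> + 1))"
      using \<gamma> p by (intro mult_nonneg_nonneg add_nonneg_nonneg divide_nonneg_nonneg) auto
    from small_time_exists[OF this \<gamma>] show ?thesis unfolding ok_def by blast
  qed
  then have ex: "\<And>V U. \<exists>T. ok V U T" .
  define life where "life V U = (SOME T. ok V U T)" for V U
  have "ok V U (life V U)" for V U unfolding life_def by (rule someI_ex[OF ex])
  then have life: "\<And>V U. 0 < life V U" "\<And>V U. life V U \<le> 1"
    "\<And>V U. 8 / \<gamma> * ?L (\<bar>V\<bar> + 1) (2 * (\<bar>U\<bar> + 1)) * life V U powr \<gamma> \<le> 1/2"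
    unfolding ok_def by blast+
  have "\<exists>u \<in> X_space T. mild_solution p v u0 T u \<and>
      (\<forall>w \<in> X_space T. mild_solution p v u0 T w \<longrightarrow> (\<forall>t\<in>{0..T}. w t = u t))"
    if v: "in_Linf_Lq (velocity_exponent p) v"
      and T_def: "T = life (enn2real (Linf_Lq_norm (velocity_exponent p) v)) (norm u0)"
    for u0 :: "('n, real) L2" and v :: "real \<Rightarrow> real^'n \<Rightarrow> real^'n" and T
  proof -
    define V where "V = enn2real (Linf_Lq_norm (velocity_exponent p) v)"
    \<comment> \<open>The added 1 secures \<open>1 \<le> R\<close> for a vanishing datum too; the
      factor 2 leaves half of the radius to the Duhamel integral.\<close>
    define R where "R = 2 * (norm u0 + 1)"
    have V: "0 \<le> V" "0 < V + 1" by (auto simp: V_def add_nonneg_pos)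
    have R: "1 \<le> R" "norm u0 \<le> R / 2" by (auto simp: R_def)
    have T: "0 < T" "T \<le> 1" unfolding T_def by (rule life)+
    have small: "8 / \<gamma> * ?L (V + 1) R * T powr \<gamma> \<le> 1/2"
      using life(3)[where V = V and U = "norm u0"] V unfolding T_def V_def[symmetric] R_def by simp
    have sm: "strongly_measurable_Lq (velocity_exponent p) v" using v by (simp add: in_Linf_Lq_def)
    \<comment> \<open>The bound is \<open>V + 1\<close> so as to be positive also for a vanishing
      velocity.\<close>
    have good: "AE \<tau> in lebesgue. 0 < \<tau> \<longrightarrow> v \<tau> \<in> borel_measurable torus \<and>
        torus_norm (velocity_exponent p) (v \<tau>) \<le> ennreal (V + 1)"
      by (rule velocity_bound[OF v]) (simp add: V_def)
    interpret D: duhamel "nonlinearity p v 1 (-1) (-1)" ?\<alpha> "?L (V + 1)"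
      by (rule duhamel_nonlinearity[OF p V(2) sm good]) auto
    have D\<gamma>: "D.\<gamma> = \<gamma>" by (simp add: D.\<gamma>_def \<gamma>_def)
    note mild = mild_solution_iff[OF p V(2) sm good T(2)]
    have small': "D.C * ?L (V + 1) R * T powr D.\<gamma> \<le> 1/2" using small by (simp only: D.C_def D\<gamma>)
    obtain u where u: "x_ball T R u" "\<And>t. t \<in> {0..T} \<Longrightarrow> u t = D.Phi u0 u t"
      using D.fixed_point_exists[OF T R small'] by blast
    show ?thesis
    proof (intro bexI conjI ballI impI)
      show "u \<in> X_space T" by (rule x_ball_imp_X_space[OF u(1)])
      show "mild_solution p v u0 T u" unfolding mild[OF R(1) u(1)] using u(2) by blast
      fix w t assume w: "w \<in> X_space T" "mild_solution p v u0 T w" and t: "t \<in> {0..T}"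
      obtain R' where R': "1 \<le> R'" "x_ball T R' w" by (rule X_space_imp_x_ball[OF w(1)])
      have w': "w t = D.Phi u0 w t" if "t \<in> {0..T}" for t
        using w(2) that unfolding mild[OF R'] by blast
      show "w t = u t"
        \<comment> \<open>Both solutions are placed in the ball of the larger radius, for which
          \<open>T\<close> may fail to be small; uniqueness advances in steps adapted to that
          radius.\<close>
        by (rule D.fixed_point_unique[OF x_ball_mono[OF R'(2)] x_ball_mono[OF u(1)] T _ w' u(2) t, of "max R R'"])
          (use R(1) in auto)
    qed
  qed
  then show ?thesis using life(1,2) unfolding Let_def by (intro exI[of _ life]) blast
qed

end
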